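(* Let $(M,d)$ be any one of the following six sub-Finsler manifolds: $M=\mathbb{R}^3$ with $X_1=\partial_x-\tfrac{y}{2}\partial_z$, $X_2=\partial_y+\tfrac{x}{2}\partial_z$ (Heisenberg); $M=\mathbb{R}^2$ with $X_1=\partial_x$, $X_2=x\partial_y$ (Grushin); $M=\mathbb{R}^3$ with $X_1=\partial_x+y^2\partial_z$, $X_2=\partial_y$ (Martinet). In each case $d$ is the sub-Finsler distance associated with either the norm $\|\cdot\|_\infty$ or the norm $\|\cdot\|_1$ (see context) on $\mathrm{span}\{X_1,X_2\}$. Let $n=\dim M$. Then for every $r>0$ the sphere $S_r=\{q\in M: d(0,q)=r\}$ centered at the origin is homeomorphic to the Euclidean sphere $S^{n-1}$, is a Euclidean $(n-1)$-rectifiable subset of $\mathbb{R}^n$, and is a semianalytic subset of $\mathbb{R}^n$.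
   Context: For $q\in M$ and $v\in\mathrm{span}\{X_1(q),X_2(q)\}$ set $\|v\|_\infty=\min\{\max(|w_1|,|w_2|): v=w_1X_1(q)+w_2X_2(q)\}$ and $\|v\|_1=\min\{|w_1|+|w_2|: v=w_1X_1(q)+w_2X_2(q)\}$. A curve $\gamma:[0,T]\to M$ is horizontal if it is absolutely continuous and $\dot\gamma(t)\in\mathrm{span}\{X_1(\gamma(t)),X_2(\gamma(t))\}$ for a.e. $t$; its length is $\int_0^T\|\dot\gamma(t)\|\,dt$ for the chosen norm $\|\cdot\|$, and $d(p,q)$ is the infimum of lengths of horizontal curves from $p$ to $q$. *)

theory Defs
  imports "HOL-Analysis.Analysis"
begin

definition norm_inf_coeff :: "real \<Rightarrow> real \<Rightarrow> real" where
  "norm_inf_coeff w1 w2 = max \<bar>w1\<bar> \<bar>w2\<bar>"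

definition norm_one_coeff :: "real \<Rightarrow> real \<Rightarrow> real" where
  "norm_one_coeff w1 w2 = \<bar>w1\<bar> + \<bar>w2\<bar>"

definition sf_norm ::
  "(real \<Rightarrow> real \<Rightarrow> real) \<Rightarrow> ('a::real_vector \<Rightarrow> 'a) \<Rightarrow> ('a \<Rightarrow> 'a) \<Rightarrow> 'a \<Rightarrow> 'a \<Rightarrow> real" where
  "sf_norm N X1 X2 q v = Inf {N w1 w2 | w1 w2. v = w1 *\<^sub>R X1 q + w2 *\<^sub>R X2 q}"

definition abs_continuous_on :: "real \<Rightarrow> real \<Rightarrow> (real \<Rightarrow> 'a::real_normed_vector) \<Rightarrow> bool" where
  "abs_continuous_on a b \<gamma> \<longleftrightarrow>
     (\<forall>\<epsilon>>0. \<exists>\<delta>>0. \<forall>(n::nat) (s::nat \<Rightarrow> real) (t::nat \<Rightarrow> real).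
        (\<forall>i<n. a \<le> s i \<and> s i \<le> t i \<and> t i \<le> b) \<and>
        (\<forall>i. Suc i < n \<longrightarrow> t i \<le> s (Suc i)) \<and>
        (\<Sum>i<n. t i - s i) < \<delta>
        \<longrightarrow> (\<Sum>i<n. norm (\<gamma> (t i) - \<gamma> (s i))) < \<epsilon>)"

definition horizontal ::
  "('a::euclidean_space \<Rightarrow> 'a) \<Rightarrow> ('a \<Rightarrow> 'a) \<Rightarrow> real \<Rightarrow> (real \<Rightarrow> 'a) \<Rightarrow> bool" where
  "horizontal X1 X2 T \<gamma> \<longleftrightarrow>
     abs_continuous_on 0 T \<gamma> \<and>
     (AE t in lborel. t \<in> {0..T} \<longrightarrow>
        \<gamma> differentiable (at t within {0..T}) \<and>
        vector_derivative \<gamma> (at t within {0..T}) \<in> span {X1 (\<gamma> t), X2 (\<gamma> t)})"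

definition sf_length ::
  "(real \<Rightarrow> real \<Rightarrow> real) \<Rightarrow> ('a::euclidean_space \<Rightarrow> 'a) \<Rightarrow> ('a \<Rightarrow> 'a) \<Rightarrow> real \<Rightarrow> (real \<Rightarrow> 'a) \<Rightarrow> ennreal" where
  "sf_length N X1 X2 T \<gamma> =
     (\<integral>\<^sup>+ t. indicator {0..T} t *
        ennreal (sf_norm N X1 X2 (\<gamma> t) (vector_derivative \<gamma> (at t within {0..T}))) \<partial>lborel)"

definition sf_dist ::
  "(real \<Rightarrow> real \<Rightarrow> real) \<Rightarrow> ('a::euclidean_space \<Rightarrow> 'a) \<Rightarrow> ('a \<Rightarrow> 'a) \<Rightarrow> 'a \<Rightarrow> 'a \<Rightarrow> ennreal" where
  "sf_dist N X1 X2 p q =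
     Inf {sf_length N X1 X2 T \<gamma> | T \<gamma>. 0 \<le> T \<and> horizontal X1 X2 T \<gamma> \<and> \<gamma> 0 = p \<and> \<gamma> T = q}"

definition sf_sphere ::
  "(real \<Rightarrow> real \<Rightarrow> real) \<Rightarrow> ('a::euclidean_space \<Rightarrow> 'a) \<Rightarrow> ('a \<Rightarrow> 'a) \<Rightarrow> real \<Rightarrow> 'a set" where
  "sf_sphere N X1 X2 r = {q. sf_dist N X1 X2 0 q = ennreal r}"

text \<open>Coordinates: x = q$1, y = q$2, z = q$3.\<close>
definition heis_X1 :: "real^3 \<Rightarrow> real^3" where
  "heis_X1 q = vector [1, 0, - (q$2) / 2]"
definition heis_X2 :: "real^3 \<Rightarrow> real^3" where
  "heis_X2 q = vector [0, 1, (q$1) / 2]"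

definition grushin_X1 :: "real^2 \<Rightarrow> real^2" where
  "grushin_X1 q = vector [1, 0]"
definition grushin_X2 :: "real^2 \<Rightarrow> real^2" where
  "grushin_X2 q = vector [0, q$1]"

definition martinet_X1 :: "real^3 \<Rightarrow> real^3" where
  "martinet_X1 q = vector [1, 0, (q$2)^2]"
definition martinet_X2 :: "real^3 \<Rightarrow> real^3" where
  "martinet_X2 q = vector [0, 1, 0]"

definition hausdorff_measure :: "nat \<Rightarrow> 'a::euclidean_space set \<Rightarrow> ennreal" where
  "hausdorff_measure m A =
     (SUP \<delta>\<in>{0<..}. INF C\<in>{C :: nat \<Rightarrow> 'a set. A \<subseteq> (\<Union>i. C i) \<and>
                                 (\<forall>i. bounded (C i) \<and> diameter (C i) \<le> \<delta>)}.
        (\<Sum>i. ennreal (unit_ball_vol (real m) / 2 ^ m * diameter (C i) ^ m)))"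

definition rectifiable_set :: "'m::euclidean_space itself \<Rightarrow> 'a::euclidean_space set \<Rightarrow> bool" where
  "rectifiable_set _ S \<longleftrightarrow>
     (\<exists>f :: nat \<Rightarrow> 'm \<Rightarrow> 'a. (\<forall>i. \<exists>L. L-lipschitz_on UNIV (f i)) \<and>
        hausdorff_measure DIM('m) (S - (\<Union>i. range (f i))) = 0)"

definition real_analytic_on :: "(real^'n) set \<Rightarrow> (real^'n \<Rightarrow> real) \<Rightarrow> bool" where
  "real_analytic_on U f \<longleftrightarrow>
     (\<forall>p\<in>U. \<exists>r>0. \<exists>c :: ('n \<Rightarrow> nat) \<Rightarrow> real. \<forall>x\<in>ball p r.
        ((\<lambda>\<alpha>. c \<alpha> * (\<Prod>i\<in>UNIV. (x$i - p$i) ^ \<alpha> i)) has_sum f x) UNIV)"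

definition semianalytic :: "(real^'n) set \<Rightarrow> bool" where
  "semianalytic S \<longleftrightarrow>
     (\<forall>x. \<exists>U. open U \<and> x \<in> U \<and>
        (\<exists>(p::nat) (q::nat) (f :: nat \<Rightarrow> nat \<Rightarrow> real^'n \<Rightarrow> real) (g :: nat \<Rightarrow> nat \<Rightarrow> real^'n \<Rightarrow> real).
           (\<forall>i<p. \<forall>j<q. real_analytic_on U (f i j) \<and> real_analytic_on U (g i j)) \<and>
           S \<inter> U = (\<Union>i<p. {y \<in> U. \<forall>j<q. f i j y = 0 \<and> g i j y > 0})))"

end

theory Submission
  imports Defs
begin

text \<open>In each of the six cases the closed ball of radius \<open>L\<close> about the origin is
  \<open>{q. \<ell> q \<le> L \<and> - V L q \<le> q $ v \<and> q $ v \<le> U L q}\<close>, where \<open>v\<close> is the last coordinate and \<open>\<ell>\<close>, \<open>U L\<close>, \<open>V L\<close>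
  are explicit continuous piecewise polynomial functions of the other coordinates.
  That nothing outside this set is reached is shown by calibrations: if the derivative of \<open>\<phi>\<close> in every
  horizontal direction is at most \<open>C\<close> times the norm, then \<open>\<phi>\<close> increases by at most \<open>C\<close> times the length.
  The curve is cut at the times where a horizontal coordinate is extremal and a different \<open>\<phi>\<close> is used on each
  piece. Conversely, every point of the set is the end of a path with piecewise constant controls.
  Appending a short loop to such a path moves only the last coordinate, so the sphere is the ball minus
  the set where all inequalities are strict; it is semialgebraic and covered by finitely many graphs of
  polynomials. Every dilation orbit meets it once, which gives the homeomorphism.\<close>

section \<open>Absolutely continuous curves and calibrations\<close>

text \<open>The speed \<open>sf_norm\<close> of a horizontal curve is not shown to be measurable, so
  lengths are lower integrals; only superadditivity over arcs, scaling by a constant and comparison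
  are used, and calibrations get by with these. The constant of a calibration may depend on the
  curve, through the extremal value or the range of the coordinate at which the curve is cut. The
  resulting bound is a function of that value, and \<open>U\<close> and \<open>V\<close> are its
  maxima over the values that the length permits; hence the clamps \<open>max a (min b c)\<close>, a
  free maximiser moved into the admissible interval. The same maximiser prescribes the path that
  attains the bound. For the Martinet distribution with the sup norm a single calibration for each
  peak is not sharp: a family with two parameters acts as Lagrange multipliers, and their right
  choice depends on whether the peak is free or clamped. The short loops settle a separate point,
  that a point of a closed ball satisfies the inequalities of every larger ball strictly; without
  this the distance could not be read off from them.\<close>

lemma abs_continuous_on_disjoint_intervals:
  fixes \<Phi> :: "real \<Rightarrow> 'a::real_normed_vector"
  assumes ac: "abs_continuous_on a b \<Phi>" and e: "\<epsilon> > 0"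
  shows "\<exists>\<delta>>0. \<forall>(I::'i set) u v. finite I \<longrightarrow> (\<forall>i\<in>I. a \<le> u i \<and> u i < v i \<and> v i \<le> b) \<longrightarrow>
     disjoint_family_on (\<lambda>i. {u i<..<v i}) I \<longrightarrow> (\<Sum>i\<in>I. v i - u i) < \<delta> \<longrightarrow>
     (\<Sum>i\<in>I. norm (\<Phi> (v i) - \<Phi> (u i))) < \<epsilon>"
proof -
  obtain \<delta> where d: "\<delta> > 0" and D: "\<And>(n::nat) (s::nat \<Rightarrow> real) (t::nat \<Rightarrow> real).
        (\<forall>i<n. a \<le> s i \<and> s i \<le> t i \<and> t i \<le> b) \<and>
        (\<forall>i. Suc i < n \<longrightarrow> t i \<le> s (Suc i)) \<and>
        (\<Sum>i<n. t i - s i) < \<delta>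
        \<Longrightarrow> (\<Sum>i<n. norm (\<Phi> (t i) - \<Phi> (s i))) < \<epsilon>"
    using ac[unfolded abs_continuous_on_def, rule_format, OF e] by blast
  have "(\<Sum>i\<in>I. norm (\<Phi> (v i) - \<Phi> (u i))) < \<epsilon>"
    if fin: "finite I" and uv: "\<And>i. i\<in>I \<Longrightarrow> a \<le> u i \<and> u i < v i \<and> v i \<le> b"
     and dis: "disjoint_family_on (\<lambda>i. {u i<..<v i}) I" and sm: "(\<Sum>i\<in>I. v i - u i) < \<delta>"
    for I :: "'i set" and u v
  proof -
    have sep: "v i \<le> u j" if "i \<in> I" "j \<in> I" "i \<noteq> j" "u i \<le> u j" for i j
    proof (rule ccontr)
      assume "\<not> v i \<le> u j"
      then have "(u j + min (v i) (v j)) / 2 \<in> {u i<..<v i} \<inter> {u j<..<v j}"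
        using that uv[of i] uv[of j] by (auto simp: min_def)
      then show False using dis that unfolding disjoint_family_on_def by blast
    qed
    \<comment> \<open>The definition asks for consecutive intervals, a tagged division supplies an
      unordered family. Strictness of \<open>u i < v i\<close> enters here: nondegenerate intervals
      with disjoint interiors cannot share a left endpoint, so sorting the left endpoints loses no
      interval.\<close>
    have inj: "inj_on u I"
    proof (rule inj_onI, rule ccontr)
      fix i j assume *: "i \<in> I" "j \<in> I" "u i = u j" "i \<noteq> j"
      from sep[of i j] * uv[of i] show False by auto
    qed
    define xs where "xs = sorted_list_of_set (u ` I)"
    have fA: "finite (u ` I)" using fin by simp
    have xs: "sorted xs" "distinct xs" "set xs = u ` I" unfolding xs_def using fA by auto
    define w where "w y = v (inv_into I u y)" for y
    have w: "w (u i) = v i" if "i \<in> I" for i unfolding w_def using inj that by simp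
    define s where "s = (\<lambda>k. xs ! k)"
    define t where "t = (\<lambda>k. w (xs ! k))"
    have nth: "\<exists>i\<in>I. s k = u i \<and> t k = v i" if "k < length xs" for k
    proof -
      have "xs ! k \<in> u ` I" using that xs(3) nth_mem by blast
      then show ?thesis unfolding s_def t_def using w by auto
    qed
    have tr: "(\<Sum>k<length xs. g (s k) (t k)) = (\<Sum>i\<in>I. g (u i) (v i))" for g :: "real \<Rightarrow> real \<Rightarrow> real"
    proof -
      have "(\<Sum>k<length xs. g (s k) (t k)) = sum_list (map (\<lambda>y. g y (w y)) xs)"
        unfolding s_def t_def by (simp add: sum_list_sum_nth atLeast0LessThan)
      also have "\<dots> = (\<Sum>y\<in>u ` I. g y (w y))"
        using xs by (metis sum.distinct_set_conv_list)
      also have "\<dots> = (\<Sum>i\<in>I. g (u i) (v i))"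
        by (simp add: sum.reindex[OF inj] w)
      finally show ?thesis .
    qed
    have "(\<Sum>k<length xs. norm (\<Phi> (t k) - \<Phi> (s k))) < \<epsilon>"
    proof (rule D, intro conjI allI impI)
      fix k assume "k < length xs"
      from nth[OF this] uv show "a \<le> s k" "s k \<le> t k" "t k \<le> b" by (auto simp: less_imp_le)
    next
      fix k assume k: "Suc k < length xs"
      then have "s k < s (Suc k)" unfolding s_def
        using xs(1,2) by (simp add: sorted_wrt_nth_less strict_sorted_iff)
      moreover obtain i where "i \<in> I" "s k = u i" "t k = v i" using nth[of k] k by auto
      moreover obtain j where "j \<in> I" "s (Suc k) = u j" using nth[of "Suc k"] k by auto
      ultimately show "t k \<le> s (Suc k)" using sep[of i j] by auto
    next
      show "(\<Sum>i<length xs. t i - s i) < \<delta>" using tr[of "\<lambda>x y. y - x"] sm by simp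
    qed
    then show ?thesis using tr[of "\<lambda>x y. norm (\<Phi> y - \<Phi> x)"] by simp
  qed
  then show ?thesis using d by (intro exI[of _ \<delta>] conjI allI impI) auto
qed

text \<open>Integrability of \<open>f\<close> is part of the claim, so the gauge integral is used
  directly. The null set is enclosed in an open set so small that absolute continuity bounds the
  increments of \<open>\<Phi>\<close> over the intervals tagged in \<open>N\<close>, where
  \<open>f\<close> is 0; at the other tags \<open>\<Phi>\<close> is differentiable.\<close>

lemma fundamental_theorem_of_calculus_abs_continuous:
  fixes \<Phi> :: "real \<Rightarrow> real"
  assumes ab: "a \<le> b" and ac: "abs_continuous_on a b \<Phi>" and N: "N \<in> null_sets lebesgue"
    and der: "\<And>t. t \<in> {a..b} - N \<Longrightarrow> (\<Phi> has_real_derivative f t) (at t within {a..b})"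
    and zero: "\<And>t. t \<in> N \<Longrightarrow> f t = 0"
  shows "(f has_integral (\<Phi> b - \<Phi> a)) {a..b}"
proof (cases "a < b")
  case False then show ?thesis using ab by auto
next
  case True
  show ?thesis unfolding has_integral_factor_content_real
  proof (intro allI impI)
    fix e :: real assume e: "e > 0"
    \<comment> \<open>One half of \<open>e\<close> pays for the tags outside \<open>N\<close>, the
      other half for those in \<open>N\<close>.\<close>
    define \<epsilon> where "\<epsilon> = e / 2"
    have \<epsilon>: "\<epsilon> > 0" using e unfolding \<epsilon>_def by simp
    have \<epsilon>': "\<epsilon> * (b - a) > 0" using \<epsilon> True by simp
    obtain \<delta> where \<delta>: "\<delta> > 0" and D: "\<And>(I::(real \<times> real set) set) u v. finite I \<Longrightarrow> (\<forall>i\<in>I. a \<le> u i \<and> u i < v i \<and> v i \<le> b) \<Longrightarrow>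
       disjoint_family_on (\<lambda>i. {u i<..<v i}) I \<Longrightarrow> (\<Sum>i\<in>I. v i - u i) < \<delta> \<Longrightarrow>
       (\<Sum>i\<in>I. norm (\<Phi> (v i) - \<Phi> (u i))) < \<epsilon> * (b - a)"
      using abs_continuous_on_disjoint_intervals[OF ac \<epsilon>'] by blast
    obtain T where T: "open T" "N \<subseteq> T" "T - N \<in> lmeasurable" "emeasure lebesgue (T - N) < ennreal \<delta>"
      using sets_lebesgue_outer_open[of N \<delta>] N \<delta> by blast
    have emT: "emeasure lebesgue T < ennreal \<delta>"
    proof -
      have "emeasure lebesgue T = emeasure lebesgue ((T - N) \<union> N)" using T(2) by (simp add: Un_absorb2)
      also have "\<dots> \<le> emeasure lebesgue (T - N) + emeasure lebesgue N"
        using T(3) N by (intro emeasure_subadditive) (auto dest: fmeasurableD)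
      also have "\<dots> = emeasure lebesgue (T - N)" using null_setsD1[OF N] by simp
      finally show ?thesis using T(4) by simp
    qed
    have "\<exists>d>0. x \<in> {a..b} - N \<longrightarrow>
         (\<forall>y\<in>{a..b}. norm (y-x) < d \<longrightarrow> norm (\<Phi> y - \<Phi> x - f x * (y - x)) \<le> \<epsilon> * norm (y-x))" for x
      using der[of x] \<epsilon> unfolding has_field_derivative_def has_derivative_within_alt
      by (cases "x \<in> {a..b} - N") (auto intro: exI[of _ 1])
    then obtain d where d: "\<And>x. 0 < d x"
                 "\<And>x y. \<lbrakk>x \<in> {a..b} - N; y \<in> {a..b}; norm (y-x) < d x\<rbrakk>
                        \<Longrightarrow> norm (\<Phi> y - \<Phi> x - f x * (y - x)) \<le> \<epsilon> * norm (y-x)"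
      by metis
    \<comment> \<open>Fineness keeps the intervals tagged in \<open>N\<close> inside
      \<open>T\<close>, so their total length is below \<open>\<delta>\<close>; every other interval
      is short enough for the linear approximation at its tag.\<close>
    define g where "g x = (if x \<in> N then T else ball x (d x))" for x
    have gg: "gauge g" unfolding gauge_def g_def using d(1) T(1,2) by (auto simp: subset_iff)
    show "\<exists>g. gauge g \<and> (\<forall>p. p tagged_division_of {a..b} \<and> g fine p \<longrightarrow>
        norm ((\<Sum>(x, k)\<in>p. measure lborel k *\<^sub>R f x) - (\<Phi> b - \<Phi> a)) \<le> e * measure lborel {a..b})"
    proof (intro exI[of _ g] conjI gg allI impI)
      fix p assume p: "p tagged_division_of {a..b} \<and> g fine p"
      then have ptag: "p tagged_division_of {a..b}" and fine: "\<And>x K. (x,K) \<in> p \<Longrightarrow> K \<subseteq> g x"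
        by (auto simp: fine_def)
      note pd = tagged_division_ofD[OF ptag]
      have K: "\<exists>u v. K = {u..v} \<and> u \<le> x \<and> x \<le> v \<and> a \<le> u \<and> v \<le> b \<and> Inf K = u \<and> Sup K = v \<and> measure lborel K = v - u \<and> interior K = {u<..<v}"
        if xK: "(x,K) \<in> p" for x K
      proof -
        obtain u v where uv: "K = {u..v}" using pd(4)[OF xK] by auto
        have x: "x \<in> K" using pd(2)[OF xK] .
        have "K \<subseteq> {a..b}" using pd(3)[OF xK] .
        then show ?thesis using uv x by (intro exI[of _ u] exI[of _ v]) auto
      qed
      have ba: "b - a = (\<Sum>(x,K)\<in>p. Sup K - Inf K)" "\<Phi> b - \<Phi> a = (\<Sum>(x,K)\<in>p. \<Phi>(Sup K) - \<Phi>(Inf K))"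
        using additive_tagged_division_1[where f= "\<lambda>x. x"] additive_tagged_division_1[where f= \<Phi>]
            ab ptag by auto
      \<comment> \<open>Degenerate intervals are dropped: they contribute nothing, and
        \<open>abs_continuous_on_disjoint_intervals\<close> asks for
        \<open>u i < v i\<close>.\<close>
      define q where "q = {z \<in> p. fst z \<in> N \<and> Inf (snd z) < Sup (snd z)}"
      have fq: "finite q" using pd(1) unfolding q_def by simp
      have dis: "disjoint_family_on (\<lambda>i. {Inf (snd i)<..<Sup (snd i)}) q"
        unfolding disjoint_family_on_def
      proof (intro ballI impI)
        fix z z' assume *: "z \<in> q" "z' \<in> q" "z \<noteq> z'"
        obtain x K x' K' where [simp]: "z = (x,K)" "z' = (x',K')" by fastforce
        have "interior K \<inter> interior K' = {}" using pd(5)[of x K x' K'] * unfolding q_def by auto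
        moreover have "interior K = {Inf K<..<Sup K}" using K[of x K] * unfolding q_def by auto
        moreover have "interior K' = {Inf K'<..<Sup K'}" using K[of x' K'] * unfolding q_def by auto
        ultimately show "{Inf (snd z)<..<Sup (snd z)} \<inter> {Inf (snd z')<..<Sup (snd z')} = {}" by simp
      qed
      have qprop: "a \<le> Inf (snd z) \<and> Inf (snd z) < Sup (snd z) \<and> Sup (snd z) \<le> b" "{Inf (snd z)<..<Sup (snd z)} \<subseteq> T"
        if "z \<in> q" for z
      proof -
        obtain x k where z: "z = (x,k)" by fastforce
        have zp: "(x,k) \<in> p" "x \<in> N" "Inf k < Sup k" using that z unfolding q_def by auto
        obtain u v where uv: "k = {u..v}" "a \<le> u" "v \<le> b" "Inf k = u" "Sup k = v" using K[OF zp(1)] by blast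
        show "a \<le> Inf (snd z) \<and> Inf (snd z) < Sup (snd z) \<and> Sup (snd z) \<le> b" using uv zp z by simp
        have "k \<subseteq> T" using fine[OF zp(1)] zp(2) unfolding g_def by simp
        then show "{Inf (snd z)<..<Sup (snd z)} \<subseteq> T" using uv z by auto
      qed
      have "ennreal (\<Sum>z\<in>q. Sup (snd z) - Inf (snd z)) = (\<Sum>z\<in>q. emeasure lebesgue {Inf (snd z)<..<Sup (snd z)})"
        using qprop by (subst sum_ennreal[symmetric]) (auto intro!: sum.cong simp: less_imp_le)
      also have "\<dots> = emeasure lebesgue (\<Union>z\<in>q. {Inf (snd z)<..<Sup (snd z)})"
        by (rule sum_emeasure) (use dis fq in auto)
      also have "\<dots> \<le> emeasure lebesgue T"
        by (rule emeasure_mono) (use qprop(2) T(1) in blast, use T(1) in auto)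
      finally have "ennreal (\<Sum>z\<in>q. Sup (snd z) - Inf (snd z)) < ennreal \<delta>" using emT by simp
      then have "(\<Sum>z\<in>q. Sup (snd z) - Inf (snd z)) < \<delta>"
        using \<delta> by (simp add: ennreal_less_iff sum_nonneg qprop less_imp_le)
      then have q1: "(\<Sum>z\<in>q. norm (\<Phi> (Sup (snd z)) - \<Phi> (Inf (snd z)))) < \<epsilon> * (b - a)"
        using D[OF fq _ dis] qprop by blast
      have ptw: "norm (case z of (x,K) \<Rightarrow> measure lborel K *\<^sub>R f x - (\<Phi>(Sup K) - \<Phi>(Inf K)))
          \<le> \<epsilon> * (Sup (snd z) - Inf (snd z)) + (if z \<in> q then norm (\<Phi> (Sup (snd z)) - \<Phi> (Inf (snd z))) else 0)"
        if zp: "z \<in> p" for z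
      proof -
        obtain x k where z: "z = (x,k)" by fastforce
        obtain u v where uv: "k = {u..v}" "u \<le> x" "x \<le> v" "a \<le> u" "v \<le> b" "Inf k = u" "Sup k = v" "measure lborel k = v - u"
          using K[of x k] zp z by blast
        show ?thesis
        proof (cases "x \<in> N")
          case True
          have "norm (measure lborel k *\<^sub>R f x - (\<Phi>(Sup k) - \<Phi>(Inf k))) = norm (\<Phi> v - \<Phi> u)" using zero[OF True] uv by (simp add: norm_minus_commute)
          moreover have "\<epsilon> * (v - u) \<ge> 0" using uv \<epsilon> by simp
          moreover have "z \<in> q \<or> u = v" using True zp z uv unfolding q_def by auto
          ultimately show ?thesis using z uv by auto
        next
          case False
          have sub: "{u..v} \<subseteq> ball x (d x)" using fine[of x k] zp z False uv unfolding g_def by auto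
          have "u \<in> {u..v}" "v \<in> {u..v}" using uv(2,3) by auto
          then have "u \<in> ball x (d x)" "v \<in> ball x (d x)" using sub by blast+
          then have uu: "norm (u - x) < d x" and vv: "norm (v - x) < d x"
            by (auto simp: dist_norm norm_minus_commute)
          \<comment> \<open>The interval is cut at its tag and the linear approximation is applied
            to both halves.\<close>
          have "norm (\<Phi> u - \<Phi> x - f x * (u - x)) \<le> \<epsilon> * norm (u - x)" by (rule d(2)) (use uu uv False in auto)
          moreover have "norm (\<Phi> v - \<Phi> x - f x * (v - x)) \<le> \<epsilon> * norm (v - x)" by (rule d(2)) (use vv uv False in auto)
          moreover have "(v - u) * f x - (\<Phi> v - \<Phi> u) = (\<Phi> u - \<Phi> x - f x * (u - x)) - (\<Phi> v - \<Phi> x - f x * (v - x))"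
            by (simp add: algebra_simps)
          moreover have "\<epsilon> * norm (u - x) + \<epsilon> * norm (v - x) = \<epsilon> * (v - u)"
            using uv by (simp add: algebra_simps)
          ultimately have "norm ((v - u) * f x - (\<Phi> v - \<Phi> u)) \<le> \<epsilon> * (v - u)" by (smt (verit) norm_triangle_ineq4)
          then show ?thesis using z uv by (auto intro: add_increasing2)
        qed
      qed
      have "norm ((\<Sum>(x, k)\<in>p. measure lborel k *\<^sub>R f x) - (\<Phi> b - \<Phi> a))
          = norm (\<Sum>z\<in>p. case z of (x,K) \<Rightarrow> measure lborel K *\<^sub>R f x - (\<Phi>(Sup K) - \<Phi>(Inf K)))"
        unfolding ba(2) sum_subtractf[symmetric] by (rule arg_cong[of _ _ norm], rule sum.cong) auto
      also have "\<dots> \<le> (\<Sum>z\<in>p. \<epsilon> * (Sup (snd z) - Inf (snd z)) + (if z \<in> q then norm (\<Phi> (Sup (snd z)) - \<Phi> (Inf (snd z))) else 0))"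
        by (rule sum_norm_le) (rule ptw)
      also have "\<dots> = \<epsilon> * (b - a) + (\<Sum>z\<in>p. if z \<in> q then norm (\<Phi> (Sup (snd z)) - \<Phi> (Inf (snd z))) else 0)"
        unfolding ba(1) by (simp add: sum.distrib sum_distrib_left case_prod_unfold)
      also have "(\<Sum>z\<in>p. if z \<in> q then norm (\<Phi> (Sup (snd z)) - \<Phi> (Inf (snd z))) else 0) = (\<Sum>z\<in>q. norm (\<Phi> (Sup (snd z)) - \<Phi> (Inf (snd z))))"
        using pd(1) by (simp add: sum.If_cases Int_absorb1 q_def Collect_conj_eq[symmetric] Int_def)
      also have "\<epsilon> * (b - a) + \<dots> \<le> e * (b - a)" using q1 unfolding \<epsilon>_def by (simp add: field_simps)
      finally show "norm ((\<Sum>(x, k)\<in>p. measure lborel k *\<^sub>R f x) - (\<Phi> b - \<Phi> a)) \<le> e * measure lborel {a..b}"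
        using ab by simp
    qed
  qed
qed

text \<open>For a nonmeasurable \<open>f\<close> the integral is the supremum over simple functions
  below \<open>f\<close>. A simple function below \<open>c * f\<close> becomes a competitor for
  \<open>f\<close> after division by \<open>c\<close>.\<close>

lemma nn_integral_cmult_le:
  assumes "0 \<le> c"
  shows "(\<integral>\<^sup>+x. ennreal c * f x \<partial>M) \<le> ennreal c * (\<integral>\<^sup>+x. f x \<partial>M)"
proof (cases "c = 0")
  case False
  then have c: "c > 0" using assms by simp
  show ?thesis unfolding nn_integral_def[of M "\<lambda>x. ennreal c * f x"]
  proof (rule SUP_least, clarsimp)
    fix g assume g: "simple_function M g" "g \<le> (\<lambda>x. ennreal c * f x)"
    have inv: "ennreal c * (ennreal (1/c) * y) = y" "ennreal (1/c) * (ennreal c * y) = y" for y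
      using c by (simp_all add: mult.assoc[symmetric] ennreal_mult[symmetric])
    have gm: "g \<in> borel_measurable M" using g(1) by (rule borel_measurable_simple_function)
    have "integral\<^sup>S M g = (\<integral>\<^sup>+x. g x \<partial>M)" using g(1) by (simp add: nn_integral_eq_simple_integral)
    also have "\<dots> = (\<integral>\<^sup>+x. ennreal c * (ennreal (1/c) * g x) \<partial>M)" by (simp only: inv)
    also have "\<dots> = ennreal c * (\<integral>\<^sup>+x. ennreal (1/c) * g x \<partial>M)"
      using gm by (intro nn_integral_cmult) auto
    also have "\<dots> \<le> ennreal c * (\<integral>\<^sup>+x. f x \<partial>M)"
    proof (intro mult_left_mono nn_integral_mono)
      fix x have "ennreal (1/c) * g x \<le> ennreal (1/c) * (ennreal c * f x)"
        using g(2) by (intro mult_left_mono) (auto simp: le_fun_def)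
      then show "ennreal (1/c) * g x \<le> f x" by (simp only: inv)
    qed simp
    finally show "integral\<^sup>S M g \<le> ennreal c * (\<integral>\<^sup>+x. f x \<partial>M)" .
  qed
qed simp

text \<open>The sum of two simple minorants is a simple minorant of the sum. For nonmeasurable
  functions the converse inequality may fail; this is the direction in which lengths of arcs are
  added.\<close>

lemma nn_integral_superadditive:
  "(\<integral>\<^sup>+x. f x \<partial>M) + (\<integral>\<^sup>+x. g x \<partial>M) \<le> (\<integral>\<^sup>+x. f x + g x \<partial>M)"
proof -
  have *: "integral\<^sup>S M u + integral\<^sup>S M v \<le> (\<integral>\<^sup>+x. f x + g x \<partial>M)"
    if u: "simple_function M u" "u \<le> f" and v: "simple_function M v" "v \<le> g" for u v
  proof -
    have "integral\<^sup>S M u + integral\<^sup>S M v = (\<integral>\<^sup>+x. u x + v x \<partial>M)"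
      using u(1) v(1) by (subst nn_integral_add) (auto simp: nn_integral_eq_simple_integral borel_measurable_simple_function)
    also have "\<dots> \<le> (\<integral>\<^sup>+x. f x + g x \<partial>M)"
      using u v by (intro nn_integral_mono add_mono) (auto simp: le_fun_def)
    finally show ?thesis .
  qed
  have ne: "{u. simple_function M u \<and> u \<le> h} \<noteq> {}" for h :: "'a \<Rightarrow> ennreal"
    by (auto intro!: exI[of _ "\<lambda>_. 0"] simp: le_fun_def)
  have "integral\<^sup>S M u + (\<integral>\<^sup>+x. g x \<partial>M) \<le> (\<integral>\<^sup>+x. f x + g x \<partial>M)"
    if u: "simple_function M u" "u \<le> f" for u
    unfolding nn_integral_def[of M g]
    by (subst ennreal_SUP_add_right[OF ne]) (auto intro!: SUP_least *[OF u])
  then show ?thesis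
    unfolding nn_integral_def[of M f]
    by (subst ennreal_SUP_add_left[OF ne, symmetric]) (auto intro!: SUP_least)
qed

lemma abs_continuous_on_imp_continuous_on:
  assumes "abs_continuous_on a b \<gamma>"
  shows "continuous_on {a..b} \<gamma>"
  unfolding continuous_on_iff
proof (intro ballI allI impI)
  fix x e :: real assume x: "x \<in> {a..b}" and e: "e > 0"
  obtain d where d: "d > 0" and D: "\<And>(n::nat) (s::nat \<Rightarrow> real) (t::nat \<Rightarrow> real).
        (\<forall>i<n. a \<le> s i \<and> s i \<le> t i \<and> t i \<le> b) \<and>
        (\<forall>i. Suc i < n \<longrightarrow> t i \<le> s (Suc i)) \<and>
        (\<Sum>i<n. t i - s i) < d
        \<Longrightarrow> (\<Sum>i<n. norm (\<gamma> (t i) - \<gamma> (s i))) < e"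
    using assms[unfolded abs_continuous_on_def, rule_format, OF e] by blast
  show "\<exists>d>0. \<forall>x'\<in>{a..b}. dist x' x < d \<longrightarrow> dist (\<gamma> x') (\<gamma> x) < e"
  proof (intro exI[of _ d] conjI d ballI impI)
    fix y assume y: "y \<in> {a..b}" "dist y x < d"
    show "dist (\<gamma> y) (\<gamma> x) < e"
      using D[of 1 "\<lambda>_. x" "\<lambda>_. y"] D[of 1 "\<lambda>_. y" "\<lambda>_. x"] x y
      by (cases "x \<le> y") (auto simp: dist_norm norm_minus_commute)
  qed
qed

lemma abs_continuous_on_lipschitz_compose:
  assumes ac: "abs_continuous_on a b \<gamma>" and B: "B-lipschitz_on S \<phi>"
    and S: "\<And>\<tau>. \<tau> \<in> {s..t} \<Longrightarrow> \<gamma> \<tau> \<in> S" and st: "a \<le> s" "t \<le> b"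
  shows "abs_continuous_on s t (\<lambda>\<tau>. \<phi> (\<gamma> \<tau>))"
  unfolding abs_continuous_on_def
proof (intro allI impI)
  fix e :: real assume e: "e > 0"
  have B0: "B \<ge> 0" using B lipschitz_on_nonneg by blast
  \<comment> \<open>\<open>B + 1\<close> is positive also when \<open>B = 0\<close>.\<close>
  then have e': "e / (B + 1) > 0" using e by simp
  obtain d where d: "d > 0" and D: "\<And>(n::nat) (u::nat \<Rightarrow> real) (v::nat \<Rightarrow> real).
        (\<forall>i<n. a \<le> u i \<and> u i \<le> v i \<and> v i \<le> b) \<and>
        (\<forall>i. Suc i < n \<longrightarrow> v i \<le> u (Suc i)) \<and>
        (\<Sum>i<n. v i - u i) < d
        \<Longrightarrow> (\<Sum>i<n. norm (\<gamma> (v i) - \<gamma> (u i))) < e / (B + 1)"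
    using ac[unfolded abs_continuous_on_def, rule_format, OF e'] by blast
  show "\<exists>\<delta>>0. \<forall>n u v. (\<forall>i<n. s \<le> u i \<and> u i \<le> v i \<and> v i \<le> t) \<and>
            (\<forall>i. Suc i < n \<longrightarrow> v i \<le> u (Suc i)) \<and> (\<Sum>i<n. v i - u i) < \<delta> \<longrightarrow>
            (\<Sum>i<n. norm (\<phi> (\<gamma> (v i)) - \<phi> (\<gamma> (u i)))) < e"
  proof (intro exI[of _ d] conjI d allI impI)
    fix n :: nat and u v :: "nat \<Rightarrow> real"
    assume *: "(\<forall>i<n. s \<le> u i \<and> u i \<le> v i \<and> v i \<le> t) \<and>
            (\<forall>i. Suc i < n \<longrightarrow> v i \<le> u (Suc i)) \<and> (\<Sum>i<n. v i - u i) < d"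
    then have "(\<Sum>i<n. norm (\<gamma> (v i) - \<gamma> (u i))) < e / (B + 1)"
      using st by (intro D) force
    moreover have "(\<Sum>i<n. norm (\<phi> (\<gamma> (v i)) - \<phi> (\<gamma> (u i)))) \<le> (\<Sum>i<n. B * norm (\<gamma> (v i) - \<gamma> (u i)))"
    proof (rule sum_mono)
      fix i assume "i \<in> {..<n}"
      then have "u i \<in> {s..t}" "v i \<in> {s..t}" using * by force+
      then show "norm (\<phi> (\<gamma> (v i)) - \<phi> (\<gamma> (u i))) \<le> B * norm (\<gamma> (v i) - \<gamma> (u i))"
        using lipschitz_onD[OF B S S, of "v i" "u i"] by (simp add: dist_norm)
    qed
    moreover have "\<dots> = B * (\<Sum>i<n. norm (\<gamma> (v i) - \<gamma> (u i)))" by (simp add: sum_distrib_left)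
    moreover have "B * (\<Sum>i<n. norm (\<gamma> (v i) - \<gamma> (u i))) \<le> (B + 1) * (\<Sum>i<n. norm (\<gamma> (v i) - \<gamma> (u i)))"
      by (intro mult_right_mono sum_nonneg) auto
    ultimately show "(\<Sum>i<n. norm (\<phi> (\<gamma> (v i)) - \<phi> (\<gamma> (u i)))) < e"
      using B0 by (auto simp: pos_less_divide_eq mult.commute)
  qed
qed

text \<open>The intervals are half-open so that consecutive arcs do not overlap, and the derivative
  is taken within \<open>{0..T}\<close> for every arc so that all arcs see the same speed at a given
  time.\<close>

definition arc_length where
  "arc_length N X1 X2 T \<gamma> s t =
     (\<integral>\<^sup>+ \<tau>. indicator {s<..t} \<tau> *
        ennreal (sf_norm N X1 X2 (\<gamma> \<tau>) (vector_derivative \<gamma> (at \<tau> within {0..T}))) \<partial>lborel)"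

lemma arc_length_superadditive:
  assumes "s \<le> t" "t \<le> u"
  shows "arc_length N X1 X2 T \<gamma> s t + arc_length N X1 X2 T \<gamma> t u \<le> arc_length N X1 X2 T \<gamma> s u"
  unfolding arc_length_def
  by (rule order_trans[OF nn_integral_superadditive nn_integral_mono])
     (use assms in \<open>auto simp: indicator_def\<close>)

lemma arc_length_le_sf_length: "arc_length N X1 X2 T \<gamma> 0 T \<le> sf_length N X1 X2 T \<gamma>"
  unfolding arc_length_def sf_length_def
  by (intro nn_integral_mono mult_right_mono) (auto simp: indicator_def)

text \<open>The derivative of \<open>\<phi>\<close> along the curve is at most
  \<open>C * N w1 w2\<close> for every way of writing the velocity, hence at most \<open>C\<close>
  times the infimum \<open>sf_norm\<close>; then integrate. The bound is required only at points of
  the arc, so \<open>C\<close> may depend on the curve. A negative increment is sent to 0 by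
  \<open>ennreal\<close>.\<close>

proposition calibration:
  fixes \<gamma> :: "real \<Rightarrow> 'a::euclidean_space" and \<phi> :: "'a \<Rightarrow> real"
  assumes hor: "horizontal X1 X2 T \<gamma>" and st: "0 \<le> s" "s \<le> t" "t \<le> T"
    and lip: "\<And>R. \<exists>B. B-lipschitz_on (cball 0 R) \<phi>"
    and der: "\<And>q. (\<phi> has_derivative \<phi>' q) (at q)"
    and C: "0 \<le> C"
    and bnd: "\<And>\<tau> w1 w2. \<tau> \<in> {s..t} \<Longrightarrow>
       \<phi>' (\<gamma> \<tau>) (w1 *\<^sub>R X1 (\<gamma> \<tau>) + w2 *\<^sub>R X2 (\<gamma> \<tau>)) \<le> C * N w1 w2"
  shows "ennreal (\<phi> (\<gamma> t) - \<phi> (\<gamma> s)) \<le> ennreal C * arc_length N X1 X2 T \<gamma> s t"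
proof -
  define vd where "vd \<tau> = vector_derivative \<gamma> (at \<tau> within {0..T})" for \<tau>
  define sp where "sp \<tau> = sf_norm N X1 X2 (\<gamma> \<tau>) (vd \<tau>)" for \<tau>
  have ac: "abs_continuous_on 0 T \<gamma>" using hor unfolding horizontal_def by blast
  have "compact (\<gamma> ` {0..T})"
    using abs_continuous_on_imp_continuous_on[OF ac] by (intro compact_continuous_image) auto
  then obtain R where R: "\<gamma> ` {0..T} \<subseteq> cball 0 R"
    by (fastforce dest!: compact_imp_bounded simp: bounded_iff)
  obtain B where B: "B-lipschitz_on (cball 0 R) \<phi>" using lip by blast
  have acP: "abs_continuous_on s t (\<lambda>\<tau>. \<phi> (\<gamma> \<tau>))"
    by (rule abs_continuous_on_lipschitz_compose[OF ac B], rule subsetD[OF R]) (use st in auto)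
  have "AE \<tau> in lborel. \<tau> \<in> {0..T} \<longrightarrow>
        \<gamma> differentiable (at \<tau> within {0..T}) \<and> vd \<tau> \<in> span {X1 (\<gamma> \<tau>), X2 (\<gamma> \<tau>)}"
    using hor unfolding horizontal_def vd_def by blast
  then obtain Z where Z: "\<forall>\<tau>. \<tau> \<notin> Z \<longrightarrow> \<tau> \<in> {0..T} \<longrightarrow>
        \<gamma> differentiable (at \<tau> within {0..T}) \<and> vd \<tau> \<in> span {X1 (\<gamma> \<tau>), X2 (\<gamma> \<tau>)}"
     and Z0: "Z \<in> null_sets lborel"
    using AE_E3 by (metis (mono_tags, lifting) DiffI UNIV_I space_borel space_lborel)
  have good: "\<gamma> differentiable (at \<tau> within {0..T})" "vd \<tau> \<in> span {X1 (\<gamma> \<tau>), X2 (\<gamma> \<tau>)}"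
    if "\<tau> \<in> {0..T}" "\<tau> \<notin> Z" for \<tau>
    using Z that by auto
  define f where "f \<tau> = (if \<tau> \<in> Z then 0 else \<phi>' (\<gamma> \<tau>) (vd \<tau>))" for \<tau>
  have derP: "((\<lambda>\<tau>. \<phi> (\<gamma> \<tau>)) has_real_derivative f \<tau>) (at \<tau> within {s..t})"
    if \<tau>: "\<tau> \<in> {s..t} - Z" for \<tau>
  proof -
    have "(\<gamma> has_vector_derivative vd \<tau>) (at \<tau> within {0..T})"
      unfolding vd_def using good(1)[of \<tau>] \<tau> st by (auto simp: vector_derivative_works)
    then have "(\<gamma> has_derivative (\<lambda>h. h *\<^sub>R vd \<tau>)) (at \<tau> within {s..t})"
      unfolding has_vector_derivative_def by (rule has_derivative_subset) (use st in auto)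
    from has_derivative_compose[OF this der]
    have "((\<lambda>\<tau>. \<phi> (\<gamma> \<tau>)) has_derivative (\<lambda>h. \<phi>' (\<gamma> \<tau>) (h *\<^sub>R vd \<tau>))) (at \<tau> within {s..t})" .
    moreover have "\<phi>' (\<gamma> \<tau>) (h *\<^sub>R vd \<tau>) = f \<tau> * h" for h
      using linear_cmul[OF has_derivative_linear[OF der]] \<tau> unfolding f_def by simp
    ultimately show ?thesis unfolding has_field_derivative_def by simp
  qed
  have fI: "(f has_integral (\<phi> (\<gamma> t) - \<phi> (\<gamma> s))) {s..t}"
    by (rule fundamental_theorem_of_calculus_abs_continuous[OF st(2) acP _ derP, of Z])
       (use Z0 in \<open>auto simp: f_def intro: null_sets_completionI\<close>)
  have fle: "f \<tau> \<le> C * sp \<tau>" if \<tau>: "\<tau> \<in> {s..t}" "\<tau> \<notin> Z" for \<tau>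
  proof -
    have "vd \<tau> \<in> span {X1 (\<gamma> \<tau>), X2 (\<gamma> \<tau>)}" using good \<tau> st by auto
    then obtain a b where ab: "vd \<tau> - a *\<^sub>R X1 (\<gamma> \<tau>) = b *\<^sub>R X2 (\<gamma> \<tau>)"
      by (auto simp: span_insert span_singleton)
    have ff: "f \<tau> \<le> C * N w1 w2" if "vd \<tau> = w1 *\<^sub>R X1 (\<gamma> \<tau>) + w2 *\<^sub>R X2 (\<gamma> \<tau>)" for w1 w2
      using bnd[OF \<tau>(1), of w1 w2] \<tau>(2) unfolding f_def that by simp
    show ?thesis
    \<comment> \<open>For \<open>C = 0\<close> division by \<open>C\<close> is impossible, but a
      single representation of the velocity already gives \<open>f \<tau> \<le> 0\<close>.\<close>
    proof (cases "C = 0")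
      case True then show ?thesis using ff[of a b] ab by (simp add: algebra_simps)
    next
      case False
      then have "f \<tau> / C \<le> sp \<tau>" unfolding sp_def sf_norm_def
      proof (intro cInf_greatest)
        show "{N w1 w2 |w1 w2. vd \<tau> = w1 *\<^sub>R X1 (\<gamma> \<tau>) + w2 *\<^sub>R X2 (\<gamma> \<tau>)} \<noteq> {}"
          using ab by (auto simp: algebra_simps)
      qed (use ff C False in \<open>auto simp: divide_le_eq mult.commute\<close>)
      then show ?thesis using C False by (simp add: divide_le_eq mult.commute)
    qed
  qed
  \<comment> \<open>\<open>sp\<close> may fail to be measurable, whereas \<open>f\<close> is
    measurable because it has an integral; so the comparison with the length passes through the
    positive part of \<open>f\<close>.\<close>
  define g where "g \<tau> = indicator {s..t} \<tau> * max 0 (f \<tau>)" for \<tau>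
  have fI': "((\<lambda>\<tau>. indicator {s..t} \<tau> * f \<tau>) has_integral (\<phi> (\<gamma> t) - \<phi> (\<gamma> s))) UNIV"
  proof -
    have "(\<lambda>\<tau>. indicator {s..t} \<tau> * f \<tau>) = (\<lambda>\<tau>. if \<tau> \<in> {s..t} then f \<tau> else 0)" by auto
    then show ?thesis using fI by (simp only: has_integral_restrict_UNIV)
  qed
  have "(\<lambda>\<tau>. indicator {s..t} \<tau> * f \<tau>) \<in> borel_measurable lebesgue"
    using has_integral_implies_lebesgue_measurable[OF fI] by simp
  then have "(\<lambda>\<tau>. max 0 (indicator {s..t} \<tau> * f \<tau>)) \<in> borel_measurable lebesgue" by measurable
  moreover have "(\<lambda>\<tau>. max 0 (indicator {s..t} \<tau> * f \<tau>)) = g" unfolding g_def by (auto simp: indicator_def)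
  ultimately have gm: "g \<in> borel_measurable lebesgue" by simp
  have "(\<integral>\<^sup>+\<tau>. ennreal (g \<tau>) \<partial>lborel) \<le>
     (\<integral>\<^sup>+\<tau>. ennreal C * (indicator {s<..t} \<tau> * ennreal (sp \<tau>)) \<partial>lborel)"
  proof (rule nn_integral_mono_AE)
    have "AE \<tau> in lborel. \<tau> \<notin> Z" using Z0 by (rule AE_not_in)
    moreover have "AE \<tau> in lborel. \<tau> \<noteq> s" by (rule AE_lborel_singleton)
    ultimately show "AE \<tau> in lborel. ennreal (g \<tau>) \<le> ennreal C * (indicator {s<..t} \<tau> * ennreal (sp \<tau>))"
    proof eventually_elim
      case (elim \<tau>)
      show ?case
      proof (cases "\<tau> \<in> {s..t}")
        case True
        have "ennreal (g \<tau>) = ennreal (f \<tau>)" unfolding g_def using True by (simp add: max_def ennreal_neg)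
        also have "\<dots> \<le> ennreal (C * sp \<tau>)" using fle True elim by (intro ennreal_leI) auto
        also have "\<dots> = ennreal C * ennreal (sp \<tau>)"
          using C by (rule ennreal_mult')
        finally show ?thesis using True elim by (auto simp: indicator_def)
      qed (simp add: g_def)
    qed
  qed
  also have "\<dots> \<le> ennreal C * arc_length N X1 X2 T \<gamma> s t"
    unfolding arc_length_def sp_def vd_def by (rule nn_integral_cmult_le[OF C])
  finally have le: "(\<integral>\<^sup>+\<tau>. ennreal (g \<tau>) \<partial>lborel) \<le> ennreal C * arc_length N X1 X2 T \<gamma> s t" .
  show ?thesis
  proof (cases "(\<integral>\<^sup>+\<tau>. ennreal (g \<tau>) \<partial>lborel) = top")
    case True then show ?thesis using le by (simp add: top_unique)
  next
    case False
    then obtain r where r: "r \<ge> 0" "(\<integral>\<^sup>+\<tau>. ennreal (g \<tau>) \<partial>lborel) = ennreal r"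
      by (metis ennreal_cases)
    have "(g has_integral r) UNIV"
      by (subst has_integral_iff_nn_integral_lebesgue)
         (use gm r in \<open>auto simp: g_def nn_integral_completion\<close>)
    from has_integral_le[OF fI' this] have "\<phi> (\<gamma> t) - \<phi> (\<gamma> s) \<le> r"
      by (auto simp: g_def indicator_def)
    then show ?thesis using le r by (metis ennreal_leI order_trans)
  qed
qed

section \<open>Curves of unit speed\<close>

text \<open>\<open>L\<close> is a duration: speed at most 1 allows waiting, which makes the relation
  monotone in \<open>L\<close>. Lipschitz curves with finitely many exceptional times are stable
  under concatenation and include all piecewise constant controls.\<close>

definition steers ::
  "(real \<Rightarrow> real \<Rightarrow> real) \<Rightarrow> ('a::euclidean_space \<Rightarrow> 'a) \<Rightarrow> ('a \<Rightarrow> 'a) \<Rightarrow> real \<Rightarrow> 'a \<Rightarrow> 'a \<Rightarrow> bool" where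
  "steers N X1 X2 L p q \<longleftrightarrow> 0 \<le> L \<and> (\<exists>\<gamma> C F. \<gamma> 0 = p \<and> \<gamma> L = q \<and> C-lipschitz_on {0..L} \<gamma> \<and> finite F \<and>
     (\<forall>t\<in>{0<..<L} - F. \<exists>w1 w2. N w1 w2 \<le> 1 \<and>
        (\<gamma> has_vector_derivative (w1 *\<^sub>R X1 (\<gamma> t) + w2 *\<^sub>R X2 (\<gamma> t))) (at t)))"

lemma steers_refl: "steers N X1 X2 0 p p"
  unfolding steers_def
  by (intro conjI exI[of _ "\<lambda>_. p"] exI[of _ "0::real"] exI[of _ "{}"]) (auto simp: lipschitz_on_def)

lemma steers_const:
  assumes "N 0 0 \<le> 1" "0 \<le> L" shows "steers N X1 X2 L p p"
proof -
  have "(0::real)-lipschitz_on {0..L} (\<lambda>_. p)" by (auto simp: lipschitz_on_def)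
  moreover have "((\<lambda>_. p) has_vector_derivative 0 *\<^sub>R X1 p + 0 *\<^sub>R X2 p) (at t)" for t by simp
  ultimately show ?thesis
    unfolding steers_def using assms
    by (intro conjI exI[of _ "\<lambda>_. p"] exI[of _ "0::real"] exI[of _ "{}"]) (auto intro!: exI[of _ "0::real"])
qed

lemma steers_trans:
  assumes 1: "steers N X1 X2 L p q" and 2: "steers N X1 X2 M q s"
  shows "steers N X1 X2 (L + M) p s"
proof -
  obtain \<gamma> C F where L: "0 \<le> L" "\<gamma> 0 = p" "\<gamma> L = q" "C-lipschitz_on {0..L} \<gamma>" "finite F"
    and dL: "\<And>t. t\<in>{0<..<L} - F \<Longrightarrow> \<exists>w1 w2. N w1 w2 \<le> 1 \<and>
        (\<gamma> has_vector_derivative (w1 *\<^sub>R X1 (\<gamma> t) + w2 *\<^sub>R X2 (\<gamma> t))) (at t)"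
    using 1 unfolding steers_def by blast
  obtain \<eta> D G where M: "0 \<le> M" "\<eta> 0 = q" "\<eta> M = s" "D-lipschitz_on {0..M} \<eta>" "finite G"
    and dM: "\<And>t. t\<in>{0<..<M} - G \<Longrightarrow> \<exists>w1 w2. N w1 w2 \<le> 1 \<and>
        (\<eta> has_vector_derivative (w1 *\<^sub>R X1 (\<eta> t) + w2 *\<^sub>R X2 (\<eta> t))) (at t)"
    using 2 unfolding steers_def by blast
  define \<zeta> where "\<zeta> = (\<lambda>t. if t \<le> L then \<gamma> t else \<eta> (t - L))"
  have "D-lipschitz_on {L..L+M} (\<lambda>t. \<eta> (t - L))"
  proof (rule lipschitz_onI)
    fix x y assume "x \<in> {L..L+M}" "y \<in> {L..L+M}"
    then show "dist (\<eta> (x - L)) (\<eta> (y - L)) \<le> D * dist x y"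
      using lipschitz_onD[OF M(4), of "x - L" "y - L"] by (auto simp: dist_real_def)
  qed (rule lipschitz_on_nonneg[OF M(4)])
  then have lip: "(max C D)-lipschitz_on {0..L+M} \<zeta>"
    unfolding \<zeta>_def using L M by (intro lipschitz_on_concat_max) auto
  \<comment> \<open>The junction \<open>L\<close> joins the exceptional times, since the velocities
    on its two sides need not agree.\<close>
  have der: "\<exists>w1 w2. N w1 w2 \<le> 1 \<and>
        (\<zeta> has_vector_derivative (w1 *\<^sub>R X1 (\<zeta> t) + w2 *\<^sub>R X2 (\<zeta> t))) (at t)"
    if t: "t \<in> {0<..<L+M} - (F \<union> (\<lambda>t. t + L) ` G \<union> {L})" for t
  proof (cases "t < L")
    case True
    then obtain w1 w2 where "N w1 w2 \<le> 1" "(\<gamma> has_vector_derivative (w1 *\<^sub>R X1 (\<gamma> t) + w2 *\<^sub>R X2 (\<gamma> t))) (at t)"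
      using dL[of t] t by auto
    moreover from this(2) have "(\<zeta> has_vector_derivative (w1 *\<^sub>R X1 (\<gamma> t) + w2 *\<^sub>R X2 (\<gamma> t))) (at t)"
      by (rule has_vector_derivative_transform_within_open[of _ _ _ "{..<L}"]) (use True in \<open>auto simp: \<zeta>_def\<close>)
    ultimately show ?thesis using True unfolding \<zeta>_def by auto
  next
    case False
    then have tL: "t > L" using t by auto
    have "t - L \<notin> G" using t by (metis DiffD2 UnCI diff_add_cancel image_eqI)
    then obtain w1 w2 where w: "N w1 w2 \<le> 1" "(\<eta> has_vector_derivative (w1 *\<^sub>R X1 (\<eta> (t-L)) + w2 *\<^sub>R X2 (\<eta> (t-L)))) (at (t - L))"
      using dM[of "t - L"] t tL by auto
    have "((\<lambda>t. t - L) has_vector_derivative 1) (at t)" by (auto intro!: derivative_eq_intros)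
    from vector_diff_chain_at[OF this w(2)]
    have "((\<lambda>t. \<eta> (t - L)) has_vector_derivative (w1 *\<^sub>R X1 (\<eta> (t-L)) + w2 *\<^sub>R X2 (\<eta> (t-L)))) (at t)"
      by (simp add: o_def)
    then have "(\<zeta> has_vector_derivative (w1 *\<^sub>R X1 (\<eta> (t-L)) + w2 *\<^sub>R X2 (\<eta> (t-L)))) (at t)"
      by (rule has_vector_derivative_transform_within_open[of _ _ _ "{L<..}"]) (use tL in \<open>auto simp: \<zeta>_def\<close>)
    then show ?thesis using w(1) tL unfolding \<zeta>_def by auto
  qed
  have "\<zeta> 0 = p" using L unfolding \<zeta>_def by simp
  moreover have "\<zeta> (L + M) = s" using L M unfolding \<zeta>_def by (cases "M = 0") simp_all
  moreover have "finite (F \<union> (\<lambda>t. t + L) ` G \<union> {L})" using L M by auto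
  ultimately show ?thesis unfolding steers_def using lip der L M
    by (intro conjI exI[of _ \<zeta>] exI[of _ "max C D"] exI[of _ "F \<union> (\<lambda>t. t + L) ` G \<union> {L}"]) auto
qed

lemma steers_mono:
  assumes "steers N X1 X2 L p q" "L \<le> L'" "N 0 0 \<le> 1"
  shows "steers N X1 X2 L' p q"
  using steers_trans[OF assms(1) steers_const[of N "L' - L"]] assms(2,3) by simp

text \<open>A curve with constant controls run for unit time is reparametrised so that the controls
  get norm 1; its duration then is \<open>N w1 w2\<close>.\<close>

lemma steers_flow:
  assumes der: "\<And>t. (\<gamma> has_vector_derivative (w1 *\<^sub>R X1 (\<gamma> t) + w2 *\<^sub>R X2 (\<gamma> t))) (at t)"
    and cont: "continuous_on {0..1} (\<lambda>t. w1 *\<^sub>R X1 (\<gamma> t) + w2 *\<^sub>R X2 (\<gamma> t))"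
    and hom: "\<And>a. 0 \<le> a \<Longrightarrow> N (a * w1) (a * w2) = a * N w1 w2" and pos: "N w1 w2 > 0"
  shows "steers N X1 X2 (N w1 w2) (\<gamma> 0) (\<gamma> 1)"
proof -
  define L where "L = N w1 w2"
  have L: "L > 0" using pos L_def by simp
  let ?v = "\<lambda>t. w1 *\<^sub>R X1 (\<gamma> t) + w2 *\<^sub>R X2 (\<gamma> t)"
  define \<zeta> where "\<zeta> = (\<lambda>t. \<gamma> (t / L))"
  have der\<zeta>: "(\<zeta> has_vector_derivative ((w1 / L) *\<^sub>R X1 (\<zeta> t) + (w2 / L) *\<^sub>R X2 (\<zeta> t))) (at t)" for t
  proof -
    have "((\<lambda>t. t / L) has_vector_derivative (1 / L)) (at t)"
      using DERIV_cdivide[OF DERIV_ident, where c=L] by (simp add: has_real_derivative_iff_has_vector_derivative)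
    from vector_diff_chain_at[OF this der]
    show ?thesis by (simp add: o_def \<zeta>_def scaleR_add_right)
  qed
  have "compact (?v ` {0..1})" using cont by (intro compact_continuous_image) auto
  then obtain B where B: "\<And>t. t \<in> {0..1} \<Longrightarrow> norm (?v t) \<le> B" by (fastforce dest!: compact_imp_bounded simp: bounded_iff)
  have B0: "B \<ge> 0" by (rule order_trans[OF norm_ge_zero B[of 0]]) simp
  have "(B / L)-lipschitz_on {0..L} \<zeta>"
  proof (rule bounded_derivative_imp_lipschitz)
    fix t assume t: "t \<in> {0..L}"
    show "(\<zeta> has_derivative (\<lambda>h. h *\<^sub>R ((w1 / L) *\<^sub>R X1 (\<zeta> t) + (w2 / L) *\<^sub>R X2 (\<zeta> t)))) (at t within {0..L})"
      using der\<zeta>[of t] unfolding has_vector_derivative_def by (rule has_derivative_at_withinI)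
    have "norm ((w1 / L) *\<^sub>R X1 (\<zeta> t) + (w2 / L) *\<^sub>R X2 (\<zeta> t)) = norm (?v (t / L)) / L"
    proof -
      have "(w1 / L) *\<^sub>R X1 (\<zeta> t) + (w2 / L) *\<^sub>R X2 (\<zeta> t) = (1 / L) *\<^sub>R ?v (t / L)"
        by (simp add: \<zeta>_def scaleR_add_right)
      then show ?thesis using L by simp
    qed
    also have "\<dots> \<le> B / L" using B[of "t / L"] t L by (intro divide_right_mono) auto
    finally have "norm (h *\<^sub>R ((w1 / L) *\<^sub>R X1 (\<zeta> t) + (w2 / L) *\<^sub>R X2 (\<zeta> t))) \<le> B / L * norm h" for h
      unfolding norm_scaleR real_norm_def by (metis abs_ge_zero mult.commute mult_left_mono)
    then show "onorm (\<lambda>h. h *\<^sub>R ((w1 / L) *\<^sub>R X1 (\<zeta> t) + (w2 / L) *\<^sub>R X2 (\<zeta> t))) \<le> B / L"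
      by (rule onorm_le)
  qed (use B0 L in auto)
  moreover have "N (w1 / L) (w2 / L) \<le> 1"
    using hom[of "1 / L"] L unfolding L_def by simp
  ultimately have "steers N X1 X2 L (\<gamma> 0) (\<gamma> 1)" unfolding steers_def
    using L der\<zeta> by (intro conjI exI[of _ \<zeta>] exI[of _ "B / L"] exI[of _ "{}"]) (auto simp: \<zeta>_def)
  then show ?thesis unfolding L_def .
qed

text \<open>If admissible velocities are sent to \<open>k\<close> times admissible velocities,
  running the image curve at \<open>1 / k\<close> of its speed makes it admissible. This serves the
  dilations and also the passage between the two norms.\<close>

lemma steers_linear_image:
  assumes st: "steers N X1 X2 L p q" and A: "linear A" and l: "k > 0"
    and con: "\<And>q w1 w2. N w1 w2 \<le> 1 \<Longrightarrow> \<exists>v1 v2. N' v1 v2 \<le> 1 \<and>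
        A (w1 *\<^sub>R X1 q + w2 *\<^sub>R X2 q) = k *\<^sub>R (v1 *\<^sub>R Y1 (A q) + v2 *\<^sub>R Y2 (A q))"
  shows "steers N' Y1 Y2 (k * L) (A p) (A q)"
proof -
  have bl: "bounded_linear A" using A by (simp add: linear_linear)
  obtain \<gamma> C F where L: "0 \<le> L" "\<gamma> 0 = p" "\<gamma> L = q" "C-lipschitz_on {0..L} \<gamma>" "finite F"
    and dL: "\<And>t. t\<in>{0<..<L} - F \<Longrightarrow> \<exists>w1 w2. N w1 w2 \<le> 1 \<and>
        (\<gamma> has_vector_derivative (w1 *\<^sub>R X1 (\<gamma> t) + w2 *\<^sub>R X2 (\<gamma> t))) (at t)"
    using st unfolding steers_def by blast
  define \<zeta> where "\<zeta> = (\<lambda>t. A (\<gamma> (t / k)))"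
  obtain K where K: "K-lipschitz_on UNIV A"
    using bounded_linear.lipschitz_boundE[OF bl] by blast
  have "(1/k)-lipschitz_on {0..k * L} (\<lambda>t. t / k)"
    using l by (intro lipschitz_onI) (auto simp: dist_real_def diff_divide_distrib[symmetric] abs_divide)
  moreover have "C-lipschitz_on ((\<lambda>t. t / k) ` {0..k * L}) \<gamma>"
    by (rule lipschitz_on_subset[OF L(4)]) (use l L in \<open>auto simp: field_simps\<close>)
  ultimately have "(C * (1/k))-lipschitz_on {0..k * L} (\<lambda>t. \<gamma> (t / k))"
    by (rule lipschitz_on_compose2)
  then have "(K * (C * (1/k)))-lipschitz_on {0..k * L} \<zeta>"
    unfolding \<zeta>_def by (rule lipschitz_on_compose2[OF _ lipschitz_on_subset[OF K]]) simp
  moreover have "\<exists>v1 v2. N' v1 v2 \<le> 1 \<and> (\<zeta> has_vector_derivative (v1 *\<^sub>R Y1 (\<zeta> t) + v2 *\<^sub>R Y2 (\<zeta> t))) (at t)"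
    if t: "t \<in> {0<..<k * L} - (\<lambda>t. k * t) ` F" for t
  proof -
    have "t / k \<in> {0<..<L} - F" using t l by (auto simp: field_simps image_iff)
    then obtain w1 w2 where w: "N w1 w2 \<le> 1"
        "(\<gamma> has_vector_derivative (w1 *\<^sub>R X1 (\<gamma> (t/k)) + w2 *\<^sub>R X2 (\<gamma> (t/k)))) (at (t/k))"
      using dL by blast
    obtain v1 v2 where v: "N' v1 v2 \<le> 1"
        "A (w1 *\<^sub>R X1 (\<gamma> (t/k)) + w2 *\<^sub>R X2 (\<gamma> (t/k))) = k *\<^sub>R (v1 *\<^sub>R Y1 (\<zeta> t) + v2 *\<^sub>R Y2 (\<zeta> t))"
      using con[OF w(1)] unfolding \<zeta>_def by blast
    have "((\<lambda>t. t / k) has_vector_derivative (1 / k)) (at t)"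
      using DERIV_cdivide[OF DERIV_ident, where c=k] by (simp add: has_real_derivative_iff_has_vector_derivative)
    from bounded_linear.has_vector_derivative[OF bl vector_diff_chain_at[OF this w(2)]]
    have "(\<zeta> has_vector_derivative (1/k) *\<^sub>R A (w1 *\<^sub>R X1 (\<gamma> (t/k)) + w2 *\<^sub>R X2 (\<gamma> (t/k)))) (at t)"
      unfolding \<zeta>_def o_def linear_cmul[OF A] .
    then show ?thesis using v l by auto
  qed
  ultimately show ?thesis unfolding steers_def
    using L l by (intro conjI exI[of _ \<zeta>] exI[of _ "K * (C * (1/k))"] exI[of _ "(\<lambda>t. k * t) ` F"]) (auto simp: \<zeta>_def)
qed

text \<open>The controls given by \<open>steers\<close> compete in the infimum
  \<open>sf_norm\<close>, so the speed is at most 1. \<open>L > 0\<close> makes the derivative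
  within \<open>{0..L}\<close> unique.\<close>

lemma steers_imp_horizontal_curve:
  assumes st: "steers N X1 X2 L p q" and L0: "L > 0" and nn: "\<And>w1 w2. 0 \<le> N w1 w2"
  shows "\<exists>\<gamma>. horizontal X1 X2 L \<gamma> \<and> \<gamma> 0 = p \<and> \<gamma> L = q \<and> sf_length N X1 X2 L \<gamma> \<le> ennreal L"
proof -
  obtain \<gamma> C F where L: "0 \<le> L" "\<gamma> 0 = p" "\<gamma> L = q" "C-lipschitz_on {0..L} \<gamma>" "finite F"
    and dL: "\<And>t. t\<in>{0<..<L} - F \<Longrightarrow> \<exists>w1 w2. N w1 w2 \<le> 1 \<and>
        (\<gamma> has_vector_derivative (w1 *\<^sub>R X1 (\<gamma> t) + w2 *\<^sub>R X2 (\<gamma> t))) (at t)"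
    using st unfolding steers_def by blast
  have "abs_continuous_on 0 L (\<lambda>t::real. t)" unfolding abs_continuous_on_def
    by (intro allI impI, rename_tac e, rule_tac x=e in exI) auto
  from abs_continuous_on_lipschitz_compose[OF this L(4)]
  have ac: "abs_continuous_on 0 L \<gamma>" by simp
  have ae: "AE t in lborel. t \<notin> F \<union> {0, L}"
    using L(5) by (intro AE_not_in finite_imp_null_set_lborel) auto
  have key: "\<exists>w1 w2. N w1 w2 \<le> 1 \<and> \<gamma> differentiable (at t within {0..L}) \<and>
       vector_derivative \<gamma> (at t within {0..L}) = w1 *\<^sub>R X1 (\<gamma> t) + w2 *\<^sub>R X2 (\<gamma> t)"
    if t: "t \<in> {0..L}" "t \<notin> F \<union> {0, L}" for t
  proof -
    obtain w1 w2 where w: "N w1 w2 \<le> 1" "(\<gamma> has_vector_derivative (w1 *\<^sub>R X1 (\<gamma> t) + w2 *\<^sub>R X2 (\<gamma> t))) (at t)"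
      using dL[of t] t by force
    have "(\<gamma> has_vector_derivative (w1 *\<^sub>R X1 (\<gamma> t) + w2 *\<^sub>R X2 (\<gamma> t))) (at t within {0..L})"
      using w(2) by (rule has_vector_derivative_at_within)
    then show ?thesis using w(1) vector_derivative_within_closed_interval[OF _ t(1)] L0
      by (meson differentiableI_vector)
  qed
  have "horizontal X1 X2 L \<gamma>" unfolding horizontal_def
  proof (intro conjI ac, use ae in eventually_elim, intro impI)
    fix t assume t: "t \<notin> F \<union> {0, L}" "t \<in> {0..L}"
    have "a *\<^sub>R X1 (\<gamma> t) + b *\<^sub>R X2 (\<gamma> t) \<in> span {X1 (\<gamma> t), X2 (\<gamma> t)}" for a b
      by (intro span_add span_scale span_base) auto
    then show "\<gamma> differentiable at t within {0..L} \<and>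
         vector_derivative \<gamma> (at t within {0..L}) \<in> span {X1 (\<gamma> t), X2 (\<gamma> t)}"
      using key[OF t(2,1)] by force
  qed
  moreover have "sf_length N X1 X2 L \<gamma> \<le> ennreal L"
  proof -
    have "sf_length N X1 X2 L \<gamma> \<le> (\<integral>\<^sup>+ t. indicator {0..L} t \<partial>lborel)"
      unfolding sf_length_def
    proof (rule nn_integral_mono_AE, use ae in eventually_elim)
      fix t assume t: "t \<notin> F \<union> {0, L}"
      show "indicator {0..L} t * ennreal (sf_norm N X1 X2 (\<gamma> t) (vector_derivative \<gamma> (at t within {0..L}))) \<le> indicator {0..L} t"
      proof (cases "t \<in> {0..L}")
        case True
        from key[OF this t] obtain w1 w2 where w: "N w1 w2 \<le> 1"
          "vector_derivative \<gamma> (at t within {0..L}) = w1 *\<^sub>R X1 (\<gamma> t) + w2 *\<^sub>R X2 (\<gamma> t)" by blast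
        have "sf_norm N X1 X2 (\<gamma> t) (vector_derivative \<gamma> (at t within {0..L})) \<le> N w1 w2"
          unfolding sf_norm_def by (rule cInf_lower) (use w nn in \<open>auto intro!: bdd_belowI[of _ 0]\<close>)
        then show ?thesis using w True by (auto simp: ennreal_le_1)
      qed simp
    qed
    also have "\<dots> = ennreal L" using L by simp
    finally show ?thesis .
  qed
  ultimately show ?thesis using L by blast
qed

section \<open>Piecewise polynomial functions and semialgebraic sets\<close>

text \<open>Calibrations contain products of coordinates, which are Lipschitz on bounded sets only;
  a horizontal curve on a compact interval stays in such a set.\<close>

definition lipschitz_on_balls :: "('a::real_normed_vector \<Rightarrow> real) \<Rightarrow> bool" where
  "lipschitz_on_balls f \<longleftrightarrow> (\<forall>R. \<exists>L. L-lipschitz_on (cball 0 R) f)"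

lemma lipschitz_on_balls_const: "lipschitz_on_balls (\<lambda>_. c)"
  unfolding lipschitz_on_balls_def by (auto intro!: exI[of _ 0] simp: lipschitz_on_def)

lemma lipschitz_on_balls_coord: "lipschitz_on_balls (\<lambda>q :: real^'n. q $ i)"
  unfolding lipschitz_on_balls_def by (auto intro!: exI[of _ 1] simp: lipschitz_on_def dist_vec_nth_le)

lemma lipschitz_on_balls_add: "lipschitz_on_balls f \<Longrightarrow> lipschitz_on_balls g \<Longrightarrow> lipschitz_on_balls (\<lambda>q. f q + g q)"
  unfolding lipschitz_on_balls_def by (blast intro: lipschitz_on_add)

lemma lipschitz_on_balls_diff: "lipschitz_on_balls f \<Longrightarrow> lipschitz_on_balls g \<Longrightarrow> lipschitz_on_balls (\<lambda>q. f q - g q)"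
  unfolding lipschitz_on_balls_def by (blast intro: lipschitz_on_diff)

lemma lipschitz_on_balls_abs:
  assumes "lipschitz_on_balls f" shows "lipschitz_on_balls (\<lambda>q. \<bar>f q\<bar>)"
  unfolding lipschitz_on_balls_def
proof
  fix R
  obtain L where L: "L-lipschitz_on (cball 0 R) f" using assms unfolding lipschitz_on_balls_def by blast
  have "L-lipschitz_on (cball 0 R) (\<lambda>q. \<bar>f q\<bar>)"
    using lipschitz_onD[OF L] lipschitz_on_nonneg[OF L] unfolding lipschitz_on_def dist_real_def
    by (meson abs_triangle_ineq3 order_trans)
  then show "\<exists>L. L-lipschitz_on (cball 0 R) (\<lambda>q. \<bar>f q\<bar>)" by blast
qed

lemma lipschitz_on_balls_mult:
  fixes f g :: "'a::euclidean_space \<Rightarrow> real"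
  assumes "lipschitz_on_balls f" "lipschitz_on_balls g" shows "lipschitz_on_balls (\<lambda>q. f q * g q)"
  unfolding lipschitz_on_balls_def
proof
  fix R
  let ?S = "cball 0 R :: 'a set"
  obtain L M where L: "L-lipschitz_on ?S f" and M: "M-lipschitz_on ?S g"
    using assms unfolding lipschitz_on_balls_def by blast
  have "bounded (f ` ?S)" "bounded (g ` ?S)"
    using L M by (auto intro: bounded_uniformly_continuous_image lipschitz_on_uniformly_continuous)
  then obtain B C where B: "\<And>x. x \<in> ?S \<Longrightarrow> \<bar>f x\<bar> \<le> B" and C: "\<And>x. x \<in> ?S \<Longrightarrow> \<bar>g x\<bar> \<le> C"
    by (fastforce simp: bounded_iff)
  have "(\<bar>B\<bar> * M + \<bar>C\<bar> * L)-lipschitz_on ?S (\<lambda>x. f x * g x)"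
  proof (rule lipschitz_onI)
    fix x y assume xy: "x \<in> ?S" "y \<in> ?S"
    have "\<bar>f x * g x - f y * g y\<bar> = \<bar>f x * (g x - g y) + g y * (f x - f y)\<bar>" by (simp add: algebra_simps)
    also have "\<dots> \<le> \<bar>f x\<bar> * \<bar>g x - g y\<bar> + \<bar>g y\<bar> * \<bar>f x - f y\<bar>"
      by (metis abs_mult abs_triangle_ineq)
    also have "\<dots> \<le> \<bar>B\<bar> * (M * dist x y) + \<bar>C\<bar> * (L * dist x y)"
      using lipschitz_onD[OF L xy] lipschitz_onD[OF M xy] B[OF xy(1)] C[OF xy(2)]
      by (intro add_mono mult_mono) (auto simp: dist_real_def)
    finally show "dist (f x * g x) (f y * g y) \<le> (\<bar>B\<bar> * M + \<bar>C\<bar> * L) * dist x y"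
      by (simp add: dist_real_def algebra_simps)
  qed (use lipschitz_on_nonneg[OF L] lipschitz_on_nonneg[OF M] in auto)
  then show "\<exists>L. L-lipschitz_on ?S (\<lambda>x. f x * g x)" by blast
qed

lemma lipschitz_on_balls_divide:
  fixes f :: "'a::euclidean_space \<Rightarrow> real"
  assumes "lipschitz_on_balls f" shows "lipschitz_on_balls (\<lambda>q. f q / c)"
  using lipschitz_on_balls_mult[OF assms lipschitz_on_balls_const[of "1/c"]] by simp

lemma lipschitz_on_balls_power:
  fixes f :: "'a::euclidean_space \<Rightarrow> real"
  shows "lipschitz_on_balls f \<Longrightarrow> lipschitz_on_balls (\<lambda>q. f q ^ n)"
  by (induction n) (auto intro: lipschitz_on_balls_mult lipschitz_on_balls_const)

lemmas lipschitz_on_balls_intros = lipschitz_on_balls_const lipschitz_on_balls_coord lipschitz_on_balls_add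
  lipschitz_on_balls_diff lipschitz_on_balls_abs lipschitz_on_balls_mult lipschitz_on_balls_divide lipschitz_on_balls_power

section \<open>Polynomial functions and semialgebraic sets\<close>

inductive poly_map :: "(real^'n \<Rightarrow> real) \<Rightarrow> bool" where
  poly_map_const: "poly_map (\<lambda>_. c)"
| poly_map_coord: "poly_map (\<lambda>x. x $ i)"
| poly_map_add: "poly_map f \<Longrightarrow> poly_map g \<Longrightarrow> poly_map (\<lambda>x. f x + g x)"
| poly_map_mult: "poly_map f \<Longrightarrow> poly_map g \<Longrightarrow> poly_map (\<lambda>x. f x * g x)"

lemma poly_map_uminus: "poly_map f \<Longrightarrow> poly_map (\<lambda>x. - f x)"
  using poly_map_mult[OF poly_map_const[of "-1"], of f] by simp

lemma poly_map_diff: "poly_map f \<Longrightarrow> poly_map g \<Longrightarrow> poly_map (\<lambda>x. f x - g x)"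
  using poly_map_add[OF _ poly_map_uminus, of f g] by simp

text \<open>Exponents may repeat in the list, so that sums become concatenations without collecting
  terms. A coordinate is expanded about \<open>p\<close> as
  \<open>p$j + (x$j - p$j)\<close>.\<close>

lemma poly_map_sum_of_monomials:
  fixes f :: "real^'n \<Rightarrow> real"
  assumes "poly_map f"
  shows "\<exists>l :: (real \<times> ('n \<Rightarrow> nat)) list. \<forall>x. f x = (\<Sum>(a,\<alpha>)\<leftarrow>l. a * (\<Prod>i\<in>UNIV. (x$i - p$i) ^ \<alpha> i))"
  using assms
proof induction
  case (poly_map_const c)
  show ?case by (rule exI[of _ "[(c, \<lambda>_. 0)]"]) simp
next
  case (poly_map_coord j)
  have "(\<Prod>i\<in>UNIV. (x$i - p$i) ^ (if i = j then 1 else 0)) = x$j - p$j" for x :: "real^'n"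
  proof -
    have "(\<Prod>i\<in>UNIV. (x$i - p$i) ^ (if i = j then 1 else 0)) = (\<Prod>i\<in>UNIV. if i = j then x$i - p$i else 1)"
      by (rule prod.cong) auto
    then show ?thesis by simp
  qed
  then show ?case
    by (intro exI[of _ "[(p$j, \<lambda>_. 0), (1, \<lambda>i. if i = j then 1 else 0)]"]) simp
next
  case (poly_map_add f g)
  then obtain l m where "\<forall>x. f x = (\<Sum>(a,\<alpha>)\<leftarrow>l. a * (\<Prod>i\<in>UNIV. (x$i - p$i) ^ \<alpha> i))"
    "\<forall>x. g x = (\<Sum>(a,\<alpha>)\<leftarrow>m. a * (\<Prod>i\<in>UNIV. (x$i - p$i) ^ \<alpha> i))" by blast
  then show ?case by (intro exI[of _ "l @ m"]) simp
next
  case (poly_map_mult f g)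
  then obtain l m :: "(real \<times> ('n \<Rightarrow> nat)) list" where l: "\<forall>x. f x = (\<Sum>(a,\<alpha>)\<leftarrow>l. a * (\<Prod>i\<in>UNIV. (x$i - p$i) ^ \<alpha> i))"
    and m: "\<forall>x. g x = (\<Sum>(a,\<alpha>)\<leftarrow>m. a * (\<Prod>i\<in>UNIV. (x$i - p$i) ^ \<alpha> i))" by blast
  define M where "M x = (\<lambda>(a,\<alpha>). a * (\<Prod>i\<in>UNIV. (x$i - p$i) ^ \<alpha> i))" for x :: "real^'n"
  define times where "times = (\<lambda>(a::real, \<alpha>::'n\<Rightarrow>nat) (b, \<beta>). (a * b, \<lambda>i. \<alpha> i + \<beta> i))"
  have t: "M x (times u v) = M x u * M x v" for x u v
    by (cases u; cases v) (simp add: M_def times_def power_add prod.distrib)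
  have 1: "sum_list (map (M x) (map (times u) m)) = M x u * sum_list (map (M x) m)" for x u m
    by (induction m) (simp_all add: t distrib_left)
  have 2: "sum_list (map (M x) (concat (map (\<lambda>u. map (times u) m) l))) = sum_list (map (M x) l) * sum_list (map (M x) m)" for x l
    by (induction l) (simp_all add: 1[simplified] distrib_right)
  show ?case using l m 2
    by (intro exI[of _ "concat (map (\<lambda>u. map (times u) m) l)"]) (simp add: M_def)
qed

lemma poly_map_real_analytic: 
  fixes f :: "real^'n \<Rightarrow> real"
  assumes "poly_map f" shows "real_analytic_on U f"
  unfolding real_analytic_on_def
proof
  fix p assume "p \<in> U"
  obtain l where l: "\<And>x. f x = (\<Sum>(a,\<alpha>)\<leftarrow>l. a * (\<Prod>i\<in>UNIV. (x$i - p$i) ^ \<alpha> i))"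
    using poly_map_sum_of_monomials[OF assms, of p] by blast
  have "\<exists>c :: ('n \<Rightarrow> nat) \<Rightarrow> real. \<forall>x.
      ((\<lambda>\<alpha>. c \<alpha> * (\<Prod>i\<in>UNIV. (x$i - p$i) ^ \<alpha> i)) has_sum (\<Sum>(a,\<alpha>)\<leftarrow>l. a * (\<Prod>i\<in>UNIV. (x$i - p$i) ^ \<alpha> i))) UNIV"
  proof (induction l)
    case Nil
    show ?case by (rule exI[of _ "\<lambda>_. 0"]) simp
  next
    case (Cons u l)
    obtain a \<beta> where u: "u = (a,\<beta>)" by fastforce
    from Cons obtain c :: "('n \<Rightarrow> nat) \<Rightarrow> real" where c: "\<And>x. ((\<lambda>\<alpha>. c \<alpha> * (\<Prod>i\<in>UNIV. (x$i - p$i) ^ \<alpha> i)) has_sum (\<Sum>(a,\<alpha>)\<leftarrow>l. a * (\<Prod>i\<in>UNIV. (x$i - p$i) ^ \<alpha> i))) UNIV"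
      by blast
    have "((\<lambda>\<alpha>. (if \<alpha> = \<beta> then a else 0) * (\<Prod>i\<in>UNIV. (x$i - p$i) ^ \<alpha> i)) has_sum a * (\<Prod>i\<in>UNIV. (x$i - p$i) ^ \<beta> i)) UNIV" for x :: "real^'n"
      by (rule has_sum_finite_neutralI[of "{\<beta>}"]) auto
    from has_sum_add[OF this c]
    show ?case unfolding u
      by (intro exI[of _ "\<lambda>\<alpha>. (if \<alpha> = \<beta> then a else 0) + c \<alpha>"]) (simp add: distrib_right)
  qed
  then show "\<exists>r>0. \<exists>c. \<forall>x\<in>ball p r. ((\<lambda>\<alpha>. c \<alpha> * (\<Prod>i\<in>UNIV. (x $ i - p $ i) ^ \<alpha> i)) has_sum f x) UNIV"
    unfolding l[symmetric] by (intro exI[of _ "1::real"]) auto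
qed

text \<open>Every condition couples an equation with a strict inequality, as in
  \<open>semianalytic\<close>: a lone equation is paired with \<open>1 > 0\<close>, a lone
  inequality with \<open>0 = 0\<close>. Inner lists are conjunctions, the outer list is their
  union.\<close>

definition semialgebraic :: "(real^'n) set \<Rightarrow> bool" where
  "semialgebraic S \<longleftrightarrow> (\<exists>D :: ((real^'n \<Rightarrow> real) \<times> (real^'n \<Rightarrow> real)) list list.
     (\<forall>C\<in>set D. \<forall>u\<in>set C. poly_map (fst u) \<and> poly_map (snd u)) \<and>
     S = {y. \<exists>C\<in>set D. \<forall>u\<in>set C. fst u y = 0 \<and> snd u y > 0})"

lemma semialgebraic_Un:
  assumes "semialgebraic S" "semialgebraic T" shows "semialgebraic (S \<union> T)"
proof -
  obtain D where D:
    "\<forall>C\<in>set D. \<forall>u\<in>set C. poly_map (fst u) \<and> poly_map (snd u)" "S = {y. \<exists>C\<in>set D. \<forall>u\<in>set C. fst u y = 0 \<and> snd u y > 0}"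
    using assms(1) unfolding semialgebraic_def by blast
  obtain E where E:
    "\<forall>C\<in>set E. \<forall>u\<in>set C. poly_map (fst u) \<and> poly_map (snd u)" "T = {y. \<exists>C\<in>set E. \<forall>u\<in>set C. fst u y = 0 \<and> snd u y > 0}"
    using assms(2) unfolding semialgebraic_def by blast
  have "S \<union> T = {y. \<exists>C\<in>set (D @ E). \<forall>u\<in>set C. fst u y = 0 \<and> snd u y > 0}"
    unfolding D(2) E(2) set_append by blast
  moreover have "\<forall>C\<in>set (D @ E). \<forall>u\<in>set C. poly_map (fst u) \<and> poly_map (snd u)" using D(1) E(1) by auto
  ultimately show ?thesis unfolding semialgebraic_def by blast
qed

lemma semialgebraic_Int:
  assumes "semialgebraic S" "semialgebraic T" shows "semialgebraic (S \<inter> T)"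
proof -
  obtain D where D:
    "\<forall>C\<in>set D. \<forall>u\<in>set C. poly_map (fst u) \<and> poly_map (snd u)" "S = {y. \<exists>C\<in>set D. \<forall>u\<in>set C. fst u y = 0 \<and> snd u y > 0}"
    using assms(1) unfolding semialgebraic_def by blast
  obtain E where E:
    "\<forall>C\<in>set E. \<forall>u\<in>set C. poly_map (fst u) \<and> poly_map (snd u)" "T = {y. \<exists>C\<in>set E. \<forall>u\<in>set C. fst u y = 0 \<and> snd u y > 0}"
    using assms(2) unfolding semialgebraic_def by blast
  define F where "F = concat (map (\<lambda>C. map (\<lambda>B. C @ B) E) D)"
  have F: "set F = (\<Union>C\<in>set D. (\<lambda>B. C @ B) ` set E)" unfolding F_def by auto
  have "S \<inter> T = {y. \<exists>C\<in>set F. \<forall>u\<in>set C. fst u y = 0 \<and> snd u y > 0}"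
    unfolding D(2) E(2) F by (simp add: set_eq_iff ball_Un)
  moreover have "\<forall>C\<in>set F. \<forall>u\<in>set C. poly_map (fst u) \<and> poly_map (snd u)" using D(1) E(1) unfolding F by auto
  ultimately show ?thesis unfolding semialgebraic_def by blast
qed

lemma semialgebraic_eq0: assumes "poly_map f" shows "semialgebraic {y. f y = 0}"
  unfolding semialgebraic_def using assms
  by (intro exI[of _ "[[(f, \<lambda>_. 1)]]"]) (simp add: poly_map_const)

lemma semialgebraic_gt0: assumes "poly_map f" shows "semialgebraic {y. f y > 0}"
  unfolding semialgebraic_def using assms
  by (intro exI[of _ "[[(\<lambda>_. 0, f)]]"]) (simp add: poly_map_const)

lemma semialgebraic_UNIV: "semialgebraic UNIV"
  unfolding semialgebraic_def by (intro exI[of _ "[[]]"]) auto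

lemma semialgebraic_empty: "semialgebraic {}"
  unfolding semialgebraic_def by (intro exI[of _ "[]"]) auto

lemma semialgebraic_Union_list: "(\<And>S. S \<in> set l \<Longrightarrow> semialgebraic S) \<Longrightarrow> semialgebraic (\<Union>(set l))"
  by (induction l) (auto intro: semialgebraic_Un semialgebraic_empty)

lemma semialgebraic_imp_semianalytic:
  fixes S :: "(real^'n) set"
  assumes "semialgebraic S" shows "semianalytic S"
  unfolding semianalytic_def
proof
  fix x
  obtain D :: "((real^'n \<Rightarrow> real) \<times> (real^'n \<Rightarrow> real)) list list" where
    D: "\<forall>C\<in>set D. \<forall>u\<in>set C. poly_map (fst u) \<and> poly_map (snd u)" and S: "S = {y. \<exists>C\<in>set D. \<forall>u\<in>set C. fst u y = 0 \<and> snd u y > 0}"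
    using assms unfolding semialgebraic_def by blast
  define q where "q = Max (insert 0 (length ` set D))"
  have q: "length C \<le> q" if "C \<in> set D" for C unfolding q_def using that by (intro Max_ge) auto
  \<comment> \<open>\<open>semianalytic\<close> wants a rectangular array, so short conjunctions are
    filled up with the true condition \<open>0 = 0\<close> and \<open>1 > 0\<close>.\<close>
  define h where "h i j = (if j < length (D ! i) then D ! i ! j else (\<lambda>_. 0, \<lambda>_. 1))" for i j
  have "real_analytic_on UNIV (fst (h i j)) \<and> real_analytic_on UNIV (snd (h i j))" if "i < length D" for i j
  proof (cases "j < length (D ! i)")
    case True
    then have "h i j \<in> set (D ! i)" unfolding h_def by simp
    then show ?thesis using D that by (meson nth_mem poly_map_real_analytic)
  next
    case False
    then show ?thesis unfolding h_def by (simp add: poly_map_real_analytic poly_map_const)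
  qed
  moreover have "S \<inter> UNIV = (\<Union>i<length D. {y \<in> UNIV. \<forall>j<q. fst (h i j) y = 0 \<and> snd (h i j) y > 0})"
  proof -
    have eq: "(\<forall>u\<in>set (D!i). fst u y = 0 \<and> snd u y > 0) \<longleftrightarrow> (\<forall>j<q. fst (h i j) y = 0 \<and> snd (h i j) y > 0)"
      if "i < length D" for i y
    proof -
      have "length (D ! i) \<le> q" using q that by simp
      then show ?thesis unfolding h_def all_set_conv_all_nth by auto
    qed
    have "set D = (!) D ` {..<length D}" by (auto simp: set_conv_nth)
    then have "S = (\<Union>i<length D. {y. \<forall>u\<in>set (D!i). fst u y = 0 \<and> snd u y > 0})"
      unfolding S by simp blast
    then show ?thesis using eq by auto
  qed
  ultimately show "\<exists>U. open U \<and> x \<in> U \<and>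
        (\<exists>(p::nat) (q::nat) (f :: nat \<Rightarrow> nat \<Rightarrow> real^'n \<Rightarrow> real) (g :: nat \<Rightarrow> nat \<Rightarrow> real^'n \<Rightarrow> real).
           (\<forall>i<p. \<forall>j<q. real_analytic_on U (f i j) \<and> real_analytic_on U (g i j)) \<and>
           S \<inter> U = (\<Union>i<p. {y \<in> U. \<forall>j<q. f i j y = 0 \<and> g i j y > 0}))"
    by (intro exI[of _ UNIV] conjI exI[of _ "length D"] exI[of _ q] exI[of _ "\<lambda>i j. fst (h i j)"] exI[of _ "\<lambda>i j. snd (h i j)"]) auto
qed

text \<open>Semialgebraic pieces make equations and inequalities between such functions
  semialgebraic; finiteness puts the graph of \<open>f\<close> into finitely many polynomial graphs.
  Pieces may overlap, as each polynomial agrees with \<open>f\<close> on its whole piece.\<close>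

definition piecewise_poly :: "(real^'n \<Rightarrow> real) \<Rightarrow> bool" where
  "piecewise_poly f \<longleftrightarrow> (\<exists>l. (\<forall>u\<in>set l. semialgebraic (fst u) \<and> poly_map (snd u) \<and> (\<forall>x\<in>fst u. f x = snd u x)) \<and>
     (\<forall>x. \<exists>u\<in>set l. x \<in> fst u))"

lemma piecewise_polyE:
  assumes "piecewise_poly f"
  obtains l where "\<And>u. u\<in>set l \<Longrightarrow> semialgebraic (fst u)" "\<And>u. u\<in>set l \<Longrightarrow> poly_map (snd u)"
    "\<And>u x. u\<in>set l \<Longrightarrow> x\<in>fst u \<Longrightarrow> f x = snd u x" "\<And>x. \<exists>u\<in>set l. x \<in> fst u"
  using assms unfolding piecewise_poly_def by blast

lemma piecewise_poly_poly: "poly_map f \<Longrightarrow> piecewise_poly f"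
  unfolding piecewise_poly_def by (intro exI[of _ "[(UNIV, f)]"]) (simp add: semialgebraic_UNIV)

lemma piecewise_poly_finite_cases:
  assumes "piecewise_poly f"
  obtains l where "\<And>p. p \<in> set l \<Longrightarrow> poly_map p" "\<And>x. \<exists>p\<in>set l. f x = p x"
proof -
  obtain l where l: "\<And>u. u\<in>set l \<Longrightarrow> poly_map (snd u)"
    "\<And>u x. u\<in>set l \<Longrightarrow> x\<in>fst u \<Longrightarrow> f x = snd u x" "\<And>x. \<exists>u\<in>set l. x \<in> fst u"
    using assms by (rule piecewise_polyE) blast
  show thesis
  proof (rule that[of "map snd l"])
    show "poly_map p" if "p \<in> set (map snd l)" for p using that l(1) by auto
    show "\<exists>p\<in>set (map snd l). f x = p x" for x using l(2) l(3)[of x] by auto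
  qed
qed

lemma piecewise_poly_combine:
  fixes f g :: "real^'n \<Rightarrow> real"
  assumes f: "piecewise_poly f" and g: "piecewise_poly g"
    and h: "\<And>p q :: real^'n \<Rightarrow> real. poly_map p \<Longrightarrow> poly_map q \<Longrightarrow> poly_map (\<lambda>x. h (p x) (q x))"
  shows "piecewise_poly (\<lambda>x. h (f x) (g x))"
proof -
  obtain l where l: "\<And>u. u\<in>set l \<Longrightarrow> semialgebraic (fst u)" "\<And>u. u\<in>set l \<Longrightarrow> poly_map (snd u)"
    "\<And>u x. u\<in>set l \<Longrightarrow> x\<in>fst u \<Longrightarrow> f x = snd u x" "\<And>x. \<exists>u\<in>set l. x \<in> fst u"
    using f by (rule piecewise_polyE) blast
  obtain m where m: "\<And>u. u\<in>set m \<Longrightarrow> semialgebraic (fst u)" "\<And>u. u\<in>set m \<Longrightarrow> poly_map (snd u)"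
    "\<And>u x. u\<in>set m \<Longrightarrow> x\<in>fst u \<Longrightarrow> g x = snd u x" "\<And>x. \<exists>u\<in>set m. x \<in> fst u"
    using g by (rule piecewise_polyE) blast
  define comb where "comb u v = (fst u \<inter> fst v, \<lambda>x. h (snd u x) (snd v x))" for u v :: "(real^'n) set \<times> (real^'n \<Rightarrow> real)"
  let ?r = "concat (map (\<lambda>u. map (comb u) m) l)"
  have r: "set ?r = (\<Union>u\<in>set l. comb u ` set m)" by auto
  show ?thesis unfolding piecewise_poly_def
  proof (intro exI[of _ ?r] conjI allI ballI)
    fix w assume "w \<in> set ?r"
    then obtain u v where u: "u \<in> set l" "v \<in> set m" "w = comb u v" unfolding r by blast
    show "semialgebraic (fst w)" using u l(1) m(1) by (simp add: comb_def semialgebraic_Int)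
    have "poly_map (\<lambda>x. h (snd u x) (snd v x))" by (rule h) (use u l(2) m(2) in auto)
    then show "poly_map (snd w)" using u(3) by (simp add: comb_def)
    show "h (f x) (g x) = snd w x" if "x \<in> fst w" for x
      using that u l(3)[of u x] m(3)[of v x] by (simp add: comb_def)
  next
    fix x
    obtain u v where u: "u \<in> set l" "x \<in> fst u" "v \<in> set m" "x \<in> fst v" using l(4) m(4) by blast
    then have "comb u v \<in> set ?r" "x \<in> fst (comb u v)" unfolding r by (auto simp: comb_def)
    then show "\<exists>w\<in>set ?r. x \<in> fst w" by blast
  qed
qed

lemma piecewise_poly_add: "piecewise_poly f \<Longrightarrow> piecewise_poly g \<Longrightarrow> piecewise_poly (\<lambda>x. f x + g x)"
  by (rule piecewise_poly_combine[where h="(+)"]) (auto intro: poly_map_add)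
lemma piecewise_poly_diff: "piecewise_poly f \<Longrightarrow> piecewise_poly g \<Longrightarrow> piecewise_poly (\<lambda>x. f x - g x)"
  by (rule piecewise_poly_combine[where h="(-)"]) (auto intro: poly_map_diff)
lemma piecewise_poly_mult: "piecewise_poly f \<Longrightarrow> piecewise_poly g \<Longrightarrow> piecewise_poly (\<lambda>x. f x * g x)"
  by (rule piecewise_poly_combine[where h="(*)"]) (auto intro: poly_map_mult)
lemma piecewise_poly_const: "piecewise_poly (\<lambda>_. c)"
  by (intro piecewise_poly_poly poly_map_const)
lemma piecewise_poly_coord: "piecewise_poly (\<lambda>x. x $ i)"
  by (intro piecewise_poly_poly poly_map_coord)
lemma piecewise_poly_uminus: "piecewise_poly f \<Longrightarrow> piecewise_poly (\<lambda>x. - f x)"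
  using piecewise_poly_diff[OF piecewise_poly_const[of 0], of f] by simp
lemma piecewise_poly_divide: "piecewise_poly f \<Longrightarrow> piecewise_poly (\<lambda>x. f x / c)"
  using piecewise_poly_mult[OF piecewise_poly_const[of "1/c"], of f] by simp
lemma piecewise_poly_power: "piecewise_poly f \<Longrightarrow> piecewise_poly (\<lambda>x. f x ^ n)"
  by (induction n) (auto intro: piecewise_poly_const piecewise_poly_mult)

lemma semialgebraic_preimage_0:
  fixes f :: "real^'n \<Rightarrow> real"
  assumes f: "piecewise_poly f" and P: "\<And>p :: real^'n \<Rightarrow> real. poly_map p \<Longrightarrow> semialgebraic {x. P (p x)}"
  shows "semialgebraic {x. P (f x)}"
proof -
  obtain l where l: "\<And>u. u\<in>set l \<Longrightarrow> semialgebraic (fst u)" "\<And>u. u\<in>set l \<Longrightarrow> poly_map (snd u)"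
    "\<And>u x. u\<in>set l \<Longrightarrow> x\<in>fst u \<Longrightarrow> f x = snd u x" "\<And>x. \<exists>u\<in>set l. x \<in> fst u"
    using f by (rule piecewise_polyE) blast
  have "{x. P (f x)} = \<Union>(set (map (\<lambda>u. fst u \<inter> {x. P (snd u x)}) l))"
  proof (intro set_eqI iffI)
    fix x assume x: "x \<in> {x. P (f x)}"
    obtain u where u: "u \<in> set l" "x \<in> fst u" using l(4)[of x] by blast
    then show "x \<in> \<Union>(set (map (\<lambda>u. fst u \<inter> {x. P (snd u x)}) l))" using x l(3)[OF u] by auto
  next
    fix x assume "x \<in> \<Union>(set (map (\<lambda>u. fst u \<inter> {x. P (snd u x)}) l))"
    then obtain u where u: "u \<in> set l" "x \<in> fst u" "P (snd u x)" by auto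
    then show "x \<in> {x. P (f x)}" using l(3)[OF u(1,2)] by simp
  qed
  moreover have "semialgebraic \<dots>"
  proof (rule semialgebraic_Union_list)
    fix S assume "S \<in> set (map (\<lambda>u. fst u \<inter> {x. P (snd u x)}) l)"
    then obtain u where "u \<in> set l" "S = fst u \<inter> {x. P (snd u x)}" by auto
    then show "semialgebraic S" using semialgebraic_Int[OF l(1) P[OF l(2)]] by blast
  qed
  ultimately show ?thesis by simp
qed

lemma semialgebraic_eq:
  assumes "piecewise_poly f" "piecewise_poly g" shows "semialgebraic {x. f x = g x}"
  using semialgebraic_preimage_0[OF piecewise_poly_diff[OF assms], of "\<lambda>t. t = 0"] semialgebraic_eq0 by auto

lemma semialgebraic_less:
  assumes "piecewise_poly f" "piecewise_poly g" shows "semialgebraic {x. f x < g x}"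
  using semialgebraic_preimage_0[OF piecewise_poly_diff[OF assms(2,1)], of "\<lambda>t. t > 0"] semialgebraic_gt0 by auto

lemma semialgebraic_le:
  assumes "piecewise_poly f" "piecewise_poly g" shows "semialgebraic {x. f x \<le> g x}"
proof -
  have "{x. f x \<le> g x} = {x. f x = g x} \<union> {x. f x < g x}" by auto
  then show ?thesis using assms by (simp add: semialgebraic_Un semialgebraic_eq semialgebraic_less)
qed

text \<open>The negated condition is a hypothesis of its own; for the comparisons behind
  \<open>max\<close>, \<open>min\<close> and the absolute value it is again a comparison.\<close>

lemma piecewise_poly_if:
  assumes f: "piecewise_poly f" and g: "piecewise_poly g"
    and P: "semialgebraic {x. P x}" and nP: "semialgebraic {x. \<not> P x}"
  shows "piecewise_poly (\<lambda>x. if P x then f x else g x)"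
proof -
  obtain l where l: "\<And>u. u\<in>set l \<Longrightarrow> semialgebraic (fst u)" "\<And>u. u\<in>set l \<Longrightarrow> poly_map (snd u)"
    "\<And>u x. u\<in>set l \<Longrightarrow> x\<in>fst u \<Longrightarrow> f x = snd u x" "\<And>x. \<exists>u\<in>set l. x \<in> fst u"
    using f by (rule piecewise_polyE) blast
  obtain m where m: "\<And>u. u\<in>set m \<Longrightarrow> semialgebraic (fst u)" "\<And>u. u\<in>set m \<Longrightarrow> poly_map (snd u)"
    "\<And>u x. u\<in>set m \<Longrightarrow> x\<in>fst u \<Longrightarrow> g x = snd u x" "\<And>x. \<exists>u\<in>set m. x \<in> fst u"
    using g by (rule piecewise_polyE) blast
  let ?r = "map (\<lambda>u. (fst u \<inter> {x. P x}, snd u)) l @ map (\<lambda>u. (fst u \<inter> {x. \<not> P x}, snd u)) m"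
  show ?thesis unfolding piecewise_poly_def
  proof (intro exI[of _ ?r] conjI allI ballI)
    fix w assume w: "w \<in> set ?r"
    then show "semialgebraic (fst w)" using semialgebraic_Int[OF l(1) P] semialgebraic_Int[OF m(1) nP] by auto
    show "poly_map (snd w)" using w l(2) m(2) by auto
    show "(if P x then f x else g x) = snd w x" if "x \<in> fst w" for x using w that l(3) m(3) by auto
  next
    fix x
    obtain u v where u: "u \<in> set l" "x \<in> fst u" "v \<in> set m" "x \<in> fst v" using l(4) m(4) by blast
    show "\<exists>w\<in>set ?r. x \<in> fst w"
    proof (cases "P x")
      case True
      then show ?thesis using u by (intro bexI[of _ "(fst u \<inter> {x. P x}, snd u)"]) auto
    next
      case False
      then show ?thesis using u by (intro bexI[of _ "(fst v \<inter> {x. \<not> P x}, snd v)"]) auto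
    qed
  qed
qed

lemma piecewise_poly_max: 
  assumes "piecewise_poly f" "piecewise_poly g" shows "piecewise_poly (\<lambda>x. max (f x) (g x))"
  unfolding max_def using assms
  by (intro piecewise_poly_if semialgebraic_le) (auto simp: not_le intro: semialgebraic_less)

lemma piecewise_poly_min: 
  assumes "piecewise_poly f" "piecewise_poly g" shows "piecewise_poly (\<lambda>x. min (f x) (g x))"
  unfolding min_def using assms
  by (intro piecewise_poly_if semialgebraic_le) (auto simp: not_le intro: semialgebraic_less)

lemma piecewise_poly_abs: 
  assumes "piecewise_poly f" shows "piecewise_poly (\<lambda>x. \<bar>f x\<bar>)"
  unfolding abs_if using assms
  by (intro piecewise_poly_if semialgebraic_less piecewise_poly_uminus piecewise_poly_const)
     (auto simp: not_less intro: semialgebraic_le piecewise_poly_const)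

lemmas piecewise_poly_intros =
  piecewise_poly_add piecewise_poly_diff piecewise_poly_mult piecewise_poly_const piecewise_poly_coord
  piecewise_poly_uminus piecewise_poly_divide piecewise_poly_power piecewise_poly_max piecewise_poly_min piecewise_poly_abs

section \<open>Rectifiability of finite unions of polynomial graphs\<close>

lemma lipschitz_on_balls_poly_map: "poly_map f \<Longrightarrow> lipschitz_on_balls f"
  by (induction rule: poly_map.induct) (auto intro: lipschitz_on_balls_intros)

text \<open>The covering by empty sets has diameters 0, which contribute 0 because
  \<open>m > 0\<close>; for \<open>m = 0\<close> each term would contain
  \<open>0 ^ 0 = 1\<close>.\<close>

lemma hausdorff_measure_empty: "m > 0 \<Longrightarrow> hausdorff_measure m ({} :: 'a::euclidean_space set) = 0"
proof -
  assume m: "m > 0"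
  have "(INF C\<in>{C :: nat \<Rightarrow> 'a set. {} \<subseteq> (\<Union>i. C i) \<and> (\<forall>i. bounded (C i) \<and> diameter (C i) \<le> \<delta>)}.
        (\<Sum>i. ennreal (unit_ball_vol (real m) / 2 ^ m * diameter (C i) ^ m))) \<le> 0" if "\<delta> > 0" for \<delta> :: real
    by (rule INF_lower2[of "\<lambda>_. {}"]) (use m that in \<open>auto simp: zero_power\<close>)
  then have "hausdorff_measure m ({} :: 'a set) \<le> 0" unfolding hausdorff_measure_def by (intro SUP_least) auto
  then show ?thesis by simp
qed

text \<open>Since \<open>f\<close> does not depend on its own coordinate \<open>j\<close>, the
  equation \<open>q$j = f q\<close> describes a graph over a hyperplane, split among finitely many
  polynomials. Each polynomial graph over a ball is covered by one Lipschitz image of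
  \<open>real^'m\<close>, so that the remainder to be measured is empty.\<close>

lemma rectifiable_set_finite_graphs:
  fixes S :: "(real^'n) set" and l :: "('n \<times> (real^'n \<Rightarrow> real)) list"
  assumes card: "CARD('n) = CARD('m) + 1" and S: "bounded S"
    and l: "\<And>j f. (j,f) \<in> set l \<Longrightarrow> piecewise_poly f \<and> (\<forall>q t. f (\<chi> k. if k = j then t else q$k) = f q)"
    and cov: "\<And>q. q \<in> S \<Longrightarrow> \<exists>(j,f)\<in>set l. q$j = f q"
  shows "rectifiable_set TYPE(real^'m) S"
proof -
  obtain R where R: "\<And>q. q \<in> S \<Longrightarrow> norm q \<le> R" using S unfolding bounded_iff by blast
  define drp where "drp j q = (\<chi> k. if k = j then 0 else q$k)" for j and q :: "real^'n"
  have drp_norm: "norm (drp j q) \<le> norm q" for j q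
    by (rule norm_le_componentwise_cart) (auto simp: drp_def)
  have param: "\<exists>F :: real^'m \<Rightarrow> real^'n. (\<exists>L. L-lipschitz_on UNIV F) \<and> (\<forall>q. norm q \<le> R \<longrightarrow> q$j = p (drp j q) \<longrightarrow> q \<in> range F)"
    if p: "poly_map p" for j :: 'n and p
  proof (cases "R \<ge> 0")
    case False
    then show ?thesis by (intro exI[of _ "\<lambda>_. 0"]) (auto intro: exI[of _ 0] simp: lipschitz_on_def dest: order_trans[OF norm_ge_zero])
  next
    case True
    let ?T = "{q :: real^'n. axis j 1 \<bullet> q = 0}"
    have "dim ?T = DIM(real^'n) - 1" by (rule dim_special_hyperplane) (auto simp: Basis_vec_def)
    then have "dim (UNIV :: (real^'m) set) = dim ?T" using card by simp
    then obtain e :: "real^'m \<Rightarrow> real^'n" and e' where e: "linear e" "e ` UNIV = ?T"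
      using isometries_subspaces[of "UNIV :: (real^'m) set" ?T] subspace_hyperplane by (metis subspace_UNIV)
    \<comment> \<open>A polynomial is Lipschitz on the ball only. The nearest-point projection is
      1-Lipschitz and fixes the points of the ball, so composing with it gives a globally Lipschitz
      map.\<close>
    let ?\<pi> = "closest_point (cball (0::real^'n) R)"
    have pi: "1-lipschitz_on UNIV ?\<pi>"
      using True by (auto simp: lipschitz_on_def intro!: closest_point_lipschitz)
    have pir: "?\<pi> ` UNIV \<subseteq> cball 0 R" using True by (auto intro!: closest_point_in_set simp del: mem_cball)
    obtain L where L: "L-lipschitz_on (cball 0 R) p" using lipschitz_on_balls_poly_map[OF p] unfolding lipschitz_on_balls_def by blast
    obtain K where K: "K-lipschitz_on UNIV e"
      using bounded_linear.lipschitz_boundE[of e] e(1) by (metis linear_conv_bounded_linear)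
    have pie: "(1 * K)-lipschitz_on UNIV (\<lambda>v. ?\<pi> (e v))"
      by (rule lipschitz_on_compose2[OF K lipschitz_on_subset[OF pi]]) simp
    have "(L * (1 * K))-lipschitz_on UNIV (\<lambda>v. p (?\<pi> (e v)))"
      by (rule lipschitz_on_compose2[OF pie lipschitz_on_subset[OF L]]) (use pir in auto)
    moreover have "1-lipschitz_on UNIV (\<lambda>t. t *\<^sub>R axis j 1 :: real^'n)"
      by (auto simp: lipschitz_on_def dist_norm norm_axis_1 scaleR_diff_left[symmetric])
    ultimately have "(1 * (L * (1 * K)))-lipschitz_on UNIV (\<lambda>v. p (?\<pi> (e v)) *\<^sub>R axis j 1 :: real^'n)"
      by (intro lipschitz_on_compose2[where f="\<lambda>v. p (?\<pi> (e v))" and g="\<lambda>t. t *\<^sub>R axis j 1"]) (auto intro: lipschitz_on_subset)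
    from lipschitz_on_add[OF pie this]
    have "\<exists>L. L-lipschitz_on UNIV (\<lambda>v. ?\<pi> (e v) + p (?\<pi> (e v)) *\<^sub>R axis j 1)" by blast
    moreover have "q \<in> range (\<lambda>v. ?\<pi> (e v) + p (?\<pi> (e v)) *\<^sub>R axis j 1)" if q: "norm q \<le> R" "q$j = p (drp j q)" for q
    proof -
      have "drp j q \<in> ?T" by (simp add: inner_axis_axis inner_axis' drp_def)
      then obtain v where v: "e v = drp j q" using e(2) by (metis imageE)
      have "drp j q \<in> cball 0 R" using drp_norm[of j q] q by simp
      then have "?\<pi> (e v) = drp j q" using v closest_point_self by metis
      moreover have "q = drp j q + p (drp j q) *\<^sub>R axis j 1"
        unfolding q(2)[symmetric] by (auto simp: vec_eq_iff drp_def axis_def)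
      ultimately show ?thesis by (intro range_eqI[of _ _ v]) simp
    qed
    ultimately show ?thesis by (intro exI[of _ "\<lambda>v. ?\<pi> (e v) + p (?\<pi> (e v)) *\<^sub>R axis j 1"]) auto
  qed
  have "\<exists>P. finite P \<and> (\<forall>(j,p)\<in>P. poly_map p) \<and> (\<forall>q\<in>S. \<exists>(j,p)\<in>P. q$j = p (drp j q))"
  proof -
    have "\<exists>P. finite P \<and> (\<forall>p\<in>P. poly_map p) \<and> (\<forall>x. \<exists>p\<in>P. snd u x = p x)" if "u \<in> set l" for u
      using that l[of "fst u" "snd u"] piecewise_poly_finite_cases[of "snd u"] by (metis List.finite_set prod.collapse)
    then obtain P where P: "\<And>u. u \<in> set l \<Longrightarrow> finite (P u) \<and> (\<forall>p\<in>P u. poly_map p) \<and> (\<forall>x. \<exists>p\<in>P u. snd u x = p x)"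
      by metis
    show ?thesis
    proof (intro exI[of _ "\<Union>u\<in>set l. (\<lambda>p. (fst u, p)) ` P u"] conjI ballI)
      show "finite (\<Union>u\<in>set l. (\<lambda>p. (fst u, p)) ` P u)" using P by auto
      show "case u of (j,p) \<Rightarrow> poly_map p" if "u \<in> (\<Union>u\<in>set l. (\<lambda>p. (fst u, p)) ` P u)" for u using that P by auto
      fix q assume "q \<in> S"
      then obtain j f where f: "(j,f) \<in> set l" "q$j = f q" using cov by blast
      have "f q = f (drp j q)" using l[OF f(1)] unfolding drp_def by simp
      moreover obtain p where "p \<in> P (j,f)" "f (drp j q) = p (drp j q)" using P[OF f(1)] by fastforce
      ultimately show "\<exists>(j,p)\<in>(\<Union>u\<in>set l. (\<lambda>p. (fst u, p)) ` P u). q$j = p (drp j q)"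
        using f by (intro bexI[of _ "(j,p)"]) force+
    qed
  qed
  then obtain P where P: "finite P" "\<And>j p. (j,p)\<in>P \<Longrightarrow> poly_map p" "\<And>q. q\<in>S \<Longrightarrow> \<exists>(j,p)\<in>P. q$j = p (drp j q)"
    by fast
  have "\<forall>u\<in>P. \<exists>F :: real^'m \<Rightarrow> real^'n. (\<exists>L. L-lipschitz_on UNIV F) \<and> (\<forall>q. norm q \<le> R \<longrightarrow> q$(fst u) = snd u (drp (fst u) q) \<longrightarrow> q \<in> range F)"
    using param P(2) by (metis prod.collapse)
  then obtain F :: "_ \<Rightarrow> real^'m \<Rightarrow> real^'n" where F: "\<And>u. u \<in> P \<Longrightarrow> (\<exists>L. L-lipschitz_on UNIV (F u))"
    "\<And>u q. u \<in> P \<Longrightarrow> norm q \<le> R \<Longrightarrow> q$(fst u) = snd u (drp (fst u) q) \<Longrightarrow> q \<in> range (F u)"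
    by metis
  obtain us where us: "set us = P" using P(1) finite_list by blast
  define f where "f i = (if i < length us then F (us ! i) else (\<lambda>_. 0))" for i
  have "\<exists>L. L-lipschitz_on UNIV (f i)" for i
    using F(1)[of "us ! i"] us nth_mem[of i us]
    by (cases "i < length us") (auto simp: f_def lipschitz_on_def intro: exI[of _ 0])
  moreover have "S - (\<Union>i. range (f i)) = {}"
  proof -
    have "q \<in> (\<Union>i. range (f i))" if q: "q \<in> S" for q
    proof -
      obtain u where u: "u \<in> P" "q$(fst u) = snd u (drp (fst u) q)" using P(3)[OF q] by force
      obtain i where "i < length us" "us ! i = u" using u(1) us by (metis in_set_conv_nth)
      then show ?thesis using F(2)[OF u(1) R[OF q] u(2)] by (auto simp: f_def intro!: exI[of _ i])
    qed
    then show ?thesis by blast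
  qed
  moreover have "hausdorff_measure DIM(real^'m) ({} :: (real^'n) set) = 0"
    by (rule hausdorff_measure_empty) simp
  ultimately show ?thesis unfolding rectifiable_set_def by (intro exI[of _ f]) metis
qed

section \<open>Spheres between two graphs\<close>

text \<open>With weights \<open>e\<close> adapted to the vector fields, these are the anisotropic
  dilations that multiply durations by \<open>k\<close>, for \<open>k > 0\<close>.\<close>

definition dilation :: "('n \<Rightarrow> nat) \<Rightarrow> real \<Rightarrow> real^'n \<Rightarrow> real^'n" where
  "dilation e k q = (\<chi> j. k ^ e j * q$j)"

lemma dilation_dilation: "dilation e k (dilation e m q) = dilation e (k * m) q"
  by (simp add: dilation_def power_mult_distrib vec_eq_iff)

lemma dilation_1 [simp]: "dilation e 1 q = q"
  by (simp add: dilation_def vec_eq_iff)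

lemma dilation_0 [simp]: "dilation e k 0 = 0"
  by (simp add: dilation_def vec_eq_iff)

lemma linear_dilation: "linear (dilation e k)"
  by (intro linearI) (simp_all add: dilation_def vec_eq_iff algebra_simps)

text \<open>Coordinate \<open>j\<close> grows by the factor \<open>m ^ e j \<ge> m\<close>. So the
  orbit of a nonzero point leaves every ball and meets a Euclidean sphere at most once.\<close>

lemma norm_dilation_ge:
  assumes "\<And>j. 1 \<le> e j" "1 \<le> m"
  shows "m * norm q \<le> norm (dilation e m q)"
proof -
  have "norm (m *\<^sub>R q) \<le> norm (dilation e m q)"
  proof (rule norm_le_componentwise_cart)
    fix j
    have "m \<le> m ^ e j" using assms power_increasing[of 1 "e j" m] by simp
    then show "norm ((m *\<^sub>R q) $ j) \<le> norm (dilation e m q $ j)"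
      using assms(2) by (auto simp: dilation_def abs_mult intro!: mult_right_mono)
  qed
  then show ?thesis using assms(2) by simp
qed

text \<open>\<open>low\<close> and \<open>up\<close> identify the ball with the set cut out by three
  inequalities; \<open>loop\<close> makes these strict when the radius grows, \<open>indep\<close>
  presents two parts of the boundary as graphs, \<open>dil\<close> and \<open>ell_bound\<close>
  yield the scaling of the distance and the boundedness of balls. \<open>U\<close> and
  \<open>V\<close> are separate because the Martinet bounds above and below differ.\<close>

locale sublevel_barriers =
  fixes N :: "real \<Rightarrow> real \<Rightarrow> real" and X1 X2 :: "real^'n \<Rightarrow> real^'n" and v :: 'n and e :: "'n \<Rightarrow> nat"
    and ell :: "real^'n \<Rightarrow> real" and U V :: "real \<Rightarrow> real^'n \<Rightarrow> real"
  assumes N_nonneg: "\<And>w1 w2. 0 \<le> N w1 w2" and N_0: "N 0 0 = 0"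
    and e: "\<And>j. 1 \<le> e j"
    and dil: "\<And>k L p q. 0 < k \<Longrightarrow> steers N X1 X2 L p q \<Longrightarrow> steers N X1 X2 (k * L) (dilation e k p) (dilation e k q)"
    and low: "\<And>L T \<gamma>. 0 < L \<Longrightarrow> 0 \<le> T \<Longrightarrow> horizontal X1 X2 T \<gamma> \<Longrightarrow> \<gamma> 0 = 0 \<Longrightarrow> sf_length N X1 X2 T \<gamma> \<le> ennreal L \<Longrightarrow>
        ell (\<gamma> T) \<le> L \<and> - V L (\<gamma> T) \<le> \<gamma> T $ v \<and> \<gamma> T $ v \<le> U L (\<gamma> T)"
    and up: "\<And>L q. 0 < L \<Longrightarrow> ell q \<le> L \<Longrightarrow> - V L q \<le> q $ v \<Longrightarrow> q $ v \<le> U L q \<Longrightarrow> steers N X1 X2 L 0 q"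
    and loop: "\<And>L q. 0 < L \<Longrightarrow> \<exists>h>0. \<exists>h'>0. steers N X1 X2 L q (q + axis v h) \<and> steers N X1 X2 L q (q - axis v h')"
    and indep: "\<And>L q h. U L (q + axis v h) = U L q" "\<And>L q h. V L (q + axis v h) = V L q"
    and cont: "continuous_on UNIV (\<lambda>z. U (fst z) (snd z))" "continuous_on UNIV (\<lambda>z. V (fst z) (snd z))" "continuous_on UNIV ell"
    and pw: "\<And>L. piecewise_poly (U L)" "\<And>L. piecewise_poly (V L)" "piecewise_poly ell"
    and ell_bound: "\<And>j q. j \<noteq> v \<Longrightarrow> \<bar>q $ j\<bar> \<le> ell q"
begin

definition sublevel where "sublevel L q \<longleftrightarrow> ell q \<le> L \<and> - V L q \<le> q $ v \<and> q $ v \<le> U L q"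
definition open_sublevel where "open_sublevel L q \<longleftrightarrow> ell q < L \<and> - V L q < q $ v \<and> q $ v < U L q"
abbreviation "D q \<equiv> sf_dist N X1 X2 0 q"

section \<open>Balls as sublevel sets\<close>

lemma e_neq_0: "e j \<noteq> 0"
  using e[of j] by linarith

lemma steers_iff: "0 < L \<Longrightarrow> steers N X1 X2 L 0 q \<longleftrightarrow> sublevel L q"
proof
  assume L: "0 < L" and "steers N X1 X2 L 0 q"
  then obtain \<gamma> where "horizontal X1 X2 L \<gamma>" "\<gamma> 0 = 0" "\<gamma> L = q" "sf_length N X1 X2 L \<gamma> \<le> ennreal L"
    using steers_imp_horizontal_curve[of N X1 X2 L 0 q] N_nonneg by blast
  then show "sublevel L q" using low[of L L \<gamma>] L unfolding sublevel_def by simp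
qed (use up in \<open>auto simp: sublevel_def\<close>)

lemma continuous_on_bounds: "continuous_on S (\<lambda>L. U L q)" "continuous_on S (\<lambda>L. V L q)" "continuous_on T (U L)" "continuous_on T (V L)"
proof -
  have 1: "continuous_on S (\<lambda>L. (L, q))" "continuous_on T (\<lambda>q. (L, q))" by (auto intro!: continuous_intros)
  show "continuous_on S (\<lambda>L. U L q)" using continuous_on_compose2[OF cont(1) 1(1)] by simp
  show "continuous_on S (\<lambda>L. V L q)" using continuous_on_compose2[OF cont(2) 1(1)] by simp
  show "continuous_on T (U L)" using continuous_on_compose2[OF cont(1) 1(2)] by simp
  show "continuous_on T (V L)" using continuous_on_compose2[OF cont(2) 1(2)] by simp
qed

text \<open>The time left after reaching \<open>q\<close> is spent on a loop that moves
  \<open>q\<close> up or down. The moved points obey the inequalities for \<open>L'\<close>, whose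
  bounds are constant in direction \<open>v\<close>, so at \<open>q\<close> itself the last two are
  strict.\<close>

lemma sublevel_imp_open_sublevel:
  assumes "0 < L" "L < L'" "sublevel L q" shows "open_sublevel L' q"
proof -
  obtain h h' where h: "h > 0" "h' > 0" "steers N X1 X2 (L' - L) q (q + axis v h)" "steers N X1 X2 (L' - L) q (q - axis v h')"
    using loop[of "L' - L" q] assms by auto
  have st: "steers N X1 X2 L 0 q" using assms steers_iff by simp
  have eq: "q + axis v (- h') = q - axis v h'" by (simp add: axis_def vec_eq_iff)
  have "sublevel L' (q + axis v h)" using steers_trans[OF st h(3)] steers_iff[of L'] assms by simp
  moreover have "sublevel L' (q + axis v (- h'))" using steers_trans[OF st h(4)] steers_iff[of L'] assms
    by (simp add: eq)
  moreover have "axis v t $ v = t" for t :: real by (simp add: axis_def)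
  ultimately show ?thesis using h(1,2) assms unfolding sublevel_def open_sublevel_def indep vector_add_component by auto
qed

lemma open_open_sublevel: "open {q. open_sublevel L q}" "open {L. open_sublevel L q}"
  unfolding open_sublevel_def by (intro open_Collect_conj open_Collect_less continuous_intros continuous_on_bounds continuous_on_subset[OF cont(3)]; simp)+

lemma closed_sublevel: "closed {q. sublevel L q}" "closed {L. sublevel L q}"
  unfolding sublevel_def by (intro closed_Collect_conj closed_Collect_le continuous_intros continuous_on_bounds continuous_on_subset[OF cont(3)]; simp)+

text \<open>Strict inequalities persist for slightly smaller radii, because the bounds are
  continuous in \<open>L\<close>.\<close>

lemma open_sublevel_imp_sublevel:
  assumes "0 < L" "open_sublevel L q" shows "\<exists>L'. 0 < L' \<and> L' < L \<and> sublevel L' q"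
proof -
  obtain \<epsilon> where \<epsilon>: "\<epsilon> > 0" "ball L \<epsilon> \<subseteq> {L. open_sublevel L q}" using open_open_sublevel(2)[of q] assms(2) open_contains_ball by blast
  define L' where "L' = L - min (L/2) (\<epsilon>/2)"
  have "L' \<in> ball L \<epsilon>" using \<epsilon> assms unfolding L'_def by (auto simp: dist_real_def min_def)
  then have "open_sublevel L' q" using \<epsilon> by blast
  then have "sublevel L' q" unfolding open_sublevel_def sublevel_def by auto
  then show ?thesis using assms \<epsilon>(1) unfolding L'_def by (intro exI[of _ L']) (auto simp: L'_def min_def)
qed

lemma D_le:
  assumes L: "0 < L" and sublevel: "sublevel L q" shows "D q \<le> ennreal L"
proof -
  have "steers N X1 X2 L 0 q" using steers_iff[OF L] sublevel by simp
  from steers_imp_horizontal_curve[OF this L N_nonneg]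
  obtain \<gamma> where g: "horizontal X1 X2 L \<gamma>" "\<gamma> 0 = 0" "\<gamma> L = q" "sf_length N X1 X2 L \<gamma> \<le> ennreal L"
    by blast
  have "D q \<le> sf_length N X1 X2 L \<gamma>"
    unfolding sf_dist_def by (rule Inf_lower) (use g L in \<open>auto intro!: exI[of _ L] exI[of _ \<gamma>]\<close>)
  then show ?thesis using g(4) by simp
qed

lemma D_less_iff:
  assumes L: "0 < L" shows "D q < ennreal L \<longleftrightarrow> open_sublevel L q"
proof
  assume "D q < ennreal L"
  then obtain T \<gamma> where g: "0 \<le> T" "horizontal X1 X2 T \<gamma>" "\<gamma> 0 = 0" "\<gamma> T = q" "sf_length N X1 X2 T \<gamma> < ennreal L"
    unfolding sf_dist_def by (auto simp: Inf_less_iff)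
  obtain l where l: "sf_length N X1 X2 T \<gamma> = ennreal l" "0 \<le> l" using g(5) by (cases "sf_length N X1 X2 T \<gamma>") auto
  have "l < L" using g(5) l L by (simp add: ennreal_less_iff)
  \<comment> \<open>The midpoint is positive even if \<open>l = 0\<close>, as \<open>low\<close>
    requires, and leaves room below \<open>L\<close> for the loop.\<close>
  then have "sublevel ((l + L)/2) q"
    using low[of "(l+L)/2" T \<gamma>] g l L unfolding sublevel_def by (auto intro: ennreal_leI)
  then show "open_sublevel L q" using sublevel_imp_open_sublevel[of "(l+L)/2" L] \<open>l < L\<close> l L by auto
next
  assume "open_sublevel L q"
  then obtain L' where L': "0 < L'" "L' < L" "sublevel L' q" using open_sublevel_imp_sublevel L by blast
  then have "D q \<le> ennreal L'" by (intro D_le)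
  also have "\<dots> < ennreal L" using L' by (simp add: ennreal_less_iff)
  finally show "D q < ennreal L" .
qed

text \<open>\<open>D_less_iff\<close> gives membership at every larger radius, and the inequalities
  are closed in \<open>L\<close>, so they survive the limit.\<close>

lemma D_le_iff:
  assumes L: "0 < L" shows "D q \<le> ennreal L \<longleftrightarrow> sublevel L q"
proof
  assume le: "D q \<le> ennreal L"
  have "sublevel L' q" if "L < L'" for L'
  proof -
    have "D q < ennreal L'" using le that L by (auto simp: ennreal_less_iff intro: le_less_trans)
    then show ?thesis using D_less_iff[of L'] L that unfolding sublevel_def open_sublevel_def by auto
  qed
  then have "{L<..} \<subseteq> {L. sublevel L q}" by auto
  then have "closure {L<..} \<subseteq> {L. sublevel L q}" using closed_sublevel(2) by (rule closure_minimal)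
  then show "sublevel L q" by auto
qed (use D_le[OF L] in blast)

lemma sublevel_dilation: "0 < k \<Longrightarrow> 0 < L \<Longrightarrow> sublevel L q \<longleftrightarrow> sublevel (k * L) (dilation e k q)"
proof -
  assume k: "0 < k" and L: "0 < L"
  have 1: "sublevel L q \<Longrightarrow> sublevel (k * L) (dilation e k q)" if "0 < k" "0 < L" for k L q
    using dil[OF that(1), of L 0 q] that steers_iff[of L q] steers_iff[of "k*L"] by simp
  show ?thesis using 1[OF k L] 1[of "1/k" "k * L" "dilation e k q"] k L by (auto simp: dilation_dilation)
qed

lemma open_sublevel_1_0: "open_sublevel 1 0"
proof -
  have "sublevel (1/2) 0" using steers_const[of N "1/2" X1 X2 0] N_0 steers_iff[of "1/2" 0] by simp
  then show ?thesis using sublevel_imp_open_sublevel[of "1/2" 1 0] by simp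
qed

text \<open>Small dilation factors bring \<open>q\<close> into the neighbourhood
  \<open>open_sublevel 1\<close> of 0, and scaling back gives a radius for \<open>q\<close>. Thus
  all distances from 0 are finite.\<close>

lemma ex_sublevel: "\<exists>L>0. sublevel L q"
proof -
  have "((\<lambda>k. dilation e k q) \<longlongrightarrow> dilation e 0 q) (at_right 0)"
    unfolding dilation_def by (intro tendsto_vec_lambda tendsto_intros)
  moreover have "dilation e 0 q = 0" unfolding dilation_def
    by (simp add: vec_eq_iff power_0_left e_neq_0)
  ultimately have "\<forall>\<^sub>F k in at_right 0. dilation e k q \<in> {q. open_sublevel 1 q}"
    using topological_tendstoD[OF _ open_open_sublevel(1)[of 1]] open_sublevel_1_0 by auto
  moreover have "\<forall>\<^sub>F k in at_right (0::real). k > 0" by (simp add: eventually_at_right_less)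
  ultimately have "\<forall>\<^sub>F k in at_right (0::real). k > 0 \<and> open_sublevel 1 (dilation e k q)" by eventually_elim auto
  then obtain k :: real where k: "k > 0" "open_sublevel 1 (dilation e k q)"
    using eventually_happens' trivial_limit_at_right_real by (metis (mono_tags, lifting))
  then obtain L where "0 < L" "sublevel L (dilation e k q)" using open_sublevel_imp_sublevel[of 1] by auto
  then have "sublevel (L / k) q" using sublevel_dilation[of k "L / k" q] k by simp
  then show ?thesis using \<open>0 < L\<close> k by (intro exI[of _ "L / k"]) simp
qed

section \<open>The distance from the origin as a real function\<close>

definition dist0 where "dist0 q = enn2real (D q)"

lemma D_eq_dist0: "D q = ennreal (dist0 q)" and dist0_nonneg: "0 \<le> dist0 q"
proof -
  obtain L where "L > 0" "sublevel L q" using ex_sublevel by blast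
  then have "D q \<le> ennreal L" using D_le_iff by blast
  then have "D q < top" by (simp add: le_less_trans)
  then show "D q = ennreal (dist0 q)" unfolding dist0_def by (simp add: ennreal_enn2real_if)
  show "0 \<le> dist0 q" unfolding dist0_def by simp
qed

lemma dist0_less_iff: "0 < L \<Longrightarrow> dist0 q < L \<longleftrightarrow> open_sublevel L q"
  using D_less_iff[of L q] unfolding D_eq_dist0 by (simp add: ennreal_less_iff dist0_nonneg)

lemma dist0_le_iff: "0 < L \<Longrightarrow> dist0 q \<le> L \<longleftrightarrow> sublevel L q"
  using D_le_iff[of L q] unfolding D_eq_dist0 by simp

lemma continuous_on_dist0: "continuous_on S dist0"
proof -
  have "(dist0 \<longlongrightarrow> dist0 x) (at x)" for x
  proof (rule order_tendstoI)
    fix a assume a: "dist0 x < a"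
    then have a0: "a > 0" using dist0_nonneg[of x] by linarith
    have "{q. dist0 q < a} = {q. open_sublevel a q}" using dist0_less_iff[OF a0] by simp
    then have "open {q. dist0 q < a}" using open_open_sublevel(1) by simp
    then show "\<forall>\<^sub>F q in at x. dist0 q < a" using a by (auto dest!: eventually_nhds_in_open[of _ x] simp: eventually_at_filter elim: eventually_mono)
  next
    fix a assume a: "a < dist0 x"
    \<comment> \<open>The equivalence with \<open>sublevel\<close> holds at positive radii, so
      \<open>a\<close> is raised to a positive level still below \<open>dist0 x\<close>.\<close>
    define b where "b = max a (dist0 x / 2)"
    show "\<forall>\<^sub>F q in at x. a < dist0 q"
    proof (cases "dist0 x = 0")
      case True
      then show ?thesis using a dist0_nonneg by (auto intro!: always_eventually intro: less_le_trans)
    next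
      case False
      then have b: "b > 0" "b < dist0 x" "a \<le> b" using a dist0_nonneg[of x] unfolding b_def by auto
      have "{q. b < dist0 q} = - {q. sublevel b q}" using dist0_le_iff[OF b(1)] by force
      then have "open {q. b < dist0 q}" using closed_sublevel(1) by auto
      then show ?thesis using b(2,3) by (auto dest!: eventually_nhds_in_open[of _ x] simp: eventually_at_filter elim: eventually_mono)
    qed
  qed
  then show ?thesis by (simp add: continuous_on_def tendsto_within_subset[OF _ subset_UNIV])
qed

lemma dist0_dilation:
  assumes k: "k > 0" shows "dist0 (dilation e k q) = k * dist0 q"
proof -
  have *: "dist0 q \<le> L \<longleftrightarrow> dist0 (dilation e k q) \<le> k * L" if "L > 0" for L
    using dist0_le_iff[OF that, of q] dist0_le_iff[of "k * L" "dilation e k q"] sublevel_dilation[OF k that, of q] k that by simp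
  define x y where "x = dist0 q" and "y = dist0 (dilation e k q) / k"
  have xy: "x \<ge> 0" "y \<ge> 0" using dist0_nonneg k unfolding x_def y_def by auto
  have "x \<le> L \<longleftrightarrow> y \<le> L" if "L > 0" for L using *[OF that] k unfolding x_def y_def by (simp add: field_simps)
  \<comment> \<open>Two different nonnegative numbers have a positive midpoint, which separates
    them.\<close>
  from this[of "(x+y)/2"] have "x = y" using xy by (cases "x = y") (auto simp: field_simps)
  then show ?thesis using k unfolding x_def y_def by simp
qed

lemma bounded_sublevel: "bounded {q. sublevel 1 q}"
proof -
  define C where "C = {q :: real^'n. \<forall>j. \<bar>q$j\<bar> \<le> 1}"
  have "C = cbox (- 1) 1" unfolding C_def by (auto simp: mem_box_cart abs_le_iff)
  then have C: "compact C" by simp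
  have "bounded (U 1 ` C)" "bounded (V 1 ` C)"
    using C continuous_on_bounds(3,4) by (auto intro!: compact_imp_bounded compact_continuous_image)
  then obtain B B' where B: "\<And>q. q \<in> C \<Longrightarrow> \<bar>U 1 q\<bar> \<le> B" "\<And>q. q \<in> C \<Longrightarrow> \<bar>V 1 q\<bar> \<le> B'"
    by (auto simp: bounded_iff)
  have "\<bar>q$j\<bar> \<le> max 1 (max B B')" if q: "sublevel 1 q" for q j
  proof (cases "j = v")
    case False
    then show ?thesis using ell_bound[of j q] q unfolding sublevel_def by auto
  next
    case True
    \<comment> \<open>\<open>U 1\<close> and \<open>V 1\<close> are bounded on the compact cube, but
      \<open>q $ v\<close> is not yet controlled; putting 0 in its place changes neither
      bound.\<close>
    define p where "p = q + axis v (- q$v)"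
    have "\<bar>p $ j\<bar> \<le> 1" for j
    proof (cases "j = v")
      case False
      then show ?thesis using ell_bound[of j q] q unfolding sublevel_def p_def by (auto simp: axis_def)
    qed (simp add: p_def axis_def)
    then have "p \<in> C" unfolding C_def by simp
    moreover have "U 1 p = U 1 q" "V 1 p = V 1 q" unfolding p_def indep by auto
    ultimately have "\<bar>U 1 q\<bar> \<le> B" "\<bar>V 1 q\<bar> \<le> B'" using B by metis+
    then show ?thesis using q True unfolding sublevel_def by auto
  qed
  note * = this
  show ?thesis
  proof (rule boundedI)
    fix q assume "q \<in> {q. sublevel 1 q}"
    then have "(\<Sum>j\<in>UNIV. \<bar>q$j\<bar>) \<le> (\<Sum>j\<in>(UNIV::'n set). max 1 (max B B'))" using * by (intro sum_mono) auto
    then show "norm q \<le> (\<Sum>j\<in>(UNIV::'n set). max 1 (max B B'))" using norm_le_l1_cart[of q] by linarith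
  qed
qed

text \<open>Dilations multiply the distance, so a nonzero point at distance 0 would have all its
  dilates in the bounded unit ball.\<close>

lemma dist0_pos: assumes "q \<noteq> 0" shows "dist0 q > 0"
proof (rule ccontr)
  assume "\<not> dist0 q > 0"
  then have dq: "dist0 q = 0" using dist0_nonneg[of q] by simp
  obtain B where B: "\<And>q. sublevel 1 q \<Longrightarrow> norm q \<le> B" using bounded_sublevel unfolding bounded_iff by blast
  define k where "k = max 1 ((B + 1) / norm q)"
  have k: "k \<ge> 1" "k * norm q \<ge> B + 1" using assms unfolding k_def by (auto simp: max_def field_simps)
  have "dist0 (dilation e k q) = 0" using dist0_dilation[of k q] k dq by simp
  then have "sublevel 1 (dilation e k q)" using dist0_le_iff[of 1 "dilation e k q"] by simp
  then show False using B[of "dilation e k q"] norm_dilation_ge[of e k q] e k by auto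
qed

lemma dist0_0: "dist0 0 = 0"
proof -
  have "sublevel L 0" if "L > 0" for L
    using steers_const[of N L X1 X2 0] N_0 steers_iff[of L 0] that by simp
  then have "dist0 0 \<le> L" if "L > 0" for L using dist0_le_iff that by blast
  then have "dist0 0 \<le> 0" by (rule field_le_epsilon[of "dist0 0" 0, simplified])
  then show ?thesis using dist0_nonneg[of 0] by simp
qed

section \<open>Topology and regularity of the sphere\<close>

context fixes r :: real assumes r: "r > 0" begin

lemma sphere_eq: "sf_sphere N X1 X2 r = {q. dist0 q = r}"
  unfolding sf_sphere_def D_eq_dist0 using r dist0_nonneg by (auto simp: ennreal_inj)

text \<open>Along the dilation orbit of a nonzero point the distance is linear in the factor and the
  Euclidean norm strictly increases, so the orbit meets each of the two spheres exactly once.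
  \<open>G\<close> follows the orbit, and compactness makes this continuous bijection a
  homeomorphism.\<close>

lemma homeomorphic_sphere: "sf_sphere N X1 X2 r homeomorphic sphere (0::real^'n) 1"
proof -
  define G where "G u = dilation e (r / dist0 u) u" for u
  have pos: "dist0 u > 0" if "u \<in> sphere 0 1" for u using that by (intro dist0_pos) auto
  have "continuous_on (sphere 0 1) (\<lambda>u. dilation e (r / dist0 u) u)"
    unfolding dilation_def using pos
    by (intro continuous_intros continuous_on_dist0) (auto simp: less_imp_neq[symmetric])
  then have c: "continuous_on (sphere 0 1) G" unfolding G_def .
  have im: "G ` sphere 0 1 = {q. dist0 q = r}"
  proof (intro set_eqI iffI)
    fix q assume "q \<in> G ` sphere 0 1"
    then obtain u where u: "u \<in> sphere 0 1" "q = G u" by blast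
    then show "q \<in> {q. dist0 q = r}" using pos[OF u(1)] r unfolding G_def by (simp add: dist0_dilation)
  next
    fix q assume q: "q \<in> {q. dist0 q = r}"
    then have q0: "q \<noteq> 0" using dist0_0 r by auto
    \<comment> \<open>At factor 0 the dilate is 0, at factor \<open>M\<close> it has norm at least
      1; in between it crosses the unit sphere.\<close>
    define M where "M = max 1 (1 / norm q)"
    have M: "M \<ge> 1" "M * norm q \<ge> 1" using q0 unfolding M_def by (auto simp: max_def field_simps)
    have "continuous_on {0..M} (\<lambda>k. norm (dilation e k q))"
      unfolding dilation_def by (intro continuous_intros)
    moreover have "norm (dilation e 0 q) = 0"
      by (simp add: dilation_def vec_eq_iff power_0_left e_neq_0)
    moreover have "norm (dilation e M q) \<ge> 1" using norm_dilation_ge[of e M q] e M by auto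
    ultimately obtain k where k: "0 \<le> k" "k \<le> M" "norm (dilation e k q) = 1"
      using IVT'[of "\<lambda>k. norm (dilation e k q)" 0 1 M] M by auto
    have k0: "k > 0" using k \<open>norm (dilation e 0 q) = 0\<close> by (cases "k = 0") auto
    have "G (dilation e k q) = q"
      unfolding G_def using k0 q r by (simp add: dist0_dilation dilation_dilation)
    moreover have "dilation e k q \<in> sphere 0 1" using k by simp
    ultimately show "q \<in> G ` sphere 0 1" by (metis image_eqI)
  qed
  \<comment> \<open>The expansion estimate speaks of factors at least 1, so the two factors are
    ordered first.\<close>
  have wlog: "u = w" if uw: "u \<in> sphere 0 1" "w \<in> sphere 0 1" "G u = G w" "r / dist0 u \<le> r / dist0 w" for u w
  proof -
    define k m where "k = r / dist0 u" and "m = r / dist0 w"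
    have km: "k > 0" "m > 0" "k \<le> m" using uw pos r unfolding k_def m_def by auto
    have "u = dilation e (1/k) (dilation e k u)" using km by (simp add: dilation_dilation)
    also have "dilation e k u = dilation e m w" using uw(3) unfolding G_def k_def m_def .
    also have "dilation e (1/k) (dilation e m w) = dilation e (m / k) w" by (simp add: dilation_dilation)
    finally have eq: "u = dilation e (m / k) w" .
    have "m / k \<le> 1" using norm_dilation_ge[of e "m / k" w] e km uw(1,2) eq by auto
    then have "m / k = 1" using km by (simp add: field_simps)
    then show ?thesis using eq by simp
  qed
  have "inj_on G (sphere 0 1)"
    by (rule inj_onI) (metis wlog linear)
  then have "sphere (0::real^'n) 1 homeomorphic {q. dist0 q = r}"
    using homeomorphic_compact[OF _ c im] by simp
  then show ?thesis unfolding sphere_eq using homeomorphic_sym by blast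
qed

lemma sphere_iff: "dist0 q = r \<longleftrightarrow> sublevel r q \<and> (ell q = r \<or> q$v = - V r q \<or> q$v = U r q)"
  using dist0_le_iff[OF r, of q] dist0_less_iff[OF r, of q] unfolding sublevel_def open_sublevel_def by auto

lemma semianalytic_sphere: "semianalytic (sf_sphere N X1 X2 r)"
proof -
  let ?T = "({q. ell q \<le> r} \<inter> ({q. - V r q \<le> q$v} \<inter> {q. q$v \<le> U r q})) \<inter>
     ({q. ell q = r} \<union> ({q. q$v = - V r q} \<union> {q. q$v = U r q}))"
  have eq: "sf_sphere N X1 X2 r = ?T"
    unfolding sphere_eq sphere_iff sublevel_def by auto
  note u = piecewise_poly_uminus[OF pw(2)[of r]]
  note c = piecewise_poly_coord[of v]
  note k = piecewise_poly_const[of r]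
  have "semialgebraic ?T"
    by (rule semialgebraic_Int[OF semialgebraic_Int[OF semialgebraic_le[OF pw(3) k]
          semialgebraic_Int[OF semialgebraic_le[OF u c] semialgebraic_le[OF c pw(1)]]]
          semialgebraic_Un[OF semialgebraic_eq[OF pw(3) k] semialgebraic_Un[OF semialgebraic_eq[OF c u] semialgebraic_eq[OF c pw(1)]]]])
  then show ?thesis unfolding eq by (rule semialgebraic_imp_semianalytic)
qed

text \<open>On the sphere one of the three inequalities is an equality. Two of them are graphs in
  direction \<open>v\<close>; the list \<open>l\<close> has to account for
  \<open>ell q = r\<close>.\<close>

lemma rectifiable_sphere:
  assumes card: "CARD('n) = CARD('m) + 1"
    and l: "\<And>j f. (j,f) \<in> set l \<Longrightarrow> piecewise_poly f \<and> (\<forall>q t. f (\<chi> k. if k = j then t else q$k) = f q)"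
    and cov: "\<And>q. ell q = r \<Longrightarrow> \<exists>(j,f)\<in>set l. q$j = f q"
  shows "rectifiable_set TYPE(real^'m) (sf_sphere N X1 X2 r)"
proof (rule rectifiable_set_finite_graphs[OF card, of _ "(v, U r) # (v, \<lambda>q. - V r q) # l"])
  have "bounded (dilation e r ` {q. sublevel 1 q})"
    using bounded_sublevel linear_dilation by (intro bounded_linear_image) (auto simp: linear_conv_bounded_linear)
  moreover have "sf_sphere N X1 X2 r \<subseteq> dilation e r ` {q. sublevel 1 q}"
  proof
    fix q assume "q \<in> sf_sphere N X1 X2 r"
    then have "dist0 (dilation e (1/r) q) = 1" using r unfolding sphere_eq by (simp add: dist0_dilation)
    then have "sublevel 1 (dilation e (1/r) q)" using dist0_le_iff[of 1 "dilation e (1/r) q"] by simp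
    moreover have "q = dilation e r (dilation e (1/r) q)" using r by (simp add: dilation_dilation)
    ultimately show "q \<in> dilation e r ` {q. sublevel 1 q}" by blast
  qed
  ultimately show "bounded (sf_sphere N X1 X2 r)" by (rule bounded_subset)
next
  have eq: "(\<chi> k. if k = v then t else q$k) = q + axis v (t - q$v)" for t and q :: "real^'n"
    by (auto simp: vec_eq_iff axis_def)
  show "piecewise_poly f \<and> (\<forall>q t. f (\<chi> k. if k = j then t else q$k) = f q)"
    if "(j,f) \<in> set ((v, U r) # (v, \<lambda>q. - V r q) # l)" for j f
    using that l[of j f] pw by (auto simp: eq indep intro: piecewise_poly_uminus)
next
  fix q assume "q \<in> sf_sphere N X1 X2 r"
  then show "\<exists>(j,f)\<in>set ((v, U r) # (v, \<lambda>q. - V r q) # l). q$j = f q"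
    using cov[of q] unfolding sphere_eq sphere_iff by auto
qed

end
end

section \<open>Calibrations by functions of the coordinates\<close>

text \<open>Calibrations must be differentiable everywhere, although the derivatives wanted contain
  absolute values; their antiderivatives are built from this one.\<close>

lemma DERIV_times_abs: "((\<lambda>u::real. u * \<bar>u\<bar>) has_real_derivative 2 * \<bar>u\<bar>) (at u)"
proof -
  consider "u > 0" | "u < 0" | "u = 0" by linarith
  then show ?thesis
  proof cases
    case 1
    have "((\<lambda>u::real. u * u) has_real_derivative 2 * \<bar>u\<bar>) (at u)" using 1 by (auto intro!: derivative_eq_intros)
    then show ?thesis by (rule has_field_derivative_transform_within_open[of _ _ _ "{0<..}"]) (use 1 in auto)
  next
    case 2
    have "((\<lambda>u::real. - (u * u)) has_real_derivative 2 * \<bar>u\<bar>) (at u)" using 2 by (auto intro!: derivative_eq_intros)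
    then show ?thesis by (rule has_field_derivative_transform_within_open[of _ _ _ "{..<0}"]) (use 2 in auto)
  next
    case 3
    have "((\<lambda>h::real. \<bar>h\<bar>) \<longlongrightarrow> 0) (at 0)" by (auto intro!: tendsto_eq_intros)
    then have "((\<lambda>h::real. (h * \<bar>h\<bar>) / h) \<longlongrightarrow> 0) (at 0)"
      by (rule Lim_transform_eventually) (simp add: eventually_at_filter)
    then show ?thesis using 3 by (simp add: DERIV_def)
  qed
qed

lemmas has_derivative_vec_nth = bounded_linear.has_derivative[OF bounded_linear_vec_nth]

lemma has_derivative_compose_vec_nth:
  fixes q :: "real^'n"
  assumes "(h has_real_derivative d) (at (q $ i))"
  shows "((\<lambda>q. h (q $ i)) has_derivative (\<lambda>v. d * v $ i)) (at q)"
  using has_derivative_compose[OF has_derivative_vec_nth[OF has_derivative_ident] assms[unfolded has_field_derivative_def]]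
  by simp

lemma calibration_real:
  fixes \<gamma> :: "real \<Rightarrow> 'a::euclidean_space"
  assumes "horizontal X1 X2 T \<gamma>" "0 \<le> s" "s \<le> t" "t \<le> T"
    and l: "arc_length N X1 X2 T \<gamma> s t = ennreal l" "0 \<le> l"
    and "lipschitz_on_balls \<phi>" and "\<And>q. (\<phi> has_derivative \<phi>' q) (at q)" and C: "0 \<le> C"
    and "\<And>\<tau> w1 w2. \<tau> \<in> {s..t} \<Longrightarrow>
       \<phi>' (\<gamma> \<tau>) (w1 *\<^sub>R X1 (\<gamma> \<tau>) + w2 *\<^sub>R X2 (\<gamma> \<tau>)) \<le> C * N w1 w2"
  shows "\<phi> (\<gamma> t) - \<phi> (\<gamma> s) \<le> C * l"
proof -
  have "ennreal (\<phi> (\<gamma> t) - \<phi> (\<gamma> s)) \<le> ennreal C * arc_length N X1 X2 T \<gamma> s t"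
    by (rule calibration[of X1 X2 T \<gamma> s t \<phi> \<phi>']) (use assms in \<open>auto simp: lipschitz_on_balls_def\<close>)
  also have "\<dots> = ennreal (C * l)" using C l by (simp add: ennreal_mult)
  finally show ?thesis using mult_nonneg_nonneg[OF C l(2)] by (auto simp: ennreal_le_iff2)
qed

text \<open>The sum of the three lengths is finite, hence each of them, and they can be added as
  reals. A single cut is the case in which the last arc is degenerate.\<close>

lemma arc_length_split3:
  assumes "0 \<le> s" "s \<le> t" "t \<le> T" "sf_length N X1 X2 T \<gamma> \<le> ennreal L" "0 \<le> L"
  obtains l1 l2 l3 where "0 \<le> l1" "0 \<le> l2" "0 \<le> l3"
    "arc_length N X1 X2 T \<gamma> 0 s = ennreal l1" "arc_length N X1 X2 T \<gamma> s t = ennreal l2"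
    "arc_length N X1 X2 T \<gamma> t T = ennreal l3" "l1 + l2 + l3 \<le> L"
proof -
  let ?l = "arc_length N X1 X2 T \<gamma>"
  have "?l 0 s + ?l s t + ?l t T \<le> ?l 0 t + ?l t T"
    using assms arc_length_superadditive[of 0 s t N X1 X2 T \<gamma>] by (intro add_right_mono) auto
  also have "\<dots> \<le> ?l 0 T" using assms by (intro arc_length_superadditive) auto
  also have "\<dots> \<le> ennreal L" using arc_length_le_sf_length assms(4) by (rule order_trans)
  finally have le: "?l 0 s + ?l s t + ?l t T \<le> ennreal L" .
  then have "?l 0 s + ?l s t + ?l t T \<noteq> top" by (auto simp: top_unique)
  then have "?l 0 s \<noteq> top" "?l s t \<noteq> top" "?l t T \<noteq> top" by auto
  then obtain l1 l2 l3 where l: "0 \<le> l1" "0 \<le> l2" "0 \<le> l3" "?l 0 s = ennreal l1" "?l s t = ennreal l2" "?l t T = ennreal l3"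
    by (metis ennreal_cases)
  then have "ennreal (l1 + l2 + l3) \<le> ennreal L" using le by (simp add: ennreal_plus)
  then have "l1 + l2 + l3 \<le> L" using assms(5) by (simp only: ennreal_le_iff)
  with l that show thesis by blast
qed

lemma horizontal_coord_attains_max:
  fixes \<gamma> :: "real \<Rightarrow> real^'n"
  assumes "horizontal X1 X2 T \<gamma>" "0 \<le> T" and f: "continuous_on UNIV f"
  shows "\<exists>t. 0 \<le> t \<and> t \<le> T \<and> (\<forall>\<tau>. 0 \<le> \<tau> \<longrightarrow> \<tau> \<le> T \<longrightarrow> f (\<gamma> \<tau>) \<le> (f (\<gamma> t) :: real))"
proof -
  have "continuous_on {0..T} \<gamma>" using assms abs_continuous_on_imp_continuous_on unfolding horizontal_def by blast
  then have "continuous_on {0..T} (\<lambda>\<tau>. f (\<gamma> \<tau>))"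
    using continuous_on_compose2[OF f] by blast
  then obtain t where "t \<in> {0..T}" "\<forall>\<tau>\<in>{0..T}. f (\<gamma> \<tau>) \<le> f (\<gamma> t)"
    using continuous_attains_sup[of "{0..T}" "\<lambda>\<tau>. f (\<gamma> \<tau>)"] assms(2) by auto
  then show ?thesis by auto
qed

lemma coeff_norm_simps:
  "0 \<le> norm_inf_coeff a b" "0 \<le> norm_one_coeff a b" "norm_inf_coeff 0 0 = 0" "norm_one_coeff 0 0 = 0"
  "norm_inf_coeff a 0 = \<bar>a\<bar>" "norm_inf_coeff 0 a = \<bar>a\<bar>" "norm_one_coeff a 0 = \<bar>a\<bar>" "norm_one_coeff 0 a = \<bar>a\<bar>"
  by (auto simp: norm_inf_coeff_def norm_one_coeff_def)

text \<open>\<open>triv\<close> treats the zero control, whose norm 0 leaves no duration to rescale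
  to.\<close>

lemma steers_flow_coeff_norm:
  assumes N: "N = norm_inf_coeff \<or> N = norm_one_coeff"
    and der: "\<And>t. (\<gamma> has_vector_derivative (w1 *\<^sub>R X1 (\<gamma> t) + w2 *\<^sub>R X2 (\<gamma> t))) (at t)"
    and cont: "continuous_on {0..1} (\<lambda>t. w1 *\<^sub>R X1 (\<gamma> t) + w2 *\<^sub>R X2 (\<gamma> t))"
    and triv: "w1 = 0 \<Longrightarrow> w2 = 0 \<Longrightarrow> \<gamma> 1 = \<gamma> 0"
  shows "steers N X1 X2 (N w1 w2) (\<gamma> 0) (\<gamma> 1)"
proof (cases "w1 = 0 \<and> w2 = 0")
  case True
  then have "N w1 w2 = 0" using N by (auto simp: coeff_norm_simps)
  then show ?thesis using triv True steers_refl by metis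
next
  case False
  show ?thesis
  proof (rule steers_flow[OF der cont])
    show "N (a * w1) (a * w2) = a * N w1 w2" if "0 \<le> a" for a
      using N that by (auto simp: norm_inf_coeff_def norm_one_coeff_def abs_mult max_mult_distrib_left distrib_left)
    show "N w1 w2 > 0" using N False by (auto simp: norm_inf_coeff_def norm_one_coeff_def)
  qed
qed

section \<open>Grushin plane\<close>

lemma steers_grushin:
  assumes N: "N = norm_inf_coeff \<or> N = norm_one_coeff"
  shows "steers N grushin_X1 grushin_X2 (N w1 w2) (vector [x, y]) (vector [x + w1, y + w2 * (x + w1 / 2)])"
proof -
  define \<gamma> :: "real \<Rightarrow> real^2" where "\<gamma> t = vector [x, y] + t *\<^sub>R vector [w1, w2 * x] + (t^2) *\<^sub>R vector [0, w1 * w2 / 2]" for t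
  have eq: "w1 *\<^sub>R grushin_X1 (\<gamma> t) + w2 *\<^sub>R grushin_X2 (\<gamma> t) = vector [w1, w2 * x] + (2 * t) *\<^sub>R vector [0, w1 * w2 / 2]" for t
    by (simp add: \<gamma>_def grushin_X1_def grushin_X2_def vec_eq_iff forall_2 vector_2 algebra_simps)
  have "steers N grushin_X1 grushin_X2 (N w1 w2) (\<gamma> 0) (\<gamma> 1)"
  proof (rule steers_flow_coeff_norm[OF N])
    show "(\<gamma> has_vector_derivative (w1 *\<^sub>R grushin_X1 (\<gamma> t) + w2 *\<^sub>R grushin_X2 (\<gamma> t))) (at t)" for t
      unfolding eq unfolding \<gamma>_def by (auto intro!: derivative_eq_intros)
    show "continuous_on {0..1} (\<lambda>t. w1 *\<^sub>R grushin_X1 (\<gamma> t) + w2 *\<^sub>R grushin_X2 (\<gamma> t))"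
      unfolding eq by (intro continuous_intros)
    show "\<gamma> 1 = \<gamma> 0" if "w1 = 0" "w2 = 0"
      using that by (simp add: \<gamma>_def vec_eq_iff forall_2 vector_2)
  qed
  moreover have "\<gamma> 0 = vector [x, y]" "\<gamma> 1 = vector [x + w1, y + w2 * (x + w1 / 2)]"
    by (simp_all add: \<gamma>_def vec_eq_iff forall_2 vector_2 algebra_simps)
  ultimately show ?thesis by simp
qed

definition grushin_e :: "2 \<Rightarrow> nat" where "grushin_e j = (if j = 1 then 1 else 2)"

lemma steers_grushin_dilation:
  assumes "0 < k" "steers N grushin_X1 grushin_X2 L p q"
  shows "steers N grushin_X1 grushin_X2 (k * L) (dilation grushin_e k p) (dilation grushin_e k q)"
  by (rule steers_linear_image[OF assms(2) linear_dilation assms(1)])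
     (auto simp: dilation_def grushin_e_def grushin_X1_def grushin_X2_def vec_eq_iff forall_2 vector_2 power2_eq_square)

text \<open>Three legs of length \<open>L / 3\<close>: away from the line \<open>x = 0\<close>,
  along \<open>X2\<close>, and back. The first leg brings \<open>\<bar>x\<bar>\<close> to at least
  \<open>\<delta>\<close>, which matters on that line, where \<open>X2\<close> vanishes.\<close>

lemma steers_grushin_loop:
  assumes N: "N = norm_inf_coeff \<or> N = norm_one_coeff" and L: "0 < L"
  shows "\<exists>h>0. \<exists>h'>0. steers N grushin_X1 grushin_X2 L q (q + axis 2 h) \<and> steers N grushin_X1 grushin_X2 L q (q - axis 2 h')"
proof -
  define \<epsilon> :: real where "\<epsilon> = (if q$1 \<ge> 0 then 1 else -1)"
  have \<epsilon>: "\<bar>\<epsilon>\<bar> = 1" "\<epsilon> * \<epsilon> = 1" "\<epsilon> * q$1 = \<bar>q$1\<bar>" by (auto simp: \<epsilon>_def)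
  define \<delta> where "\<delta> = L / 3"
  define h where "h = (\<bar>q$1\<bar> + \<delta>) * \<delta>"
  have h: "h > 0" using L unfolding h_def \<delta>_def by (intro mult_pos_pos) auto
  have q: "q = vector [q$1, q$2]" by (simp add: vec_eq_iff forall_2 vector_2)
  have st: "steers N grushin_X1 grushin_X2 L q (q + axis 2 (\<sigma> * h))" if \<sigma>: "\<bar>\<sigma>\<bar> = 1" for \<sigma>
  proof -
    have s: "\<sigma> * \<epsilon> * \<delta> * (q$1 + \<epsilon> * \<delta>) = \<sigma> * h"
    proof -
      have "\<sigma> * \<epsilon> * \<delta> * (q$1 + \<epsilon> * \<delta>) = \<sigma> * \<delta> * (\<epsilon> * q$1 + (\<epsilon> * \<epsilon>) * \<delta>)" by (simp add: algebra_simps)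
      then show ?thesis unfolding \<epsilon> h_def by (simp add: algebra_simps)
    qed
    from steers_trans[OF steers_trans[OF steers_grushin[OF N, of "\<epsilon> * \<delta>" 0 "q$1" "q$2"]
        steers_grushin[OF N, of 0 "\<sigma> * \<epsilon> * \<delta>"]] steers_grushin[OF N, of "- \<epsilon> * \<delta>" 0]]
    have "steers N grushin_X1 grushin_X2 (N (\<epsilon> * \<delta>) 0 + N 0 (\<sigma> * \<epsilon> * \<delta>) + N (- \<epsilon> * \<delta>) 0) q (vector [q$1, q$2 + \<sigma> * h])"
      using s q by simp
    moreover have "N (\<epsilon> * \<delta>) 0 + N 0 (\<sigma> * \<epsilon> * \<delta>) + N (- \<epsilon> * \<delta>) 0 = L"
      using N \<epsilon>(1) \<sigma> L by (auto simp: coeff_norm_simps abs_mult \<delta>_def)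
    moreover have "vector [q$1, q$2 + \<sigma> * h] = q + axis 2 (\<sigma> * h)"
      by (simp add: vec_eq_iff forall_2 vector_2 axis_def)
    ultimately show ?thesis by simp
  qed
  have "q + axis 2 (- h) = q - axis 2 h" by (simp add: vec_eq_iff axis_def)
  then show ?thesis using st[of 1] st[of "-1"] h by auto
qed

text \<open>Going out to \<open>\<bar>x\<bar> = \<mu>\<close> and back to the abscissa of
  \<open>q\<close> costs \<open>2 * \<mu> - \<bar>q$1\<bar>\<close>; the rest of \<open>L\<close>,
  spent along \<open>X2\<close>, gains \<open>\<mu>\<close> per unit. This is the maximum of
  \<open>\<mu> * (L + \<bar>q$1\<bar> - 2 * \<mu>)\<close> over
  \<open>\<mu> \<ge> \<bar>q$1\<bar>\<close>, with free maximiser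
  \<open>(L + \<bar>q$1\<bar>) / 4\<close>.\<close>

definition grushin_bound_one :: "real \<Rightarrow> real^2 \<Rightarrow> real" where
  "grushin_bound_one L q = max \<bar>q$1\<bar> ((L + \<bar>q$1\<bar>) / 4) * (L + \<bar>q$1\<bar> - 2 * max \<bar>q$1\<bar> ((L + \<bar>q$1\<bar>) / 4))"

text \<open>Under the sup norm \<open>X2\<close> can act at full strength all the time, so the gain
  is the integral of \<open>\<bar>x\<bar>\<close> on the way out to
  \<open>(L + \<bar>q$1\<bar>) / 2\<close> and back.\<close>

definition grushin_bound_inf :: "real \<Rightarrow> real^2 \<Rightarrow> real" where
  "grushin_bound_inf L q = (L + \<bar>q$1\<bar>)^2 / 4 - (q$1)^2 / 2"

lemma grushin_peak_one:
  fixes \<mu> a L :: real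
  assumes "a \<le> \<mu>"
  shows "\<mu> * (L + a - 2 * \<mu>) \<le> max a ((L + a) / 4) * (L + a - 2 * max a ((L + a) / 4))"
proof (cases "a \<le> (L + a) / 4")
  case True
  have "0 \<le> 2 * ((L + a) / 4 - \<mu>)^2" by simp
  then show ?thesis using True by (simp add: max_def power2_eq_square field_simps)
next
  case False
  have "0 \<le> (\<mu> - a) * (2 * \<mu> + 2 * a - (L + a))" using assms False by (intro mult_nonneg_nonneg) (auto simp: field_simps)
  then show ?thesis using False by (simp add: max_def algebra_simps)
qed

text \<open>The cut is at the largest \<open>\<bar>x\<bar>\<close>, called \<open>\<mu>\<close>. The
  calibrations add to \<open>s * y\<close> an odd function of \<open>x\<close> whose sign is
  reversed at the cut, so that both the way out and the way back are charged. The sign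
  \<open>s\<close> treats the upper and the lower bound together.\<close>

lemma grushin_barrier:
  assumes hor: "horizontal grushin_X1 grushin_X2 T \<gamma>" and T: "0 \<le> T" and g0: "\<gamma> 0 = 0"
    and N: "N = norm_inf_coeff \<or> N = norm_one_coeff"
    and len: "sf_length N grushin_X1 grushin_X2 T \<gamma> \<le> ennreal L" and L: "0 \<le> L" and s: "\<bar>s\<bar> = 1"
  shows "\<bar>\<gamma> T $ 1\<bar> \<le> L" "N = norm_one_coeff \<Longrightarrow> s * \<gamma> T $ 2 \<le> grushin_bound_one L (\<gamma> T)"
    "N = norm_inf_coeff \<Longrightarrow> s * \<gamma> T $ 2 \<le> grushin_bound_inf L (\<gamma> T)"
proof -
  have cf: "continuous_on UNIV (\<lambda>q :: real^2. \<bar>q $ 1\<bar>)" by (intro continuous_intros)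
  obtain t where t: "0 \<le> t" "t \<le> T" "\<And>\<tau>. 0 \<le> \<tau> \<Longrightarrow> \<tau> \<le> T \<Longrightarrow> \<bar>\<gamma> \<tau> $ 1\<bar> \<le> \<bar>\<gamma> t $ 1\<bar>"
    using horizontal_coord_attains_max[OF hor T, of "\<lambda>q. \<bar>q $ 1\<bar>"] cf by blast
  define \<mu> where "\<mu> = \<bar>\<gamma> t $ 1\<bar>"
  define x where "x = \<gamma> T $ 1"
  define \<epsilon> :: real where "\<epsilon> = (if \<gamma> t $ 1 \<ge> 0 then 1 else -1)"
  have \<epsilon>: "\<bar>\<epsilon>\<bar> = 1" "\<epsilon> * \<gamma> t $ 1 = \<mu>" "\<epsilon> * x \<le> \<bar>x\<bar>" by (auto simp: \<epsilon>_def \<mu>_def)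
  have \<mu>: "0 \<le> \<mu>" "\<bar>x\<bar> \<le> \<mu>" using t(3)[of T] T unfolding \<mu>_def x_def by auto
  obtain l1 l2 l3 where l: "0 \<le> l1" "0 \<le> l2" "0 \<le> l3"
    "arc_length N grushin_X1 grushin_X2 T \<gamma> 0 t = ennreal l1" "arc_length N grushin_X1 grushin_X2 T \<gamma> t T = ennreal l2"
    "arc_length N grushin_X1 grushin_X2 T \<gamma> T T = ennreal l3" "l1 + l2 + l3 \<le> L"
    using arc_length_split3[OF t(1,2) order_refl len L] by blast
  have lin: "\<sigma> * (\<gamma> b $ 1 - \<gamma> a $ 1) \<le> l" 
    if "\<bar>\<sigma>\<bar> = 1" "0 \<le> a" "a \<le> b" "b \<le> T" "arc_length N grushin_X1 grushin_X2 T \<gamma> a b = ennreal l" "0 \<le> l" for \<sigma> a b l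
  proof -
    have "\<sigma> * \<gamma> b $ 1 - \<sigma> * \<gamma> a $ 1 \<le> 1 * l"
    proof (rule calibration_real[OF hor that(2-6), where \<phi>="\<lambda>q. \<sigma> * q $ 1" and \<phi>'="\<lambda>q h. \<sigma> * h $ 1"])
      show "lipschitz_on_balls (\<lambda>q :: real^2. \<sigma> * q $ 1)" by (intro lipschitz_on_balls_intros)
      show "((\<lambda>q :: real^2. \<sigma> * q $ 1) has_derivative (\<lambda>h. \<sigma> * h $ 1)) (at q)" for q
        by (auto intro!: derivative_eq_intros has_derivative_vec_nth)
      show "\<sigma> * (w1 *\<^sub>R grushin_X1 (\<gamma> \<tau>) + w2 *\<^sub>R grushin_X2 (\<gamma> \<tau>)) $ 1 \<le> 1 * N w1 w2" for \<tau> w1 w2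
        using N abs_le_D1[of "\<sigma> * w1" "\<bar>w1\<bar>"] that(1) by (auto simp: grushin_X1_def grushin_X2_def norm_inf_coeff_def norm_one_coeff_def abs_mult)
    qed simp
    then show ?thesis by (simp add: algebra_simps)
  qed
  have "\<sigma> * x \<le> L" if "\<bar>\<sigma>\<bar> = 1" for \<sigma>
    using lin[OF that t(1,2) order_refl l(5,2)] lin[OF that order_refl t(1,2) l(4,1)] l g0
    unfolding x_def by (simp add: algebra_simps)
  from this[of 1] this[of "-1"] show "\<bar>\<gamma> T $ 1\<bar> \<le> L" unfolding x_def by auto
  show "s * \<gamma> T $ 2 \<le> grushin_bound_one L (\<gamma> T)" if N1: "N = norm_one_coeff"
  proof -
    \<comment> \<open>Since \<open>\<bar>x\<bar> \<le> \<mu>\<close>, the part from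
      \<open>X2\<close> is at most \<open>\<mu> * \<bar>w2\<bar>\<close>; a slope
      \<open>\<kappa>\<close> of size \<open>\<mu>\<close> completes this to \<open>\<mu>\<close>
      times the norm.\<close>
    have c: "s * \<gamma> b $ 2 + \<kappa> * \<gamma> b $ 1 - (s * \<gamma> a $ 2 + \<kappa> * \<gamma> a $ 1) \<le> \<mu> * l"
      if "\<bar>\<kappa>\<bar> = \<mu>" "0 \<le> a" "a \<le> b" "b \<le> T" "arc_length N grushin_X1 grushin_X2 T \<gamma> a b = ennreal l" "0 \<le> l" for \<kappa> a b l
    proof (rule calibration_real[OF hor that(2-6), where \<phi>="\<lambda>q. s * q $ 2 + \<kappa> * q $ 1" and \<phi>'="\<lambda>q h. s * h $ 2 + \<kappa> * h $ 1"])
      show "lipschitz_on_balls (\<lambda>q :: real^2. s * q $ 2 + \<kappa> * q $ 1)" by (intro lipschitz_on_balls_intros)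
      show "((\<lambda>q :: real^2. s * q $ 2 + \<kappa> * q $ 1) has_derivative (\<lambda>h. s * h $ 2 + \<kappa> * h $ 1)) (at q)" for q
        by (auto intro!: derivative_eq_intros has_derivative_vec_nth)
      fix \<tau> w1 w2 :: real assume \<tau>: "\<tau> \<in> {a..b}"
      have "\<bar>\<gamma> \<tau> $ 1\<bar> \<le> \<mu>" using t(3)[of \<tau>] \<tau> that unfolding \<mu>_def by auto
      then have "\<bar>s * (w2 * \<gamma> \<tau> $ 1)\<bar> \<le> \<mu> * \<bar>w2\<bar>"
        using s mult_left_mono[of "\<bar>\<gamma> \<tau> $ 1\<bar>" \<mu> "\<bar>w2\<bar>"] by (simp add: abs_mult mult.commute)
      moreover have "\<bar>\<kappa> * w1\<bar> = \<mu> * \<bar>w1\<bar>" using that by (simp add: abs_mult)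
      ultimately show "s * (w1 *\<^sub>R grushin_X1 (\<gamma> \<tau>) + w2 *\<^sub>R grushin_X2 (\<gamma> \<tau>)) $ 2 + \<kappa> * (w1 *\<^sub>R grushin_X1 (\<gamma> \<tau>) + w2 *\<^sub>R grushin_X2 (\<gamma> \<tau>)) $ 1 \<le> \<mu> * N w1 w2"
        using N1 by (auto simp: grushin_X1_def grushin_X2_def norm_one_coeff_def distrib_left)
    qed (rule \<mu>)
    have e1: "\<epsilon> * \<mu> * \<gamma> t $ 1 = \<mu> * \<mu>" using \<epsilon>(2) by (metis mult.assoc mult.commute)
    have e2: "\<epsilon> * \<mu> * x = \<mu> * (\<epsilon> * x)" by simp
    have a1: "\<bar>\<epsilon> * \<mu>\<bar> = \<mu>" "\<bar>- (\<epsilon> * \<mu>)\<bar> = \<mu>" using \<epsilon>(1) \<mu>(1) by (simp_all add: abs_mult)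
    have z: "\<gamma> 0 $ i = 0" for i using g0 by simp
    have "s * \<gamma> t $ 2 + \<mu> * \<mu> \<le> \<mu> * l1"
      using c[OF a1(1) order_refl t(1,2) l(4,1)] unfolding e1 z by simp
    moreover have "s * \<gamma> T $ 2 - \<mu> * (\<epsilon> * x) - (s * \<gamma> t $ 2 - \<mu> * \<mu>) \<le> \<mu> * l2"
      using c[OF a1(2) t(1,2) order_refl l(5,2)] e1 e2 unfolding x_def mult_minus_left by linarith
    moreover have "\<mu> * (\<epsilon> * x) \<le> \<mu> * \<bar>x\<bar>" using \<epsilon> \<mu> by (intro mult_left_mono) auto
    moreover have "\<mu> * l1 + \<mu> * l2 \<le> \<mu> * L" using l \<mu> by (simp add: distrib_left[symmetric] mult_left_mono)
    ultimately have "s * \<gamma> T $ 2 \<le> \<mu> * (L + \<bar>x\<bar> - 2 * \<mu>)" by (simp add: algebra_simps)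
    then show ?thesis using grushin_peak_one[OF \<mu>(2), of L] unfolding grushin_bound_one_def x_def by linarith
  qed
  show "s * \<gamma> T $ 2 \<le> grushin_bound_inf L (\<gamma> T)" if N1: "N = norm_inf_coeff"
  proof -
    \<comment> \<open>The derivative \<open>\<mu> - \<bar>u\<bar>\<close> fills up the coefficient
      \<open>\<bar>u\<bar>\<close> of \<open>X2\<close> to \<open>\<mu>\<close>, so the sum is at
      most \<open>\<mu>\<close> times the sup norm.\<close>
    define H where "H u = \<mu> * u - u * \<bar>u\<bar> / 2" for u :: real
    have Hd: "(H has_real_derivative (\<mu> - \<bar>u\<bar>)) (at u)" for u
      using DERIV_diff[OF DERIV_cmult[OF DERIV_ident, of \<mu>] DERIV_cdivide[OF DERIV_times_abs, of 2], of u]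
      unfolding H_def by simp
    have c: "s * \<gamma> b $ 2 + \<kappa> * H (\<gamma> b $ 1) - (s * \<gamma> a $ 2 + \<kappa> * H (\<gamma> a $ 1)) \<le> \<mu> * l"
      if "\<bar>\<kappa>\<bar> = 1" "0 \<le> a" "a \<le> b" "b \<le> T" "arc_length N grushin_X1 grushin_X2 T \<gamma> a b = ennreal l" "0 \<le> l" for \<kappa> a b l
    proof (rule calibration_real[OF hor that(2-6), where \<phi>="\<lambda>q. s * q $ 2 + \<kappa> * H (q $ 1)" and \<phi>'="\<lambda>q h. s * h $ 2 + \<kappa> * ((\<mu> - \<bar>q $ 1\<bar>) * h $ 1)"])
      show "lipschitz_on_balls (\<lambda>q :: real^2. s * q $ 2 + \<kappa> * H (q $ 1))" unfolding H_def by (intro lipschitz_on_balls_intros)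
      show "((\<lambda>q :: real^2. s * q $ 2 + \<kappa> * H (q $ 1)) has_derivative (\<lambda>h. s * h $ 2 + \<kappa> * ((\<mu> - \<bar>q $ 1\<bar>) * h $ 1))) (at q)" for q
        by (rule has_derivative_eq_rhs[OF has_derivative_add[OF has_derivative_mult_right[OF has_derivative_vec_nth[OF has_derivative_ident]]
              has_derivative_mult_right[OF has_derivative_compose_vec_nth[OF Hd]]]]) simp
      fix \<tau> w1 w2 :: real assume \<tau>: "\<tau> \<in> {a..b}"
      let ?n = "max \<bar>w1\<bar> \<bar>w2\<bar>"
      have m: "\<bar>\<gamma> \<tau> $ 1\<bar> \<le> \<mu>" using t(3)[of \<tau>] \<tau> that unfolding \<mu>_def by auto
      have "\<bar>s * (w2 * \<gamma> \<tau> $ 1)\<bar> \<le> \<bar>\<gamma> \<tau> $ 1\<bar> * ?n"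
        using s mult_left_mono[of "\<bar>w2\<bar>" ?n "\<bar>\<gamma> \<tau> $ 1\<bar>"] by (simp add: abs_mult mult.commute)
      moreover have "\<bar>\<kappa> * ((\<mu> - \<bar>\<gamma> \<tau> $ 1\<bar>) * w1)\<bar> \<le> (\<mu> - \<bar>\<gamma> \<tau> $ 1\<bar>) * ?n" using that m by (simp add: abs_mult mult_left_mono)
      moreover have "\<bar>\<gamma> \<tau> $ 1\<bar> * ?n + (\<mu> - \<bar>\<gamma> \<tau> $ 1\<bar>) * ?n = \<mu> * ?n" by (simp add: algebra_simps)
      ultimately have "s * (w2 * \<gamma> \<tau> $ 1) + \<kappa> * ((\<mu> - \<bar>\<gamma> \<tau> $ 1\<bar>) * w1) \<le> \<mu> * ?n" by linarith
      then show "s * (w1 *\<^sub>R grushin_X1 (\<gamma> \<tau>) + w2 *\<^sub>R grushin_X2 (\<gamma> \<tau>)) $ 2 + \<kappa> * ((\<mu> - \<bar>\<gamma> \<tau> $ 1\<bar>) * (w1 *\<^sub>R grushin_X1 (\<gamma> \<tau>) + w2 *\<^sub>R grushin_X2 (\<gamma> \<tau>)) $ 1) \<le> \<mu> * N w1 w2"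
        using N1 by (simp add: grushin_X1_def grushin_X2_def norm_inf_coeff_def)
    qed (rule \<mu>)
    have Hodd: "\<epsilon> * H u = H (\<epsilon> * u)" for u using \<epsilon>(1) by (auto simp: H_def \<epsilon>_def)
    have z: "\<gamma> 0 $ i = 0" "H 0 = 0" for i using g0 by (simp_all add: H_def)
    have a1: "\<bar>- \<epsilon>\<bar> = 1" using \<epsilon>(1) by simp
    have e1: "\<epsilon> * H (\<gamma> t $ 1) = H \<mu>" "\<epsilon> * H (\<gamma> T $ 1) = H (\<epsilon> * x)" unfolding Hodd \<epsilon>(2) x_def by simp_all
    have "s * \<gamma> t $ 2 + H \<mu> \<le> \<mu> * l1"
      using c[OF \<epsilon>(1) order_refl t(1,2) l(4,1)] unfolding e1 z by simp
    moreover have "s * \<gamma> T $ 2 - H (\<epsilon> * x) - (s * \<gamma> t $ 2 - H \<mu>) \<le> \<mu> * l2"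
      using c[OF a1 t(1,2) order_refl l(5,2)] e1 by simp
    moreover have "H (\<epsilon> * x) \<le> \<mu> * \<bar>x\<bar> - x^2 / 2"
    proof -
      have "x * x \<le> \<mu> * \<bar>x\<bar>" using mult_right_mono[OF \<mu>(2), of "\<bar>x\<bar>"] by simp
      moreover have "0 \<le> \<mu> * \<bar>x\<bar>" using \<mu> by simp
      ultimately show ?thesis by (auto simp: H_def \<epsilon>_def power2_eq_square abs_if split: if_splits)
    qed
    moreover have "H \<mu> = \<mu>^2 / 2" using \<mu> by (simp add: H_def power2_eq_square)
    moreover have "\<mu> * l1 + \<mu> * l2 \<le> \<mu> * L" using l \<mu> by (simp add: distrib_left[symmetric] mult_left_mono)
    ultimately have "s * \<gamma> T $ 2 \<le> \<mu> * L - \<mu>^2 + \<mu> * \<bar>x\<bar> - x^2 / 2" by linarith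
    \<comment> \<open>The bound is a concave parabola in \<open>\<mu>\<close> with vertex
      \<open>(L + \<bar>x\<bar>) / 2\<close>.\<close>
    moreover have "0 \<le> (\<mu> - (L + \<bar>x\<bar>) / 2)^2" by simp
    ultimately show ?thesis unfolding grushin_bound_inf_def x_def by (simp add: power2_eq_square field_simps)
  qed
qed

text \<open>Out to the peak \<open>a\<close>, along \<open>X2\<close>, and back. The control
  \<open>w\<close> of the middle leg is fitted to \<open>q$2\<close>, and remaining time is spent
  waiting.\<close>

lemma steers_grushin_reach_one:
  assumes L: "0 < L" and x: "\<bar>q$1\<bar> \<le> L" and y: "\<bar>q$2\<bar> \<le> grushin_bound_one L q"
  shows "steers norm_one_coeff grushin_X1 grushin_X2 L 0 q"
proof -
  define a where "a = max \<bar>q$1\<bar> ((L + \<bar>q$1\<bar>) / 4)"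
  define \<epsilon> :: real where "\<epsilon> = (if q$1 \<ge> 0 then 1 else -1)"
  have \<epsilon>: "\<bar>\<epsilon>\<bar> = 1" "\<epsilon> * \<epsilon> = 1" "\<epsilon> * \<bar>q$1\<bar> = q$1" by (auto simp: \<epsilon>_def)
  have "(L + \<bar>q$1\<bar>) / 4 > 0" using L by (simp add: add_pos_nonneg)
  then have a: "a > 0" "\<bar>q$1\<bar> \<le> a" unfolding a_def by (simp_all only: less_max_iff_disj max.cobounded1 simp_thms)
  define w where "w = \<epsilon> * (q$2 / a)"
  have w: "\<bar>w\<bar> \<le> L + \<bar>q$1\<bar> - 2 * a"
    using y a \<epsilon>(1) unfolding w_def grushin_bound_one_def a_def[symmetric] by (simp add: abs_mult pos_divide_le_eq mult.commute)
  have "w * (\<epsilon> * a) = (\<epsilon> * \<epsilon>) * q$2" using a unfolding w_def by simp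
  then have wa: "w * (\<epsilon> * a) = q$2" using \<epsilon> by simp
  from steers_trans[OF steers_trans[OF steers_grushin[of norm_one_coeff "\<epsilon> * a" 0 0 0]
        steers_grushin[of norm_one_coeff 0 w]] steers_grushin[of norm_one_coeff "- \<epsilon> * (a - \<bar>q$1\<bar>)" 0]]
  have "steers norm_one_coeff grushin_X1 grushin_X2 (a + \<bar>w\<bar> + (a - \<bar>q$1\<bar>)) (vector [0, 0]) (vector [\<epsilon> * a - \<epsilon> * (a - \<bar>q$1\<bar>), q$2])"
    using a \<epsilon>(1) wa by (simp add: coeff_norm_simps abs_mult)
  moreover have "vector [\<epsilon> * a - \<epsilon> * (a - \<bar>q$1\<bar>), q$2] = q" "vector [0, 0] = (0 :: real^2)"
    using \<epsilon>(3) by (simp_all add: vec_eq_iff forall_2 vector_2 algebra_simps)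
  moreover have "a + \<bar>w\<bar> + (a - \<bar>q$1\<bar>) \<le> L" using w by simp
  ultimately show ?thesis using steers_mono[of norm_one_coeff] by (metis coeff_norm_simps(4) zero_le_one)
qed

text \<open>On the path out to \<open>m\<close> and back, the height is linear in the strength
  \<open>\<theta>\<close> of \<open>X2\<close>, and full strength gives the bound
  \<open>B\<close>.\<close>

lemma steers_grushin_reach_inf:
  assumes L: "0 < L" and x: "\<bar>q$1\<bar> \<le> L" and y: "\<bar>q$2\<bar> \<le> grushin_bound_inf L q"
  shows "steers norm_inf_coeff grushin_X1 grushin_X2 L 0 q"
proof -
  define a where "a = \<bar>q$1\<bar>"
  define m where "m = (L + a) / 2"
  define \<epsilon> :: real where "\<epsilon> = (if q$1 \<ge> 0 then 1 else -1)"
  have \<epsilon>: "\<bar>\<epsilon>\<bar> = 1" "\<epsilon> * \<epsilon> = 1" "\<epsilon> * a = q$1" by (auto simp: \<epsilon>_def a_def)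
  have m: "m > 0" "a \<le> m" "0 \<le> a" using L x unfolding m_def a_def by auto
  define B where "B = m^2 - a^2 / 2"
  have B: "B = grushin_bound_inf L q" unfolding B_def grushin_bound_inf_def m_def a_def by (simp add: power_divide)
  have "a^2 \<le> m^2" "m^2 > 0" using m by (auto intro: power_mono)
  then have B0: "B > 0" unfolding B_def by linarith
  define \<theta> where "\<theta> = q$2 / B"
  have \<theta>: "\<bar>\<theta>\<bar> \<le> 1" "\<theta> * B = q$2" using y B0 unfolding \<theta>_def B[symmetric] by (auto simp: abs_divide)
  have e2: "\<epsilon> * \<theta> * m * (\<epsilon> * m / 2) + \<epsilon> * \<theta> * (m - a) * (\<epsilon> * m + - \<epsilon> * (m - a) / 2) = q$2"
  proof -
    have "\<epsilon> * \<theta> * m * (\<epsilon> * m / 2) + \<epsilon> * \<theta> * (m - a) * (\<epsilon> * m + - \<epsilon> * (m - a) / 2)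
        = (\<epsilon> * \<epsilon>) * (\<theta> * (m * m / 2 + (m - a) * (m - (m - a) / 2)))" by (simp add: field_simps)
    also have "m * m / 2 + (m - a) * (m - (m - a) / 2) = B" unfolding B_def by (simp add: power2_eq_square field_simps)
    finally show ?thesis using \<epsilon> \<theta> by simp
  qed
  have n: "norm_inf_coeff (\<epsilon> * m) (\<epsilon> * \<theta> * m) = m" "norm_inf_coeff (- \<epsilon> * (m - a)) (\<epsilon> * \<theta> * (m - a)) = m - a"
    using \<epsilon>(1) \<theta>(1) m mult_right_mono[OF \<theta>(1), of m] mult_right_mono[OF \<theta>(1), of "m - a"]
    by (simp_all add: norm_inf_coeff_def abs_mult)
  from steers_trans[OF steers_grushin[of norm_inf_coeff "\<epsilon> * m" "\<epsilon> * \<theta> * m" 0 0]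
        steers_grushin[of norm_inf_coeff "- \<epsilon> * (m - a)" "\<epsilon> * \<theta> * (m - a)"]]
  have "steers norm_inf_coeff grushin_X1 grushin_X2 (m + (m - a)) (vector [0, 0]) (vector [\<epsilon> * m - \<epsilon> * (m - a), q$2])"
    unfolding n using e2 by simp
  moreover have "vector [\<epsilon> * m - \<epsilon> * (m - a), q$2] = q" "vector [0, 0] = (0 :: real^2)"
    using \<epsilon>(3) by (simp_all add: vec_eq_iff forall_2 vector_2 algebra_simps)
  moreover have "m + (m - a) = L" unfolding m_def by (simp add: field_simps)
  ultimately show ?thesis by simp
qed

lemma grushin_ell_graph:
  "\<exists>l. (\<forall>j f. (j,f)\<in>set l \<longrightarrow> piecewise_poly f \<and> (\<forall>q t. f (\<chi> k. if k = j then t else q$k) = f q)) \<and>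
     (\<forall>q :: real^2. \<bar>q$1\<bar> = r \<longrightarrow> (\<exists>(j,f)\<in>set l. q$j = f q))"
  by (intro exI[of _ "[(1, \<lambda>_. r), (1, \<lambda>_. - r)]"]) (auto intro: piecewise_poly_const)

lemma grushin_barriers:
  assumes NU: "N = norm_one_coeff \<and> U = grushin_bound_one \<or> N = norm_inf_coeff \<and> U = grushin_bound_inf"
  shows "sublevel_barriers N grushin_X1 grushin_X2 2 grushin_e (\<lambda>q. \<bar>q$1\<bar>) U U"
proof
  have N: "N = norm_inf_coeff \<or> N = norm_one_coeff" using NU by blast
  show "0 \<le> N w1 w2" for w1 w2 using N coeff_norm_simps by blast
  show "N 0 0 = 0" using N coeff_norm_simps by blast
  show "1 \<le> grushin_e j" for j by (simp add: grushin_e_def)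
  show "steers N grushin_X1 grushin_X2 (k * L) (dilation grushin_e k p) (dilation grushin_e k q)"
    if "0 < k" "steers N grushin_X1 grushin_X2 L p q" for k L p q
    using that by (rule steers_grushin_dilation)
  show "\<bar>\<gamma> T $ 1\<bar> \<le> L \<and> - U L (\<gamma> T) \<le> \<gamma> T $ 2 \<and> \<gamma> T $ 2 \<le> U L (\<gamma> T)"
    if *: "0 < L" "0 \<le> T" "horizontal grushin_X1 grushin_X2 T \<gamma>" "\<gamma> 0 = 0" "sf_length N grushin_X1 grushin_X2 T \<gamma> \<le> ennreal L"
    for L T \<gamma>
    using grushin_barrier[OF *(3,2,4) N *(5), of 1] grushin_barrier[OF *(3,2,4) N *(5), of "-1"] *(1) NU by auto
  show "steers N grushin_X1 grushin_X2 L 0 q"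
    if "0 < L" "\<bar>q $ 1\<bar> \<le> L" "- U L q \<le> q $ 2" "q $ 2 \<le> U L q" for L q
  proof -
    have "\<bar>q $ 2\<bar> \<le> U L q" using that by linarith
    then show ?thesis using that NU steers_grushin_reach_one[of L q] steers_grushin_reach_inf[of L q] by auto
  qed
  show "\<exists>h>0. \<exists>h'>0. steers N grushin_X1 grushin_X2 L q (q + axis 2 h) \<and> steers N grushin_X1 grushin_X2 L q (q - axis 2 h')"
    if "0 < L" for L q using N that by (rule steers_grushin_loop)
  show "U L (q + axis 2 h) = U L q" for L q h
    using NU by (auto simp: grushin_bound_one_def grushin_bound_inf_def axis_def)
  have "continuous_on UNIV (\<lambda>z. grushin_bound_one (fst z) (snd z))" "continuous_on UNIV (\<lambda>z. grushin_bound_inf (fst z) (snd z))"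
    unfolding grushin_bound_one_def grushin_bound_inf_def by (intro continuous_intros; simp)+
  then show "continuous_on UNIV (\<lambda>z. U (fst z) (snd z))" using NU by auto
  show "continuous_on UNIV (\<lambda>q :: real^2. \<bar>q $ 1\<bar>)" by (intro continuous_intros)
  have "piecewise_poly (grushin_bound_one L)" "piecewise_poly (grushin_bound_inf L)" for L
    unfolding grushin_bound_one_def grushin_bound_inf_def by (intro piecewise_poly_intros)+
  then show "piecewise_poly (U L)" for L using NU by auto
  show "piecewise_poly (\<lambda>q :: real^2. \<bar>q $ 1\<bar>)" by (intro piecewise_poly_intros)
  show "\<bar>q $ j\<bar> \<le> \<bar>q $ 1\<bar>" if "j \<noteq> 2" for j and q :: "real^2"
  proof -
    have "j = 1" using that exhaust_2 by blast
    then show ?thesis by simp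
  qed
qed

section \<open>Heisenberg group\<close>

text \<open>Under constant controls \<open>x * w2 - y * w1\<close> does not change, so the integral
  curve is a straight segment in these coordinates.\<close>

lemma steers_heis:
  assumes N: "N = norm_inf_coeff \<or> N = norm_one_coeff"
  shows "steers N heis_X1 heis_X2 (N w1 w2) (vector [x, y, z]) (vector [x + w1, y + w2, z + (x * w2 - y * w1) / 2])"
proof -
  define \<gamma> :: "real \<Rightarrow> real^3" where "\<gamma> t = vector [x, y, z] + t *\<^sub>R vector [w1, w2, (x * w2 - y * w1) / 2]" for t
  have eq: "w1 *\<^sub>R heis_X1 (\<gamma> t) + w2 *\<^sub>R heis_X2 (\<gamma> t) = vector [w1, w2, (x * w2 - y * w1) / 2]" for t
    by (simp add: \<gamma>_def heis_X1_def heis_X2_def vec_eq_iff forall_3 vector_3 field_simps)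
  have "steers N heis_X1 heis_X2 (N w1 w2) (\<gamma> 0) (\<gamma> 1)"
  proof (rule steers_flow_coeff_norm[OF N])
    show "(\<gamma> has_vector_derivative (w1 *\<^sub>R heis_X1 (\<gamma> t) + w2 *\<^sub>R heis_X2 (\<gamma> t))) (at t)" for t
      unfolding eq unfolding \<gamma>_def by (auto intro!: derivative_eq_intros)
    show "continuous_on {0..1} (\<lambda>t. w1 *\<^sub>R heis_X1 (\<gamma> t) + w2 *\<^sub>R heis_X2 (\<gamma> t))"
      unfolding eq by (intro continuous_intros)
    show "\<gamma> 1 = \<gamma> 0" if "w1 = 0" "w2 = 0"
      using that by (simp add: \<gamma>_def vec_eq_iff forall_3 vector_3)
  qed
  moreover have "\<gamma> 0 = vector [x, y, z]" "\<gamma> 1 = vector [x + w1, y + w2, z + (x * w2 - y * w1) / 2]"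
    by (simp_all add: \<gamma>_def vec_eq_iff forall_3 vector_3)
  ultimately show ?thesis by simp
qed

definition weights_3 :: "nat \<Rightarrow> 3 \<Rightarrow> nat" where "weights_3 m j = (if j = 3 then m else 1)"

lemma steers_heis_dilation:
  assumes "0 < k" "steers N heis_X1 heis_X2 L p q"
  shows "steers N heis_X1 heis_X2 (k * L) (dilation (weights_3 2) k p) (dilation (weights_3 2) k q)"
proof (rule steers_linear_image[OF assms(2) linear_dilation assms(1)])
  fix q w1 w2 assume "N w1 w2 \<le> 1"
  moreover have "dilation (weights_3 2) k (w1 *\<^sub>R heis_X1 q + w2 *\<^sub>R heis_X2 q) =
     k *\<^sub>R (w1 *\<^sub>R heis_X1 (dilation (weights_3 2) k q) + w2 *\<^sub>R heis_X2 (dilation (weights_3 2) k q))"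
    by (simp add: dilation_def weights_3_def heis_X1_def heis_X2_def vec_eq_iff forall_3 vector_3 power2_eq_square algebra_simps)
  ultimately show "\<exists>v1 v2. N v1 v2 \<le> 1 \<and> dilation (weights_3 2) k (w1 *\<^sub>R heis_X1 q + w2 *\<^sub>R heis_X2 q) =
     k *\<^sub>R (v1 *\<^sub>R heis_X1 (dilation (weights_3 2) k q) + v2 *\<^sub>R heis_X2 (dilation (weights_3 2) k q))" by blast
qed

text \<open>A square of side \<open>L / 4\<close>; \<open>z\<close> changes by the enclosed area,
  with the sign of the orientation \<open>\<sigma>\<close>.\<close>

lemma steers_heis_loop:
  assumes N: "N = norm_inf_coeff \<or> N = norm_one_coeff" and L: "0 < L"
  shows "\<exists>h>0. \<exists>h'>0. steers N heis_X1 heis_X2 L q (q + axis 3 h) \<and> steers N heis_X1 heis_X2 L q (q - axis 3 h')"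
proof -
  define \<delta> where "\<delta> = L / 4"
  have h: "\<delta> * \<delta> > 0" using L unfolding \<delta>_def by simp
  have q: "q = vector [q$1, q$2, q$3]" by (simp add: vec_eq_iff forall_3 vector_3)
  have st: "steers N heis_X1 heis_X2 L q (q + axis 3 (\<sigma> * (\<delta> * \<delta>)))" if \<sigma>: "\<bar>\<sigma>\<bar> = 1" for \<sigma>
  proof -
    let ?q1 = "vector [q$1 + \<delta>, q$2, q$3 - q$2 * \<delta> / 2] :: real^3"
    let ?q2 = "vector [q$1 + \<delta>, q$2 + \<sigma> * \<delta>, q$3 - q$2 * \<delta> / 2 + (q$1 + \<delta>) * (\<sigma> * \<delta>) / 2] :: real^3"
    let ?q3 = "vector [q$1, q$2 + \<sigma> * \<delta>, q$3 - q$2 * \<delta> / 2 + (q$1 + \<delta>) * (\<sigma> * \<delta>) / 2 + (q$2 + \<sigma> * \<delta>) * \<delta> / 2] :: real^3"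
    have "steers N heis_X1 heis_X2 (N \<delta> 0) q ?q1"
      using steers_heis[OF N, of \<delta> 0 "q$1" "q$2" "q$3"] q by simp
    moreover have "steers N heis_X1 heis_X2 (N 0 (\<sigma> * \<delta>)) ?q1 ?q2"
      using steers_heis[OF N, of 0 "\<sigma> * \<delta>"] by simp
    moreover have "steers N heis_X1 heis_X2 (N (- \<delta>) 0) ?q2 ?q3"
      using steers_heis[OF N, of "- \<delta>" 0 "q$1 + \<delta>"] by simp
    moreover have "steers N heis_X1 heis_X2 (N 0 (- (\<sigma> * \<delta>))) ?q3 (q + axis 3 (\<sigma> * (\<delta> * \<delta>)))"
    proof -
      have "q + axis 3 (\<sigma> * (\<delta> * \<delta>)) = vector [q$1 + 0, q$2 + \<sigma> * \<delta> + - (\<sigma> * \<delta>),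
          q$3 - q$2 * \<delta> / 2 + (q$1 + \<delta>) * (\<sigma> * \<delta>) / 2 + (q$2 + \<sigma> * \<delta>) * \<delta> / 2 + (q$1 * - (\<sigma> * \<delta>) - (q$2 + \<sigma> * \<delta>) * 0) / 2]"
        by (simp add: vec_eq_iff forall_3 vector_3 axis_def field_simps)
      then show ?thesis using steers_heis[OF N, of 0 "- (\<sigma> * \<delta>)" "q$1" "q$2 + \<sigma> * \<delta>"] by simp
    qed
    ultimately have "steers N heis_X1 heis_X2 (N \<delta> 0 + N 0 (\<sigma> * \<delta>) + N (- \<delta>) 0 + N 0 (- (\<sigma> * \<delta>))) q (q + axis 3 (\<sigma> * (\<delta> * \<delta>)))"
      by (blast intro: steers_trans)
    moreover have "N \<delta> 0 + N 0 (\<sigma> * \<delta>) + N (- \<delta>) 0 + N 0 (- (\<sigma> * \<delta>)) = L"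
      using N \<sigma> L by (auto simp: coeff_norm_simps abs_mult \<delta>_def)
    ultimately show ?thesis by simp
  qed
  have "q + axis 3 (- h) = q - axis 3 h" for h by (simp add: vec_eq_iff axis_def)
  then show ?thesis using st[of 1] st[of "-1"] h by auto
qed

text \<open>A rectangle problem: a projected path of length \<open>L\<close>, closed up by sides
  \<open>u\<close> and \<open>v\<close>, has perimeter \<open>L + u + v\<close>. The rectangle has
  sides \<open>w \<ge> u\<close> and \<open>K - w \<ge> v\<close>, and \<open>u * v / 2\<close> is
  the triangle between the closing sides and the chord. \<open>w\<close> is the point between
  \<open>u\<close> and \<open>K - v\<close> nearest to the vertex \<open>K / 2\<close> of
  \<open>w * (K - w)\<close>.\<close>

definition heis_bound :: "real \<Rightarrow> real \<Rightarrow> real \<Rightarrow> real" where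
  "heis_bound L u v = (let K = (L + u + v) / 2; w = max u (min (K / 2) (K - v)) in w * (K - w) - u * v / 2)"

lemma clamp_maximizes_product:
  fixes w K u v :: real
  assumes "u \<le> w" "w \<le> K - v"
  shows "w * (K - w) \<le> max u (min (K / 2) (K - v)) * (K - max u (min (K / 2) (K - v)))"
proof -
  \<comment> \<open>The difference of the two products is
    \<open>(m - w) * (K - m - w)\<close>.\<close>
  have *: "w * (K - w) \<le> m * (K - m)" if "0 \<le> (m - w) * (K - m - w)" for m
    using that by (simp add: algebra_simps)
  consider "max u (min (K / 2) (K - v)) = K / 2" | "max u (min (K / 2) (K - v)) = u" "K / 2 \<le> u"
    | "max u (min (K / 2) (K - v)) = K - v" "K - v \<le> K / 2"
  proof (cases "K / 2 \<le> u")
    case True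
    then have "max u (min (K / 2) (K - v)) = u" by simp
    then show ?thesis using that(2) True by blast
  next
    case False
    then show ?thesis using that(1,3) assms by (cases "K / 2 \<le> K - v") (simp_all add: max_def min_def)
  qed
  then show ?thesis
  proof cases
    case 1
    then show ?thesis by (simp only:, intro *) (simp add: field_simps zero_le_square power2_eq_square[symmetric] flip: power2_diff)
  next
    case 2
    have "0 \<le> (w - u) * (u + w - K)" using 2 assms by (intro mult_nonneg_nonneg) auto
    then show ?thesis unfolding 2(1) by (intro *) (simp add: algebra_simps)
  next
    case 3
    have "0 \<le> (K - v - w) * (K - (K - v) - w)" using 3 assms by (intro mult_nonneg_nonneg) auto
    then show ?thesis unfolding 3(1) by (intro *) simp
  qed
qed

text \<open>In the linear coordinates \<open>a = \<alpha>1 x + \<alpha>2 y\<close>, \<open>b = \<beta>1 x + \<beta>2 y\<close>, both coefficient norms are multiples of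
  \<open>\<bar>a'\<bar> + \<bar>b'\<bar>\<close>, and \<open>\<kappa> z + a b / 2\<close> has derivative \<open>a b'\<close> along horizontal curves.\<close>

lemma heis_barrier:
  fixes \<alpha>1 \<alpha>2 \<beta>1 \<beta>2 \<kappa> k :: real
  defines "a \<equiv> \<lambda>q :: real^3. \<alpha>1 * q$1 + \<alpha>2 * q$2" and "b \<equiv> \<lambda>q :: real^3. \<beta>1 * q$1 + \<beta>2 * q$2"
  assumes \<kappa>: "\<kappa> = \<alpha>1 * \<beta>2 - \<alpha>2 * \<beta>1" and k: "k > 0"
    and Nge: "\<And>w1 w2. k * (\<bar>\<alpha>1 * w1 + \<alpha>2 * w2\<bar> + \<bar>\<beta>1 * w1 + \<beta>2 * w2\<bar>) \<le> N w1 w2"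
    and hor: "horizontal heis_X1 heis_X2 T \<gamma>" and T: "0 \<le> T" and g0: "\<gamma> 0 = 0"
    and len: "sf_length N heis_X1 heis_X2 T \<gamma> \<le> ennreal L" and L: "0 \<le> L" and s: "\<bar>s\<bar> = 1"
  shows "\<bar>a (\<gamma> T)\<bar> + \<bar>b (\<gamma> T)\<bar> \<le> L / k" "s * \<kappa> * \<gamma> T $ 3 \<le> heis_bound (L / k) \<bar>a (\<gamma> T)\<bar> \<bar>b (\<gamma> T)\<bar>"
proof -
  have ca: "continuous_on UNIV a" "continuous_on UNIV (\<lambda>q. - a q)" unfolding a_def by (intro continuous_intros)+
  obtain tM where tM: "0 \<le> tM" "tM \<le> T" "\<And>\<tau>. 0 \<le> \<tau> \<Longrightarrow> \<tau> \<le> T \<Longrightarrow> a (\<gamma> \<tau>) \<le> a (\<gamma> tM)"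
    using horizontal_coord_attains_max[OF hor T ca(1)] by blast
  obtain tm where tm: "0 \<le> tm" "tm \<le> T" "\<And>\<tau>. 0 \<le> \<tau> \<Longrightarrow> \<tau> \<le> T \<Longrightarrow> - a (\<gamma> \<tau>) \<le> - a (\<gamma> tm)"
    using horizontal_coord_attains_max[OF hor T ca(2)] by blast
  define t1 t2 where "t1 = min tm tM" and "t2 = max tm tM"
  have t: "0 \<le> t1" "t1 \<le> t2" "t2 \<le> T" using tm tM unfolding t1_def t2_def by auto
  \<comment> \<open>\<open>\<sigma>\<close> records which extreme of \<open>a\<close> is attained
    first: \<open>a\<close> changes by \<open>\<sigma> * w\<close> between the two cuts.\<close>
  define \<sigma> :: real where "\<sigma> = (if tm \<le> tM then 1 else -1)"
  define w c where "w = a (\<gamma> tM) - a (\<gamma> tm)" and "c = (a (\<gamma> tM) + a (\<gamma> tm)) / 2"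
  have \<sigma>: "\<bar>\<sigma>\<bar> = 1" "\<sigma> * (a (\<gamma> t2) - a (\<gamma> t1)) = w" unfolding \<sigma>_def w_def t1_def t2_def by (auto simp: min_def max_def)
  have a0: "a (\<gamma> 0) = 0" "b (\<gamma> 0) = 0" "\<gamma> 0 $ 3 = 0" using g0 by (simp_all add: a_def b_def)
  define A B z where "A = a (\<gamma> T)" and "B = b (\<gamma> T)" and "z = \<gamma> T $ 3"
  have rng: "\<bar>a (\<gamma> \<tau>) - c\<bar> \<le> w / 2" if "0 \<le> \<tau>" "\<tau> \<le> T" for \<tau>
    using tM(3)[OF that] tm(3)[OF that] unfolding c_def w_def by (auto simp: abs_le_iff field_simps)
  have w: "\<bar>A\<bar> \<le> w" "\<bar>2 * c - A\<bar> \<le> w - \<bar>A\<bar>"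
  proof -
    have "0 \<le> a (\<gamma> tM)" "a (\<gamma> tm) \<le> 0" "A \<le> a (\<gamma> tM)" "a (\<gamma> tm) \<le> A"
      using tM(3)[of 0] tm(3)[of 0] tM(3)[of T] tm(3)[of T] T a0 unfolding A_def by auto
    moreover have "2 * c = a (\<gamma> tM) + a (\<gamma> tm)" unfolding c_def by simp
    ultimately show "\<bar>A\<bar> \<le> w" "\<bar>2 * c - A\<bar> \<le> w - \<bar>A\<bar>" unfolding w_def by linarith+
  qed
  obtain l1 l2 l3 where l: "0 \<le> l1" "0 \<le> l2" "0 \<le> l3"
    "arc_length N heis_X1 heis_X2 T \<gamma> 0 t1 = ennreal l1" "arc_length N heis_X1 heis_X2 T \<gamma> t1 t2 = ennreal l2"
    "arc_length N heis_X1 heis_X2 T \<gamma> t2 T = ennreal l3" "l1 + l2 + l3 \<le> L"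
    using arc_length_split3[OF t len L] by blast
  \<comment> \<open>Along horizontal curves the derivative is
    \<open>(\<eta>1 * a + \<eta>3) * b' + \<eta>2 * a'\<close>. If both coefficients are at most
    \<open>C\<close> in size, it is at most
    \<open>C * (\<bar>a'\<bar> + \<bar>b'\<bar>)\<close>.\<close>
  define \<phi> where "\<phi> \<eta>1 \<eta>2 \<eta>3 q = \<eta>1 * (\<kappa> * q$3 + a q * b q / 2) + \<eta>2 * a q + \<eta>3 * b q" for \<eta>1 \<eta>2 \<eta>3 and q :: "real^3"
  have cal: "\<phi> \<eta>1 \<eta>2 \<eta>3 (\<gamma> v) - \<phi> \<eta>1 \<eta>2 \<eta>3 (\<gamma> u) \<le> (C / k) * l"
    if u: "0 \<le> u" "u \<le> v" "v \<le> T" "arc_length N heis_X1 heis_X2 T \<gamma> u v = ennreal l" "0 \<le> l" and C: "0 \<le> C"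
     and \<eta>: "\<bar>\<eta>2\<bar> \<le> C" "\<And>\<tau>. u \<le> \<tau> \<Longrightarrow> \<tau> \<le> v \<Longrightarrow> \<bar>\<eta>1 * a (\<gamma> \<tau>) + \<eta>3\<bar> \<le> C" for \<eta>1 \<eta>2 \<eta>3 u v l C
  proof (rule calibration_real[OF hor u, where \<phi>'="\<lambda>q h. \<eta>1 * (\<kappa> * h$3 + (a h * b q + a q * b h) / 2) + \<eta>2 * a h + \<eta>3 * b h"])
    show "lipschitz_on_balls (\<phi> \<eta>1 \<eta>2 \<eta>3)" unfolding \<phi>_def a_def b_def by (intro lipschitz_on_balls_intros)
    show "(\<phi> \<eta>1 \<eta>2 \<eta>3 has_derivative (\<lambda>h. \<eta>1 * (\<kappa> * h$3 + (a h * b q + a q * b h) / 2) + \<eta>2 * a h + \<eta>3 * b h)) (at q)" for q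
      unfolding \<phi>_def a_def b_def by (auto intro!: derivative_eq_intros has_derivative_vec_nth simp: fun_eq_iff algebra_simps add_divide_distrib)
    show "0 \<le> C / k" using C k by simp
    fix \<tau> w1 w2 :: real assume \<tau>: "\<tau> \<in> {u..v}"
    define x y p r where "x = \<gamma> \<tau> $ 1" and "y = \<gamma> \<tau> $ 2" and "p = \<alpha>1 * w1 + \<alpha>2 * w2" and "r = \<beta>1 * w1 + \<beta>2 * w2"
    have X: "(w1 *\<^sub>R heis_X1 (\<gamma> \<tau>) + w2 *\<^sub>R heis_X2 (\<gamma> \<tau>)) = vector [w1, w2, (x * w2 - y * w1) / 2]"
      by (simp add: heis_X1_def heis_X2_def vec_eq_iff forall_3 vector_3 x_def y_def field_simps)
    have "\<eta>1 * (\<kappa> * ((x * w2 - y * w1) / 2) + (p * (\<beta>1 * x + \<beta>2 * y) + (\<alpha>1 * x + \<alpha>2 * y) * r) / 2) + \<eta>2 * p + \<eta>3 * r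
        = (\<eta>1 * (\<alpha>1 * x + \<alpha>2 * y) + \<eta>3) * r + \<eta>2 * p"
      unfolding \<kappa> p_def r_def by (simp add: field_simps)
    also have "\<dots> \<le> C * \<bar>r\<bar> + C * \<bar>p\<bar>"
    proof (rule add_mono)
      have "(\<eta>1 * (\<alpha>1 * x + \<alpha>2 * y) + \<eta>3) * r \<le> \<bar>\<eta>1 * (\<alpha>1 * x + \<alpha>2 * y) + \<eta>3\<bar> * \<bar>r\<bar>"
        by (metis abs_ge_self abs_mult)
      also have "\<dots> \<le> C * \<bar>r\<bar>" using \<eta>(2)[of \<tau>] \<tau> by (intro mult_right_mono) (auto simp: a_def x_def y_def)
      finally show "(\<eta>1 * (\<alpha>1 * x + \<alpha>2 * y) + \<eta>3) * r \<le> C * \<bar>r\<bar>" .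
      have "\<eta>2 * p \<le> \<bar>\<eta>2\<bar> * \<bar>p\<bar>" by (metis abs_ge_self abs_mult)
      also have "\<dots> \<le> C * \<bar>p\<bar>" using \<eta>(1) by (intro mult_right_mono) auto
      finally show "\<eta>2 * p \<le> C * \<bar>p\<bar>" .
    qed
    also have "\<dots> = C / k * (k * (\<bar>p\<bar> + \<bar>r\<bar>))" using k by (simp add: field_simps)
    also have "\<dots> \<le> C / k * N w1 w2" using Nge[of w1 w2] C k unfolding p_def r_def by (intro mult_left_mono) auto
    finally show "\<eta>1 * (\<kappa> * (w1 *\<^sub>R heis_X1 (\<gamma> \<tau>) + w2 *\<^sub>R heis_X2 (\<gamma> \<tau>)) $ 3 +
          (a (w1 *\<^sub>R heis_X1 (\<gamma> \<tau>) + w2 *\<^sub>R heis_X2 (\<gamma> \<tau>)) * b (\<gamma> \<tau>) + a (\<gamma> \<tau>) * b (w1 *\<^sub>R heis_X1 (\<gamma> \<tau>) + w2 *\<^sub>R heis_X2 (\<gamma> \<tau>))) / 2) +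
         \<eta>2 * a (w1 *\<^sub>R heis_X1 (\<gamma> \<tau>) + w2 *\<^sub>R heis_X2 (\<gamma> \<tau>)) + \<eta>3 * b (w1 *\<^sub>R heis_X1 (\<gamma> \<tau>) + w2 *\<^sub>R heis_X2 (\<gamma> \<tau>))
         \<le> C / k * N w1 w2"
      unfolding X by (simp add: a_def b_def vector_3 x_def y_def p_def r_def)
  qed
  define M where "M = L / k"
  \<comment> \<open>The coefficient of \<open>a\<close> has the same sign on the outer arcs and the
    opposite one in the middle, while all other terms telescope. So the width counts twice and the
    endpoint enters as \<open>- \<sigma> * A\<close>.\<close>
  have total: "\<eta>1 * (\<kappa> * z + A * B / 2) + \<eta>3 * B + \<eta> * (2 * w - \<sigma> * A) \<le> C * M"
    if "0 \<le> C" "\<bar>\<eta>\<bar> \<le> C" "\<And>\<tau>. 0 \<le> \<tau> \<Longrightarrow> \<tau> \<le> T \<Longrightarrow> \<bar>\<eta>1 * a (\<gamma> \<tau>) + \<eta>3\<bar> \<le> C" for \<eta>1 \<eta> \<eta>3 C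
  proof -
    have s1: "\<bar>\<sigma> * \<eta>\<bar> \<le> C" "\<bar>- (\<sigma> * \<eta>)\<bar> \<le> C" using that \<sigma> by (auto simp: abs_mult)
    have "\<phi> \<eta>1 (- (\<sigma> * \<eta>)) \<eta>3 (\<gamma> t1) - \<phi> \<eta>1 (- (\<sigma> * \<eta>)) \<eta>3 (\<gamma> 0) \<le> (C / k) * l1"
      by (rule cal) (use t l that s1 in auto)
    moreover have "\<phi> \<eta>1 (\<sigma> * \<eta>) \<eta>3 (\<gamma> t2) - \<phi> \<eta>1 (\<sigma> * \<eta>) \<eta>3 (\<gamma> t1) \<le> (C / k) * l2"
      by (rule cal) (use t l that s1 in auto)
    moreover have "\<phi> \<eta>1 (- (\<sigma> * \<eta>)) \<eta>3 (\<gamma> T) - \<phi> \<eta>1 (- (\<sigma> * \<eta>)) \<eta>3 (\<gamma> t2) \<le> (C / k) * l3"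
      by (rule cal) (use t l that s1 in auto)
    moreover have "(C / k) * l1 + (C / k) * l2 + (C / k) * l3 \<le> C * M"
    proof -
      have "(C / k) * (l1 + l2 + l3) \<le> (C / k) * L" using l(7) that(1) k by (intro mult_left_mono) auto
      then show ?thesis unfolding M_def by (simp add: distrib_left)
    qed
    moreover have "\<eta> * w = \<sigma> * \<eta> * a (\<gamma> t2) - \<sigma> * \<eta> * a (\<gamma> t1)" unfolding \<sigma>(2)[symmetric] by (simp add: algebra_simps)
    ultimately show ?thesis unfolding \<phi>_def A_def B_def z_def a0 by (simp add: algebra_simps)
  qed
  have sA: "\<sigma> * A \<le> \<bar>A\<bar>" using \<sigma>(1) by (metis abs_ge_self abs_mult mult_1)
  \<comment> \<open>With the area term switched off, this is the least length of a path of width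
    \<open>w\<close> ending at \<open>(A, B)\<close>; it gives
    \<open>w \<le> K - \<bar>B\<bar>\<close>.\<close>
  have bnd1: "\<bar>B\<bar> + 2 * w - \<bar>A\<bar> \<le> M"
  proof -
    define \<rho> :: real where "\<rho> = (if B \<ge> 0 then 1 else -1)"
    have "\<rho> * B = \<bar>B\<bar>" "\<bar>\<rho>\<bar> \<le> 1" by (auto simp: \<rho>_def)
    then show ?thesis using total[of 1 1 0 \<rho>] sA by simp
  qed
  then show "\<bar>a (\<gamma> T)\<bar> + \<bar>b (\<gamma> T)\<bar> \<le> L / k" using w unfolding A_def B_def M_def by linarith
  \<comment> \<open>The multiple \<open>- s * c\<close> of \<open>b\<close> recentres
    \<open>a\<close> at the middle of its range, which makes \<open>w / 2\<close> a sufficient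
    constant.\<close>
  have "s * (\<kappa> * z + A * B / 2) + (- s * c) * B + (w / 2) * (2 * w - \<sigma> * A) \<le> (w / 2) * M"
  proof (rule total)
    show "\<bar>s * a (\<gamma> \<tau>) + - s * c\<bar> \<le> w / 2" if "0 \<le> \<tau>" "\<tau> \<le> T" for \<tau>
    proof -
      have "s * a (\<gamma> \<tau>) + - s * c = s * (a (\<gamma> \<tau>) - c)" by (simp add: algebra_simps)
      then show ?thesis using rng[OF that] s by (simp add: abs_mult)
    qed
  qed (use w in auto)
  moreover have "s * ((2 * c - A) * B) \<le> (w - \<bar>A\<bar>) * \<bar>B\<bar>"
  proof -
    have "s * ((2 * c - A) * B) \<le> \<bar>2 * c - A\<bar> * \<bar>B\<bar>" using s by (metis abs_ge_self abs_mult mult_1)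
    also have "\<dots> \<le> (w - \<bar>A\<bar>) * \<bar>B\<bar>" using w by (intro mult_right_mono) auto
    finally show ?thesis .
  qed
  moreover have "(w / 2) * (\<sigma> * A) \<le> (w / 2) * \<bar>A\<bar>" using sA w by (intro mult_left_mono) auto
  ultimately have "s * \<kappa> * z \<le> w * ((M + \<bar>A\<bar> + \<bar>B\<bar>) / 2 - w) - \<bar>A\<bar> * \<bar>B\<bar> / 2"
    by (simp add: field_simps)
  also have "\<dots> \<le> heis_bound M \<bar>A\<bar> \<bar>B\<bar>"
  proof -
    have "w \<le> (M + \<bar>A\<bar> + \<bar>B\<bar>) / 2 - \<bar>B\<bar>" using bnd1 by (simp add: field_simps)
    from clamp_maximizes_product[OF w(1) this]
    show ?thesis unfolding heis_bound_def Let_def by (rule diff_right_mono)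
  qed
  finally show "s * \<kappa> * \<gamma> T $ 3 \<le> heis_bound (L / k) \<bar>a (\<gamma> T)\<bar> \<bar>b (\<gamma> T)\<bar>"
    unfolding A_def B_def M_def z_def .
qed

text \<open>Sides \<open>h - v\<close>, \<open>w\<close>, \<open>h\<close>, \<open>w - u\<close> in
  turn sweep out the area \<open>w * h\<close>. Every area up to the maximum arises by deforming the
  optimal rectangle, and the opposite order of the sides gives the opposite sign.\<close>

lemma steers_heis_reach_one:
  assumes L: "0 < L" and p: "\<bar>q$1\<bar> + \<bar>q$2\<bar> \<le> L" and z: "\<bar>q$3\<bar> \<le> heis_bound L \<bar>q$1\<bar> \<bar>q$2\<bar>"
  shows "steers norm_one_coeff heis_X1 heis_X2 L 0 q"
proof -
  define x y where "x = q$1" and "y = q$2"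
  define u v where "u = \<bar>x\<bar>" and "v = \<bar>y\<bar>"
  define \<epsilon> \<eta> :: real where "\<epsilon> = (if x \<ge> 0 then 1 else -1)" and "\<eta> = (if y \<ge> 0 then 1 else -1)"
  have \<epsilon>: "\<bar>\<epsilon>\<bar> = 1" "\<epsilon> * \<epsilon> = 1" "x = \<epsilon> * u" and \<eta>: "\<bar>\<eta>\<bar> = 1" "\<eta> * \<eta> = 1" "y = \<eta> * v"
    by (auto simp: \<epsilon>_def \<eta>_def u_def v_def)
  define K where "K = (L + u + v) / 2"
  define w0 where "w0 = max u (min (K / 2) (K - v))"
  have uv: "0 \<le> u" "0 \<le> v" "u + v \<le> L" using p unfolding u_def v_def x_def y_def by auto
  then have "u \<le> K - v" unfolding K_def by (simp add: field_simps)
  then have w0: "u \<le> w0" "w0 \<le> K - v" unfolding w0_def by auto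
  have B: "heis_bound L \<bar>q$1\<bar> \<bar>q$2\<bar> = w0 * (K - w0) - u * v / 2"
    unfolding heis_bound_def Let_def w0_def K_def u_def v_def x_def y_def ..
  \<comment> \<open>\<open>\<theta> = 1\<close> is the optimal rectangle,
    \<open>\<theta> = 0\<close> the degenerate one of width 0 and height \<open>v\<close>.\<close>
  define f where "f \<theta> = (\<theta> * w0) * ((1 - \<theta>) * v + \<theta> * (K - w0))" for \<theta>
  \<comment> \<open>\<open>z\<close> measures area relative to the chord; the triangle
    \<open>u * v / 2\<close> is added back to get that of the rectangle.\<close>
  define t where "t = \<bar>q$3\<bar> + u * v / 2"
  have "0 \<le> u * v" using uv by simp
  then have t: "f 0 \<le> t" "t \<le> f 1" using z B unfolding f_def t_def by auto
  have "continuous_on {0..1} f" unfolding f_def by (intro continuous_intros)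
  then obtain \<theta> where \<theta>: "0 \<le> \<theta>" "\<theta> \<le> 1" "f \<theta> = t" using IVT'[of f 0 t 1] t by auto
  define w h where "w = \<theta> * w0" and "h = (1 - \<theta>) * v + \<theta> * (K - w0)"
  have wh: "w * h = t" "0 \<le> w" using \<theta> w0 uv unfolding f_def w_def h_def by auto
  have h1: "h - v = \<theta> * (K - w0 - v)" unfolding h_def by (simp add: algebra_simps)
  moreover have "0 \<le> \<theta> * (K - w0 - v)" using \<theta> w0 by (intro mult_nonneg_nonneg) auto
  ultimately have hv: "v \<le> h" by linarith
  have "w - u = \<theta> * (w0 - u) - (1 - \<theta>) * u" unfolding w_def by (simp add: algebra_simps)
  moreover have "0 \<le> \<theta> * (w0 - u)" "0 \<le> (1 - \<theta>) * u" using \<theta> w0 uv by auto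
  ultimately have wu: "\<bar>w - u\<bar> \<le> \<theta> * (w0 - u) + (1 - \<theta>) * u" by linarith
  \<comment> \<open>The estimate for the length is affine in \<open>\<theta>\<close>, with value
    \<open>u + v\<close> at 0 and \<open>L\<close> at 1.\<close>
  have "(1 - \<theta>) * (u + v) \<le> (1 - \<theta>) * L" using uv(3) \<theta> by (intro mult_left_mono) auto
  moreover have "(h - v) + w + h + (\<theta> * (w0 - u) + (1 - \<theta>) * u) = \<theta> * (2 * K - u - v) + (1 - \<theta>) * (u + v)"
    unfolding h1 unfolding h_def w_def by (simp add: algebra_simps)
  moreover have "2 * K - u - v = L" unfolding K_def by (simp add: field_simps)
  then have "\<theta> * (2 * K - u - v) = \<theta> * L" by (simp only:)
  ultimately have len: "(h - v) + w + h + \<bar>w - u\<bar> \<le> L" using wu by (simp add: algebra_simps)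
  have one: "norm_one_coeff = norm_inf_coeff \<or> norm_one_coeff = norm_one_coeff" by simp
  note st = steers_heis[OF one]
  have v0: "vector [0, 0, 0] = (0 :: real^3)" by (simp add: vec_eq_iff forall_3 vector_3)
  have q: "q = vector [x, y, q$3]" by (simp add: vec_eq_iff forall_3 vector_3 x_def y_def)
  have abs: "\<bar>\<epsilon> * s\<bar> = \<bar>s\<bar>" "\<bar>\<eta> * s\<bar> = \<bar>s\<bar>" for s using \<epsilon>(1) \<eta>(1) by (simp_all add: abs_mult)
  have "steers norm_one_coeff heis_X1 heis_X2 ((h - v) + w + h + \<bar>w - u\<bar>) 0 q"
  proof (cases "\<epsilon> * \<eta> * q$3 \<ge> 0")
    case True
    have z3: "q$3 = \<epsilon> * \<eta> * (w * h - u * v / 2)"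
    proof -
      have "\<bar>q$3\<bar> = \<epsilon> * \<eta> * q$3" using True \<epsilon>(1) \<eta>(1) by (metis abs_mult abs_of_nonneg mult_1)
      then have "\<epsilon> * \<eta> * (w * h - u * v / 2) = (\<epsilon> * \<epsilon>) * (\<eta> * \<eta>) * q$3" unfolding wh t_def by simp
      then show ?thesis using \<epsilon> \<eta> by simp
    qed
    have "steers norm_one_coeff heis_X1 heis_X2 (h - v) 0 (vector [0, - (\<eta> * (h - v)), 0])"
      using st[of 0 "- (\<eta> * (h - v))" 0 0 0] hv by (simp add: coeff_norm_simps abs v0)
    moreover have "steers norm_one_coeff heis_X1 heis_X2 w (vector [0, - (\<eta> * (h - v)), 0]) (vector [\<epsilon> * w, - (\<eta> * (h - v)), \<eta> * (h - v) * (\<epsilon> * w) / 2])"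
      using st[of "\<epsilon> * w" 0 0 "- (\<eta> * (h - v))" 0] wh by (simp add: coeff_norm_simps abs)
    moreover have "steers norm_one_coeff heis_X1 heis_X2 h (vector [\<epsilon> * w, - (\<eta> * (h - v)), \<eta> * (h - v) * (\<epsilon> * w) / 2])
         (vector [\<epsilon> * w, y, \<eta> * (h - v) * (\<epsilon> * w) / 2 + \<epsilon> * w * (\<eta> * h) / 2])"
      using st[of 0 "\<eta> * h" "\<epsilon> * w" "- (\<eta> * (h - v))" "\<eta> * (h - v) * (\<epsilon> * w) / 2"] hv uv \<eta>(3)
      by (simp add: coeff_norm_simps abs right_diff_distrib)
    moreover have "steers norm_one_coeff heis_X1 heis_X2 \<bar>w - u\<bar> (vector [\<epsilon> * w, y, \<eta> * (h - v) * (\<epsilon> * w) / 2 + \<epsilon> * w * (\<eta> * h) / 2]) q"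
    proof -
      have "q = vector [\<epsilon> * w + - (\<epsilon> * (w - u)), y + 0, \<eta> * (h - v) * (\<epsilon> * w) / 2 + \<epsilon> * w * (\<eta> * h) / 2 + (\<epsilon> * w * 0 - y * - (\<epsilon> * (w - u))) / 2]"
        by (subst q, subst z3) (simp add: \<epsilon>(3) \<eta>(3) vec_eq_iff forall_3 vector_3 field_simps)
      then show ?thesis using st[of "- (\<epsilon> * (w - u))" 0 "\<epsilon> * w" y] by (simp add: coeff_norm_simps abs)
    qed
    ultimately show ?thesis by (blast intro: steers_trans)
  next
    \<comment> \<open>The same four sides in the opposite order.\<close>
    case False
    have z3: "q$3 = \<epsilon> * \<eta> * (u * v / 2 - w * h)"
    proof -
      have "\<bar>q$3\<bar> = - (\<epsilon> * \<eta> * q$3)" using False \<epsilon>(1) \<eta>(1) by (metis abs_mult abs_of_neg mult_1 not_le)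
      then have "\<epsilon> * \<eta> * (u * v / 2 - w * h) = (\<epsilon> * \<epsilon>) * (\<eta> * \<eta>) * q$3" unfolding wh t_def by simp
      then show ?thesis using \<epsilon> \<eta> by simp
    qed
    have "steers norm_one_coeff heis_X1 heis_X2 \<bar>w - u\<bar> 0 (vector [- (\<epsilon> * (w - u)), 0, 0])"
      using st[of "- (\<epsilon> * (w - u))" 0 0 0 0] by (simp add: coeff_norm_simps abs v0)
    moreover have "steers norm_one_coeff heis_X1 heis_X2 h (vector [- (\<epsilon> * (w - u)), 0, 0]) (vector [- (\<epsilon> * (w - u)), \<eta> * h, - (\<epsilon> * (w - u)) * (\<eta> * h) / 2])"
      using st[of 0 "\<eta> * h" "- (\<epsilon> * (w - u))" 0 0] hv uv by (simp add: coeff_norm_simps abs)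
    moreover have "steers norm_one_coeff heis_X1 heis_X2 w (vector [- (\<epsilon> * (w - u)), \<eta> * h, - (\<epsilon> * (w - u)) * (\<eta> * h) / 2])
         (vector [x, \<eta> * h, - (\<epsilon> * (w - u)) * (\<eta> * h) / 2 - \<eta> * h * (\<epsilon> * w) / 2])"
      using st[of "\<epsilon> * w" 0 "- (\<epsilon> * (w - u))" "\<eta> * h" "- (\<epsilon> * (w - u)) * (\<eta> * h) / 2"] wh \<epsilon>(3)
      by (simp add: coeff_norm_simps abs right_diff_distrib)
    moreover have "steers norm_one_coeff heis_X1 heis_X2 (h - v) (vector [x, \<eta> * h, - (\<epsilon> * (w - u)) * (\<eta> * h) / 2 - \<eta> * h * (\<epsilon> * w) / 2]) q"
    proof -
      have "q = vector [x + 0, \<eta> * h + - (\<eta> * (h - v)), - (\<epsilon> * (w - u)) * (\<eta> * h) / 2 - \<eta> * h * (\<epsilon> * w) / 2 + (x * - (\<eta> * (h - v)) - \<eta> * h * 0) / 2]"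
        by (subst q, subst z3) (simp add: \<epsilon>(3) \<eta>(3) vec_eq_iff forall_3 vector_3 field_simps)
      then show ?thesis using st[of 0 "- (\<eta> * (h - v))" x "\<eta> * h"] hv by (simp add: coeff_norm_simps abs)
    qed
    ultimately have "steers norm_one_coeff heis_X1 heis_X2 (\<bar>w - u\<bar> + h + w + (h - v)) 0 q" by (blast intro: steers_trans)
    then show ?thesis by (simp add: algebra_simps)
  qed
  then show ?thesis using steers_mono[OF _ len] by (metis coeff_norm_simps(4) zero_le_one)
qed

text \<open>A rotation by 45 degrees, combined with a dilation, exchanges the two coefficient norms.\<close>

lemma steers_heis_reach_inf:
  assumes L: "0 < L" and p: "\<bar>q$1 + q$2\<bar> + \<bar>q$2 - q$1\<bar> \<le> 2 * L"
    and z: "2 * \<bar>q$3\<bar> \<le> heis_bound (2 * L) \<bar>q$1 + q$2\<bar> \<bar>q$2 - q$1\<bar>"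
  shows "steers norm_inf_coeff heis_X1 heis_X2 L 0 q"
proof -
  \<comment> \<open>The planar part has determinant \<open>1 / 2\<close>, hence the factor on
    \<open>z\<close>; the norms match because \<open>max \<bar>w1 - w2\<bar> \<bar>w1 + w2\<bar> =
    \<bar>w1\<bar> + \<bar>w2\<bar>\<close>.\<close>
  define A :: "real^3 \<Rightarrow> real^3" where "A p = vector [(p$1 - p$2) / 2, (p$1 + p$2) / 2, p$3 / 2]" for p
  have A: "linear A" by (intro linearI) (simp_all add: A_def vec_eq_iff forall_3 vector_3 field_simps)
  define p where "p = (vector [q$1 + q$2, q$2 - q$1, 2 * q$3] :: real^3)"
  have st: "steers norm_one_coeff heis_X1 heis_X2 (2 * L) 0 p"
    by (rule steers_heis_reach_one) (use L p z in \<open>auto simp: p_def vector_3 abs_mult\<close>)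
  have "steers norm_inf_coeff heis_X1 heis_X2 (1/2 * (2 * L)) (A 0) (A p)"
  proof (rule steers_linear_image[OF st A])
    fix q w1 w2 assume "norm_one_coeff w1 w2 \<le> 1"
    then have "norm_inf_coeff (w1 - w2) (w1 + w2) \<le> 1" by (auto simp: norm_inf_coeff_def norm_one_coeff_def)
    moreover have "A (w1 *\<^sub>R heis_X1 q + w2 *\<^sub>R heis_X2 q) = (1/2) *\<^sub>R ((w1 - w2) *\<^sub>R heis_X1 (A q) + (w1 + w2) *\<^sub>R heis_X2 (A q))"
      by (simp add: A_def heis_X1_def heis_X2_def vec_eq_iff forall_3 vector_3 field_simps)
    ultimately show "\<exists>v1 v2. norm_inf_coeff v1 v2 \<le> 1 \<and> A (w1 *\<^sub>R heis_X1 q + w2 *\<^sub>R heis_X2 q) = (1/2) *\<^sub>R (v1 *\<^sub>R heis_X1 (A q) + v2 *\<^sub>R heis_X2 (A q))"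
      by blast
  qed simp
  moreover have "A p = q" "A 0 = 0" by (simp_all add: A_def p_def vec_eq_iff forall_3 vector_3)
  ultimately show ?thesis by simp
qed

definition heis_bound_one :: "real \<Rightarrow> real^3 \<Rightarrow> real" where
  "heis_bound_one L q = heis_bound L \<bar>q$1\<bar> \<bar>q$2\<bar>"

text \<open>In \<open>heis_barrier\<close> with \<open>a = x + y\<close> and
  \<open>b = y - x\<close> one has \<open>\<kappa> = 2\<close> and \<open>k = 1 / 2\<close>, hence
  the division by 2 and the length \<open>2 * L\<close>.\<close>

definition heis_bound_inf :: "real \<Rightarrow> real^3 \<Rightarrow> real" where
  "heis_bound_inf L q = heis_bound (2 * L) \<bar>q$1 + q$2\<bar> \<bar>q$2 - q$1\<bar> / 2"

definition plane_norm :: "(real \<Rightarrow> real \<Rightarrow> real) \<Rightarrow> real^3 \<Rightarrow> real" where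
  "plane_norm N q = N (q$1) (q$2)"

lemma norm_inf_coeff_rotate: "norm_inf_coeff x y = (\<bar>x + y\<bar> + \<bar>y - x\<bar>) / 2"
  by (auto simp: norm_inf_coeff_def max_def abs_if)

lemma plane_norm_regular:
  assumes "N = norm_inf_coeff \<or> N = norm_one_coeff"
  shows "continuous_on UNIV (plane_norm N)" "piecewise_poly (plane_norm N)" "j \<noteq> 3 \<Longrightarrow> \<bar>q $ j\<bar> \<le> plane_norm N q"
    "plane_norm N (q + axis 3 h) = plane_norm N q"
proof -
  have "continuous_on UNIV (plane_norm norm_inf_coeff)" "continuous_on UNIV (plane_norm norm_one_coeff)"
    unfolding plane_norm_def norm_inf_coeff_def norm_one_coeff_def by (intro continuous_intros)+
  then show "continuous_on UNIV (plane_norm N)" using assms by auto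
  have "piecewise_poly (plane_norm norm_inf_coeff)" "piecewise_poly (plane_norm norm_one_coeff)"
    unfolding plane_norm_def norm_inf_coeff_def norm_one_coeff_def by (intro piecewise_poly_intros)+
  then show "piecewise_poly (plane_norm N)" using assms by auto
  show "\<bar>q $ j\<bar> \<le> plane_norm N q" if "j \<noteq> 3"
  proof -
    have "j = 1 \<or> j = 2" using that exhaust_3 by blast
    then show ?thesis using assms by (auto simp: plane_norm_def norm_inf_coeff_def norm_one_coeff_def)
  qed
  show "plane_norm N (q + axis 3 h) = plane_norm N q" by (simp add: plane_norm_def axis_def)
qed

text \<open>The level set is a cylinder over a square, with four flat faces, or over a diamond,
  which is two graphs over \<open>y\<close>.\<close>

lemma plane_norm_level_graph:
  assumes N: "N = norm_inf_coeff \<or> N = norm_one_coeff"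
  shows "\<exists>l. (\<forall>j f. (j,f)\<in>set l \<longrightarrow> piecewise_poly f \<and> (\<forall>q t. f (\<chi> k. if k = j then t else q$k) = f q)) \<and>
     (\<forall>q :: real^3. plane_norm N q = r \<longrightarrow> (\<exists>(j,f)\<in>set l. q$j = f q))"
proof -
  have p: "piecewise_poly (\<lambda>q :: real^3. r)" "piecewise_poly (\<lambda>q :: real^3. - r)"
    "piecewise_poly (\<lambda>q :: real^3. r - \<bar>q$2\<bar>)" "piecewise_poly (\<lambda>q :: real^3. \<bar>q$2\<bar> - r)"
    by (intro piecewise_poly_intros)+
  show ?thesis
  proof (cases "N = norm_inf_coeff")
    case True
    then show ?thesis using p(1,2)
      by (intro exI[of _ "[(1, \<lambda>_. r), (1, \<lambda>_. - r), (2, \<lambda>_. r), (2, \<lambda>_. - r)]"])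
         (auto simp: plane_norm_def norm_inf_coeff_def max_def split: if_splits)
  next
    case False
    then have "N = norm_one_coeff" using N by blast
    then show ?thesis using p(3,4)
      by (intro exI[of _ "[(1, \<lambda>q. r - \<bar>q$2\<bar>), (1, \<lambda>q. \<bar>q$2\<bar> - r)]"])
         (auto simp: plane_norm_def norm_one_coeff_def)
  qed
qed

lemma heis_barriers:
  assumes NU: "N = norm_one_coeff \<and> U = heis_bound_one \<or> N = norm_inf_coeff \<and> U = heis_bound_inf"
  shows "sublevel_barriers N heis_X1 heis_X2 3 (weights_3 2) (plane_norm N) U U"
proof
  have N: "N = norm_inf_coeff \<or> N = norm_one_coeff" using NU by blast
  show "0 \<le> N w1 w2" for w1 w2 using N coeff_norm_simps by blast
  show "N 0 0 = 0" using N coeff_norm_simps by blast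
  show "1 \<le> weights_3 2 j" for j by (simp add: weights_3_def)
  show "steers N heis_X1 heis_X2 (k * L) (dilation (weights_3 2) k p) (dilation (weights_3 2) k q)"
    if "0 < k" "steers N heis_X1 heis_X2 L p q" for k L p q
    using that by (rule steers_heis_dilation)
  show "plane_norm N (\<gamma> T) \<le> L \<and> - U L (\<gamma> T) \<le> \<gamma> T $ 3 \<and> \<gamma> T $ 3 \<le> U L (\<gamma> T)"
    if *: "0 < L" "0 \<le> T" "horizontal heis_X1 heis_X2 T \<gamma>" "\<gamma> 0 = 0" "sf_length N heis_X1 heis_X2 T \<gamma> \<le> ennreal L"
    for L T \<gamma>
    using NU
  proof
    assume NU: "N = norm_one_coeff \<and> U = heis_bound_one"
    have Nge: "1 * (\<bar>1 * w1 + 0 * w2\<bar> + \<bar>0 * w1 + 1 * w2\<bar>) \<le> N w1 w2" for w1 w2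
      using NU by (simp add: norm_one_coeff_def)
    have "1 = 1 * 1 - 0 * (0::real)" by simp
    note b = heis_barrier[OF this zero_less_one Nge *(3,2,4,5)]
    show ?thesis using b(1)[of 1] b(2)[of 1] b(2)[of "-1"] *(1) NU
      by (simp add: plane_norm_def norm_one_coeff_def heis_bound_one_def)
  next
    assume NU: "N = norm_inf_coeff \<and> U = heis_bound_inf"
    have Nge: "1 / 2 * (\<bar>1 * w1 + 1 * w2\<bar> + \<bar>- 1 * w1 + 1 * w2\<bar>) \<le> N w1 w2" for w1 w2
      using NU by (simp add: norm_inf_coeff_rotate)
    have "2 = 1 * 1 - 1 * (- 1::real)" "0 < 1 / (2::real)" by simp_all
    note b = heis_barrier[OF this Nge *(3,2,4,5)]
    show ?thesis using b(1)[of 1] b(2)[of 1] b(2)[of "-1"] *(1) NU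
      by (simp add: plane_norm_def norm_inf_coeff_rotate heis_bound_inf_def mult.commute)
  qed
  show "steers N heis_X1 heis_X2 L 0 q"
    if "0 < L" "plane_norm N q \<le> L" "- U L q \<le> q $ 3" "q $ 3 \<le> U L q" for L q
  proof -
    have "\<bar>q $ 3\<bar> \<le> U L q" using that by linarith
    then show ?thesis using that NU steers_heis_reach_one[of L q] steers_heis_reach_inf[of L q]
      by (auto simp: plane_norm_def norm_one_coeff_def norm_inf_coeff_rotate heis_bound_one_def heis_bound_inf_def)
  qed
  show "\<exists>h>0. \<exists>h'>0. steers N heis_X1 heis_X2 L q (q + axis 3 h) \<and> steers N heis_X1 heis_X2 L q (q - axis 3 h')"
    if "0 < L" for L q using N that by (rule steers_heis_loop)
  show "U L (q + axis 3 h) = U L q" for L q h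
    using NU by (auto simp: heis_bound_one_def heis_bound_inf_def axis_def)
  have "continuous_on UNIV (\<lambda>z. heis_bound_one (fst z) (snd z))" "continuous_on UNIV (\<lambda>z. heis_bound_inf (fst z) (snd z))"
    unfolding heis_bound_one_def heis_bound_inf_def heis_bound_def Let_def by (intro continuous_intros; simp)+
  then show "continuous_on UNIV (\<lambda>z. U (fst z) (snd z))" using NU by auto
  have "piecewise_poly (heis_bound_one L)" "piecewise_poly (heis_bound_inf L)" for L
    unfolding heis_bound_one_def heis_bound_inf_def heis_bound_def Let_def by (intro piecewise_poly_intros)+
  then show "piecewise_poly (U L)" for L using NU by auto
qed (use NU plane_norm_regular in auto)

section \<open>Martinet distribution\<close>

lemma steers_martinet:
  assumes N: "N = norm_inf_coeff \<or> N = norm_one_coeff"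
  shows "steers N martinet_X1 martinet_X2 (N w1 w2) (vector [x, y, z])
    (vector [x + w1, y + w2, z + w1 * (y^2 + y * w2 + w2^2 / 3)])"
proof -
  define \<gamma> :: "real \<Rightarrow> real^3" where
    "\<gamma> t = vector [x, y, z] + t *\<^sub>R vector [w1, w2, w1 * y^2] + t^2 *\<^sub>R vector [0, 0, w1 * y * w2] + t^3 *\<^sub>R vector [0, 0, w1 * w2^2 / 3]" for t
  have eq: "w1 *\<^sub>R martinet_X1 (\<gamma> t) + w2 *\<^sub>R martinet_X2 (\<gamma> t) =
      vector [w1, w2, w1 * y^2] + (2 * t) *\<^sub>R vector [0, 0, w1 * y * w2] + (3 * t^2) *\<^sub>R vector [0, 0, w1 * w2^2 / 3]" for t
    by (simp add: \<gamma>_def martinet_X1_def martinet_X2_def vec_eq_iff forall_3 vector_3 power2_eq_square algebra_simps)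
  have "steers N martinet_X1 martinet_X2 (N w1 w2) (\<gamma> 0) (\<gamma> 1)"
  proof (rule steers_flow_coeff_norm[OF N])
    show "(\<gamma> has_vector_derivative (w1 *\<^sub>R martinet_X1 (\<gamma> t) + w2 *\<^sub>R martinet_X2 (\<gamma> t))) (at t)" for t
      unfolding eq unfolding \<gamma>_def by (auto intro!: derivative_eq_intros)
    show "continuous_on {0..1} (\<lambda>t. w1 *\<^sub>R martinet_X1 (\<gamma> t) + w2 *\<^sub>R martinet_X2 (\<gamma> t))"
      unfolding eq by (intro continuous_intros)
    show "\<gamma> 1 = \<gamma> 0" if "w1 = 0" "w2 = 0"
      using that by (simp add: \<gamma>_def vec_eq_iff forall_3 vector_3)
  qed
  moreover have "\<gamma> 0 = vector [x, y, z]" "\<gamma> 1 = vector [x + w1, y + w2, z + w1 * (y^2 + y * w2 + w2^2 / 3)]"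
    by (simp_all add: \<gamma>_def vec_eq_iff forall_3 vector_3 algebra_simps)
  ultimately show ?thesis by simp
qed

lemma steers_martinet_dilation:
  assumes "0 < k" "steers N martinet_X1 martinet_X2 L p q"
  shows "steers N martinet_X1 martinet_X2 (k * L) (dilation (weights_3 3) k p) (dilation (weights_3 3) k q)"
proof (rule steers_linear_image[OF assms(2) linear_dilation assms(1)])
  fix q w1 w2 assume "N w1 w2 \<le> 1"
  moreover have "dilation (weights_3 3) k (w1 *\<^sub>R martinet_X1 q + w2 *\<^sub>R martinet_X2 q) =
     k *\<^sub>R (w1 *\<^sub>R martinet_X1 (dilation (weights_3 3) k q) + w2 *\<^sub>R martinet_X2 (dilation (weights_3 3) k q))"
    by (simp add: dilation_def weights_3_def martinet_X1_def martinet_X2_def vec_eq_iff forall_3 vector_3 power2_eq_square power3_eq_cube algebra_simps)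
  ultimately show "\<exists>v1 v2. N v1 v2 \<le> 1 \<and> dilation (weights_3 3) k (w1 *\<^sub>R martinet_X1 q + w2 *\<^sub>R martinet_X2 q) =
     k *\<^sub>R (v1 *\<^sub>R martinet_X1 (dilation (weights_3 3) k q) + v2 *\<^sub>R martinet_X2 (dilation (weights_3 3) k q))" by blast
qed

text \<open>The gain of \<open>z\<close> does not involve \<open>x\<close>, so the initial
  \<open>y\<close> and the controls determine it; one leg contributes the integral of
  \<open>a * (y + t * b)^2\<close> over \<open>0 \<le> t \<le> 1\<close>.\<close>

fun martinet_height :: "real \<Rightarrow> (real \<times> real) list \<Rightarrow> real" where
  "martinet_height y [] = 0"
| "martinet_height y ((a, b) # l) = a * (y^2 + y * b + b^2 / 3) + martinet_height (y + b) l"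

lemma steers_martinet_list:
  assumes N: "N = norm_inf_coeff \<or> N = norm_one_coeff"
  shows "steers N martinet_X1 martinet_X2 (\<Sum>(a,b)\<leftarrow>l. N a b) (vector [x, y, z])
    (vector [x + (\<Sum>(a,b)\<leftarrow>l. a), y + (\<Sum>(a,b)\<leftarrow>l. b), z + martinet_height y l])"
proof (induction l arbitrary: x y z)
  case Nil
  then show ?case by (simp add: steers_refl)
next
  case (Cons u l)
  obtain a b where u: "u = (a, b)" by fastforce
  show ?case unfolding u
    using steers_trans[OF steers_martinet[OF N, of a b x y z] Cons.IH] by (simp add: add.assoc)
qed

text \<open>Reversing \<open>x\<close> reverses \<open>z\<close>, reversing \<open>y\<close>
  preserves it. Explicit paths can thus be confined to the upper bound and
  \<open>y \<ge> 0\<close>.\<close>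

lemma martinet_height_reflect:
  "martinet_height y (map (\<lambda>(a,b). (\<sigma> * a, b)) l) = \<sigma> * martinet_height y l"
  "\<eta> * \<eta> = 1 \<Longrightarrow> martinet_height (\<eta> * y) (map (\<lambda>(a,b). (a, \<eta> * b)) l) = martinet_height y l"
proof -
  show "martinet_height y (map (\<lambda>(a,b). (\<sigma> * a, b)) l) = \<sigma> * martinet_height y l"
    by (induction l arbitrary: y) (auto simp: algebra_simps)
  assume \<eta>: "\<eta> * \<eta> = 1"
  have 1: "(\<eta> * y)^2 + \<eta> * y * (\<eta> * b) + (\<eta> * b)^2 / 3 = y^2 + y * b + b^2 / 3" for y b
  proof -
    have "(\<eta> * y)^2 + \<eta> * y * (\<eta> * b) + (\<eta> * b)^2 / 3 = (\<eta> * \<eta>) * (y^2 + y * b + b^2 / 3)"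
      by (simp add: power2_eq_square algebra_simps)
    then show ?thesis unfolding \<eta> by simp
  qed
  show "martinet_height (\<eta> * y) (map (\<lambda>(a,b). (a, \<eta> * b)) l) = martinet_height y l"
    by (induction l arbitrary: y) (auto simp: 1 simp flip: distrib_left)
qed

lemma continuous_on_martinet_height:
  assumes "continuous_on S f"
  shows "continuous_on S (\<lambda>\<theta>. martinet_height (f \<theta>) (map (\<lambda>(a,b). (\<theta> * a, \<theta> * b)) l))"
  using assms
proof (induction l arbitrary: f)
  case (Cons u l)
  obtain a b where u: "u = (a, b)" by fastforce
  have "continuous_on S (\<lambda>\<theta>. martinet_height (f \<theta> + \<theta> * b) (map (\<lambda>(a,b). (\<theta> * a, \<theta> * b)) l))"
    using Cons.prems by (intro Cons.IH continuous_intros)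
  moreover have "continuous_on S (\<lambda>\<theta>. \<theta> * a * ((f \<theta>)^2 + f \<theta> * (\<theta> * b) + (\<theta> * b)^2 / 3))"
    using Cons.prems by (intro continuous_intros) auto
  ultimately show ?case unfolding u by (simp add: continuous_on_add)
qed simp

text \<open>Controls with a prescribed total displacement in the \<open>(x, y)\<close>-plane form a convex set, so heights between
  that of the segment and that of a given path are attained by interpolation.\<close>

lemma steers_martinet_interpolate:
  assumes N: "N = norm_inf_coeff \<or> N = norm_one_coeff" and p: "N x y \<le> L"
    and l: "(\<Sum>(a,b)\<leftarrow>l. a) = x" "(\<Sum>(a,b)\<leftarrow>l. b) = y" "(\<Sum>(a,b)\<leftarrow>l. N a b) \<le> L"
    and z: "x * y^2 / 3 \<le> z \<and> z \<le> martinet_height 0 l \<or> martinet_height 0 l \<le> z \<and> z \<le> x * y^2 / 3"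
  shows "steers N martinet_X1 martinet_X2 L 0 (vector [x, y, z])"
proof -
  \<comment> \<open>The segment scaled by \<open>1 - \<theta>\<close> comes first, then the path
    scaled by \<open>\<theta>\<close>: the displacement is kept and the cost is the weighted
    mean.\<close>
  define m where "m \<theta> = ((1 - \<theta>) * x, (1 - \<theta>) * y) # map (\<lambda>(a,b). (\<theta> * a, \<theta> * b)) l" for \<theta>
  define f where "f \<theta> = martinet_height 0 (m \<theta>)" for \<theta>
  have f_eq: "f \<theta> = (1 - \<theta>) * x * (((1 - \<theta>) * y)^2 / 3) + martinet_height ((1 - \<theta>) * y) (map (\<lambda>(a,b). (\<theta> * a, \<theta> * b)) l)" for \<theta>
    unfolding f_def m_def by simp
  have cont: "continuous_on {0..1} f"
    unfolding f_eq by (intro continuous_intros continuous_on_martinet_height) auto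
  have z0: "martinet_height y (map (\<lambda>(a,b). (0, 0)) l) = 0" for y and l :: "(real \<times> real) list"
    by (induction l arbitrary: y) auto
  have id: "map (\<lambda>(a,b). (a, b)) l = l" for l :: "(real \<times> real) list" by (induction l) auto
  have ends: "f 0 = x * y^2 / 3" "f 1 = martinet_height 0 l" unfolding f_eq by (simp_all add: z0 id)
  obtain \<theta> where \<theta>: "0 \<le> \<theta>" "\<theta> \<le> 1" "f \<theta> = z"
    using z IVT'[of f 0 z 1] IVT2'[of f 1 z 0] cont unfolding ends by auto
  have hom: "N (k * a) (k * b) = k * N a b" if "0 \<le> k" for k a b
    using N that by (auto simp: norm_inf_coeff_def norm_one_coeff_def abs_mult max_mult_distrib_left distrib_left)
  have sc: "(\<Sum>(a,b)\<leftarrow>map (\<lambda>(a,b). (\<theta> * a, \<theta> * b)) l. N a b) = \<theta> * (\<Sum>(a,b)\<leftarrow>l. N a b)"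
     "(\<Sum>(a,b)\<leftarrow>map (\<lambda>(a,b). (\<theta> * a, \<theta> * b)) l. a) = \<theta> * (\<Sum>(a,b)\<leftarrow>l. a)"
     "(\<Sum>(a,b)\<leftarrow>map (\<lambda>(a,b). (\<theta> * a, \<theta> * b)) l. b) = \<theta> * (\<Sum>(a,b)\<leftarrow>l. b)"
    by (induction l) (auto simp: hom \<theta> distrib_left)
  have "(\<Sum>(a,b)\<leftarrow>m \<theta>. a) = x" "(\<Sum>(a,b)\<leftarrow>m \<theta>. b) = y"
    unfolding m_def by (simp_all add: sc l left_diff_distrib del: map_map)
  moreover have "(\<Sum>(a,b)\<leftarrow>m \<theta>. N a b) \<le> L"
  proof -
    have "(\<Sum>(a,b)\<leftarrow>m \<theta>. N a b) = (1 - \<theta>) * N x y + \<theta> * (\<Sum>(a,b)\<leftarrow>l. N a b)"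
      unfolding m_def by (simp add: sc hom \<theta> del: map_map)
    also have "\<dots> \<le> (1 - \<theta>) * L + \<theta> * L" using \<theta> p l(3) by (intro add_mono mult_left_mono) auto
    finally show ?thesis by (simp add: algebra_simps)
  qed
  moreover have "vector [0, 0, 0] = (0 :: real^3)" by (simp add: vec_eq_iff forall_3 vector_3)
  ultimately show ?thesis
    using steers_mono[OF steers_martinet_list[OF N, of "m \<theta>" 0 0 0], of L] \<theta>(3) N
    unfolding f_def by (auto simp: coeff_norm_simps)
qed

text \<open>A square of side \<open>L / 4\<close> whose far side lies at larger
  \<open>\<bar>y\<bar>\<close>, where \<open>X1\<close> has the larger \<open>z\<close>-component;
  the two sides along \<open>X1\<close> therefore do not cancel, even when the near one is on
  \<open>y = 0\<close>.\<close>

lemma steers_martinet_loop: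
  assumes N: "N = norm_inf_coeff \<or> N = norm_one_coeff" and L: "0 < L"
  shows "\<exists>h>0. \<exists>h'>0. steers N martinet_X1 martinet_X2 L q (q + axis 3 h) \<and> steers N martinet_X1 martinet_X2 L q (q - axis 3 h')"
proof -
  define \<epsilon> :: real where "\<epsilon> = (if q$2 \<ge> 0 then 1 else -1)"
  have \<epsilon>: "\<bar>\<epsilon>\<bar> = 1" "\<epsilon> * \<epsilon> = 1" "\<epsilon> * q$2 = \<bar>q$2\<bar>" by (auto simp: \<epsilon>_def)
  define \<delta> where "\<delta> = L / 4"
  define h where "h = \<delta> * (2 * \<delta> * \<bar>q$2\<bar> + \<delta> * \<delta>)"
  have d: "\<delta> > 0" using L unfolding \<delta>_def by simp
  then have h: "h > 0" unfolding h_def by (intro mult_pos_pos add_nonneg_pos) auto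
  have q: "q = vector [q$1, q$2, q$3]" by (simp add: vec_eq_iff forall_3 vector_3)
  have st: "steers N martinet_X1 martinet_X2 L q (q + axis 3 (\<sigma> * h))" if \<sigma>: "\<bar>\<sigma>\<bar> = 1" for \<sigma>
  proof -
    let ?l = "[(0, \<epsilon> * \<delta>), (\<sigma> * \<delta>, 0), (0, - (\<epsilon> * \<delta>)), (- (\<sigma> * \<delta>), 0)]"
    have "(q$2 + \<epsilon> * \<delta>)^2 = (q$2)^2 + 2 * \<delta> * (\<epsilon> * q$2) + (\<epsilon> * \<epsilon>) * (\<delta> * \<delta>)"
      by (simp add: power2_eq_square algebra_simps)
    then have "martinet_height (q$2) ?l = \<sigma> * h"
      unfolding \<epsilon> h_def by (simp add: algebra_simps)
    moreover have "(\<Sum>(a,b)\<leftarrow>?l. N a b) = L"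
      using N \<sigma> \<epsilon>(1) d by (auto simp: coeff_norm_simps abs_mult \<delta>_def)
    moreover have "(\<Sum>(a,b)\<leftarrow>?l. a) = 0" "(\<Sum>(a,b)\<leftarrow>?l. b) = 0" by simp_all
    ultimately have "steers N martinet_X1 martinet_X2 L (vector [q$1, q$2, q$3]) (vector [q$1 + 0, q$2 + 0, q$3 + \<sigma> * h])"
      using steers_martinet_list[OF N, of ?l "q$1" "q$2" "q$3"] by (simp only:)
    moreover have "vector [q$1 + 0, q$2 + 0, q$3 + \<sigma> * h] = q + axis 3 (\<sigma> * h)"
      by (simp add: vec_eq_iff forall_3 vector_3 axis_def)
    ultimately show ?thesis using q by simp
  qed
  have "q + axis 3 (- h) = q - axis 3 h" by (simp add: vec_eq_iff axis_def)
  then show ?thesis using st[of 1] st[of "-1"] h by auto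
qed

text \<open>The calibration is \<open>s * z + p * x\<close> plus \<open>H y\<close> with a sign that
  is reversed at the largest \<open>\<bar>y\<bar>\<close>. The choice of norm enters through
  \<open>bnd\<close>, to which \<open>p\<close>, \<open>H\<close> and \<open>C\<close> are fitted
  later.\<close>

lemma martinet_calibration:
  assumes hor: "horizontal martinet_X1 martinet_X2 T \<gamma>" and g0: "\<gamma> 0 = 0"
    and len: "sf_length N martinet_X1 martinet_X2 T \<gamma> \<le> ennreal L" and L: "0 \<le> L"
    and t: "0 \<le> t" "t \<le> T" "\<And>\<tau>. 0 \<le> \<tau> \<Longrightarrow> \<tau> \<le> T \<Longrightarrow> \<bar>\<gamma> \<tau> $ 2\<bar> \<le> \<bar>\<gamma> t $ 2\<bar>"
    and H: "\<And>u. (H has_real_derivative h u) (at u)" "\<And>u. H (- u) = - H u" "lipschitz_on_balls (\<lambda>q :: real^3. H (q$2))"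
    and h: "\<And>u. \<bar>u\<bar> \<le> \<bar>\<gamma> t $ 2\<bar> \<Longrightarrow> 0 \<le> h u"
    and bnd: "\<And>y w1 w2. \<bar>y\<bar> \<le> \<bar>\<gamma> t $ 2\<bar> \<Longrightarrow> (s * y^2 + p) * w1 + h y * \<bar>w2\<bar> \<le> C * N w1 w2" and C: "0 \<le> C"
  shows "s * \<gamma> T $ 3 + p * \<gamma> T $ 1 + 2 * H \<bar>\<gamma> t $ 2\<bar> - H \<bar>\<gamma> T $ 2\<bar> \<le> C * L"
proof -
  define \<mu> where "\<mu> = \<bar>\<gamma> t $ 2\<bar>"
  define y where "y = \<gamma> T $ 2"
  define \<epsilon> :: real where "\<epsilon> = (if \<gamma> t $ 2 \<ge> 0 then 1 else -1)"
  have H0: "H 0 = 0" using H(2)[of 0] by simp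
  have odd: "\<epsilon> * H u = H (\<epsilon> * u)" for u using H(2)[of u] by (auto simp: \<epsilon>_def)
  have \<epsilon>: "\<bar>\<epsilon>\<bar> = 1" "\<bar>- \<epsilon>\<bar> = 1" "\<epsilon> * \<gamma> t $ 2 = \<mu>" by (auto simp: \<epsilon>_def \<mu>_def)
  obtain l1 l2 l3 where l: "0 \<le> l1" "0 \<le> l2" "0 \<le> l3"
    "arc_length N martinet_X1 martinet_X2 T \<gamma> 0 t = ennreal l1" "arc_length N martinet_X1 martinet_X2 T \<gamma> t T = ennreal l2"
    "arc_length N martinet_X1 martinet_X2 T \<gamma> T T = ennreal l3" "l1 + l2 + l3 \<le> L"
    using arc_length_split3[OF t(1,2) order_refl len L] by blast
  have c: "s * \<gamma> b $ 3 + p * \<gamma> b $ 1 + \<kappa> * H (\<gamma> b $ 2) - (s * \<gamma> a $ 3 + p * \<gamma> a $ 1 + \<kappa> * H (\<gamma> a $ 2)) \<le> C * l"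
    if k: "\<bar>\<kappa>\<bar> = 1" and a: "0 \<le> a" "a \<le> b" "b \<le> T" "arc_length N martinet_X1 martinet_X2 T \<gamma> a b = ennreal l" "0 \<le> l" for \<kappa> a b l
  proof (rule calibration_real[OF hor a, where \<phi>="\<lambda>q. s * q$3 + p * q$1 + \<kappa> * H (q$2)" and \<phi>'="\<lambda>q v. s * v$3 + p * v$1 + \<kappa> * (h (q$2) * v$2)"])
    show "lipschitz_on_balls (\<lambda>q :: real^3. s * q$3 + p * q$1 + \<kappa> * H (q$2))" by (intro lipschitz_on_balls_intros H(3))
    show "((\<lambda>q :: real^3. s * q$3 + p * q$1 + \<kappa> * H (q$2)) has_derivative (\<lambda>v. s * v$3 + p * v$1 + \<kappa> * (h (q$2) * v$2))) (at q)" for q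
      by (intro has_derivative_add has_derivative_mult_right has_derivative_vec_nth has_derivative_ident has_derivative_compose_vec_nth H(1))
    fix \<tau> w1 w2 :: real assume \<tau>: "\<tau> \<in> {a..b}"
    let ?y = "\<gamma> \<tau> $ 2"
    have yb: "\<bar>?y\<bar> \<le> \<bar>\<gamma> t $ 2\<bar>" using t(3)[of \<tau>] \<tau> a by auto
    have "\<kappa> * (h ?y * w2) \<le> \<bar>\<kappa> * (h ?y * w2)\<bar>" by simp
    also have "\<dots> = h ?y * \<bar>w2\<bar>" using k h[OF yb] by (simp add: abs_mult)
    finally have "(s * ?y^2 + p) * w1 + \<kappa> * (h ?y * w2) \<le> C * N w1 w2" using bnd[OF yb, of w1 w2] by linarith
    then show "s * (w1 *\<^sub>R martinet_X1 (\<gamma> \<tau>) + w2 *\<^sub>R martinet_X2 (\<gamma> \<tau>)) $ 3 + p * (w1 *\<^sub>R martinet_X1 (\<gamma> \<tau>) + w2 *\<^sub>R martinet_X2 (\<gamma> \<tau>)) $ 1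
       + \<kappa> * (h ?y * (w1 *\<^sub>R martinet_X1 (\<gamma> \<tau>) + w2 *\<^sub>R martinet_X2 (\<gamma> \<tau>)) $ 2) \<le> C * N w1 w2"
      by (simp add: martinet_X1_def martinet_X2_def vector_3 algebra_simps)
  qed (rule C)
  have z: "\<gamma> 0 $ i = 0" for i using g0 by simp
  have e: "\<epsilon> * H (\<gamma> t $ 2) = H \<mu>" "\<epsilon> * H (\<gamma> T $ 2) = H (\<epsilon> * y)" unfolding odd \<epsilon> y_def by simp_all
  have "s * \<gamma> t $ 3 + p * \<gamma> t $ 1 + H \<mu> \<le> C * l1"
    using c[OF \<epsilon>(1) order_refl t(1,2) l(4,1)] unfolding e z H0 by simp
  moreover have "s * \<gamma> T $ 3 + p * \<gamma> T $ 1 - H (\<epsilon> * y) - (s * \<gamma> t $ 3 + p * \<gamma> t $ 1 - H \<mu>) \<le> C * l2"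
    using c[OF \<epsilon>(2) t(1,2) order_refl l(5,2)] e by simp
  \<comment> \<open>The curve may end on the other side of \<open>y = 0\<close> from its peak;
    oddness and monotonicity of \<open>H\<close> cover this.\<close>
  moreover have "H (\<epsilon> * y) \<le> H \<bar>y\<bar>"
  proof -
    have "H 0 \<le> H \<bar>y\<bar>"
    proof (rule DERIV_nonneg_imp_nondecreasing[OF abs_ge_zero])
      fix u assume "0 \<le> u" "u \<le> \<bar>y\<bar>"
      then have "0 \<le> h u" using t(3)[of T] t(1,2) unfolding y_def by (intro h) auto
      then show "\<exists>d. (H has_real_derivative d) (at u) \<and> 0 \<le> d" using H(1) by blast
    qed
    then have "0 \<le> H \<bar>y\<bar>" unfolding H0 .
    moreover have "\<epsilon> * y = \<bar>y\<bar> \<or> \<epsilon> * y = - \<bar>y\<bar>" by (auto simp: \<epsilon>_def)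
    ultimately show ?thesis using H(2)[of "\<bar>y\<bar>"] by auto
  qed
  moreover have "C * l1 + C * l2 \<le> C * L" using l C by (simp add: distrib_left[symmetric] mult_left_mono)
  ultimately show ?thesis unfolding \<mu>_def y_def by linarith
qed

text \<open>Back along \<open>y = 0\<close>, up to \<open>m\<close>, forward by
  \<open>K - m\<close>, down to \<open>y\<close>: this path has length \<open>L\<close> and gain
  \<open>m^2 * (K - m)\<close>, with free maximiser \<open>m = 2 * K / 3\<close>. The limit
  \<open>K - max x 0\<close> keeps the lengths \<open>K - m - x\<close> and \<open>K - m\<close> of
  the two legs along \<open>X1\<close> nonnegative.\<close>

definition martinet_bound_1 :: "real \<Rightarrow> real \<Rightarrow> real \<Rightarrow> real" where
  "martinet_bound_1 L x y = (let K = (L + x + y) / 2; m = max y (min (2 * K / 3) (K - max x 0)) in m^2 * (K - m))"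

lemma clamp_maximizes_cubic:
  fixes \<mu> K y b :: real
  assumes "0 \<le> y" "y \<le> \<mu>" "\<mu> \<le> K - b" "0 \<le> b"
  shows "\<mu>^2 * (K - \<mu>) \<le> (max y (min (2 * K / 3) (K - b)))^2 * (K - max y (min (2 * K / 3) (K - b)))"
proof -
  have *: "\<mu>^2 * (K - \<mu>) \<le> m^2 * (K - m)" if "0 \<le> (m - \<mu>) * (K * (m + \<mu>) - (m^2 + m * \<mu> + \<mu>^2))" for m
    using that by (simp add: power2_eq_square algebra_simps)
  \<comment> \<open>If \<open>m\<close> is the free maximiser, then \<open>K = 3 * m / 2\<close> and
    the second factor in \<open>*\<close> contains \<open>m - \<mu>\<close> once more. The clamped
    cases compare \<open>K\<close> with \<open>3 * m / 2\<close>.\<close>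
  have fac: "3 * m / 2 * (m + \<mu>) - (m^2 + m * \<mu> + \<mu>^2) = (m - \<mu>) * (m / 2 + \<mu>)" for m
    by (simp add: power2_eq_square field_simps)
  consider "max y (min (2 * K / 3) (K - b)) = 2 * K / 3" | "max y (min (2 * K / 3) (K - b)) = y" "2 * K / 3 \<le> y"
    | "max y (min (2 * K / 3) (K - b)) = K - b" "K - b \<le> 2 * K / 3"
  proof (cases "2 * K / 3 \<le> y")
    case True
    then have "max y (min (2 * K / 3) (K - b)) = y" by simp
    then show ?thesis using that(2) True by blast
  next
    case False
    then show ?thesis using that(1,3) assms by (cases "2 * K / 3 \<le> K - b") (simp_all add: max_def min_def)
  qed
  then show ?thesis
  proof cases
    case 1
    define m where "m = 2 * K / 3"
    have K: "K = 3 * m / 2" and m: "0 \<le> m" using assms unfolding m_def by auto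
    have "(m - \<mu>) * (K * (m + \<mu>) - (m^2 + m * \<mu> + \<mu>^2)) = (m - \<mu>)^2 * (m / 2 + \<mu>)"
      unfolding K fac by (simp add: power2_eq_square)
    also have "\<dots> \<ge> 0" using m assms by simp
    finally show ?thesis unfolding 1 unfolding m_def[symmetric] by (rule *)
  next
    case 2
    have "K * (y + \<mu>) \<le> 3 * y / 2 * (y + \<mu>)" using 2 assms by (intro mult_right_mono) auto
    moreover have "(y - \<mu>) * (y / 2 + \<mu>) \<le> 0" using assms by (intro mult_nonpos_nonneg) auto
    ultimately have "K * (y + \<mu>) - (y^2 + y * \<mu> + \<mu>^2) \<le> 0" using fac[of y] by linarith
    then show ?thesis unfolding 2(1) using assms by (intro * mult_nonpos_nonpos) auto
  next
    case 3
    define m where "m = K - b"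
    have m: "\<mu> \<le> m" "3 * m / 2 \<le> K" using 3 assms unfolding m_def by auto
    have "3 * m / 2 * (m + \<mu>) \<le> K * (m + \<mu>)" using m assms by (intro mult_right_mono) auto
    moreover have "(m - \<mu>) * (m / 2 + \<mu>) \<ge> 0" using m assms by (intro mult_nonneg_nonneg) auto
    ultimately have "K * (m + \<mu>) - (m^2 + m * \<mu> + \<mu>^2) \<ge> 0" using fac[of m] by linarith
    then show ?thesis unfolding 3(1) unfolding m_def[symmetric] using m by (intro * mult_nonneg_nonneg) auto
  qed
qed

lemma martinet_barrier_one:
  assumes hor: "horizontal martinet_X1 martinet_X2 T \<gamma>" and T: "0 \<le> T" and g0: "\<gamma> 0 = 0"
    and len: "sf_length norm_one_coeff martinet_X1 martinet_X2 T \<gamma> \<le> ennreal L" and L: "0 \<le> L" and s: "\<bar>s\<bar> = 1"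
  shows "\<bar>\<gamma> T $ 1\<bar> + \<bar>\<gamma> T $ 2\<bar> \<le> L" "s * \<gamma> T $ 3 \<le> martinet_bound_1 L (s * \<gamma> T $ 1) \<bar>\<gamma> T $ 2\<bar>"
proof -
  have cf: "continuous_on UNIV (\<lambda>q :: real^3. \<bar>q $ 2\<bar>)" by (intro continuous_intros)
  obtain t where t: "0 \<le> t" "t \<le> T" "\<And>\<tau>. 0 \<le> \<tau> \<Longrightarrow> \<tau> \<le> T \<Longrightarrow> \<bar>\<gamma> \<tau> $ 2\<bar> \<le> \<bar>\<gamma> t $ 2\<bar>"
    using horizontal_coord_attains_max[OF hor T cf] by blast
  define \<mu> x y where "\<mu> = \<bar>\<gamma> t $ 2\<bar>" and "x = \<gamma> T $ 1" and "y = \<bar>\<gamma> T $ 2\<bar>"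
  have \<mu>: "0 \<le> y" "y \<le> \<mu>" using t(3)[of T] T unfolding \<mu>_def y_def by auto
  note cal = martinet_calibration[OF hor g0 len L t, folded \<mu>_def x_def y_def]
  define \<rho> :: real where "\<rho> = (if x \<ge> 0 then 1 else -1)"
  have \<rho>: "\<rho> * x = \<bar>x\<bar>" "\<bar>\<rho>\<bar> = 1" by (auto simp: \<rho>_def)
  \<comment> \<open>Rising to \<open>\<mu>\<close> and ending at \<open>y\<close> costs
    \<open>2 * \<mu> - y\<close>, on top of the displacement in \<open>x\<close>.\<close>
  have "0 * \<gamma> T $ 3 + \<rho> * x + 2 * \<mu> - y \<le> 1 * L"
  proof (rule cal[where H="\<lambda>u. u" and h="\<lambda>_. 1"])
    show "(0 * y\<^sup>2 + \<rho>) * w1 + 1 * \<bar>w2\<bar> \<le> 1 * norm_one_coeff w1 w2" for y w1 w2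
      using \<rho>(2) by (auto simp: norm_one_coeff_def \<rho>_def)
  qed (auto intro!: lipschitz_on_balls_intros derivative_eq_intros)
  then have b1: "\<bar>x\<bar> + 2 * \<mu> - y \<le> L" using \<rho> by simp
  then show "\<bar>\<gamma> T $ 1\<bar> + \<bar>\<gamma> T $ 2\<bar> \<le> L" using \<mu> unfolding x_def y_def by linarith
  \<comment> \<open>The value of \<open>p\<close> centres the range of \<open>y^2\<close> between 0
    and \<open>\<mu>^2\<close>, so that \<open>\<mu>^2 / 2\<close> bounds the coefficients of both
    controls.\<close>
  have "s * \<gamma> T $ 3 + (- s * \<mu>^2 / 2) * x + 2 * (\<mu>^2 / 2 * \<mu>) - \<mu>^2 / 2 * y \<le> \<mu>^2 / 2 * L"
  proof (rule cal[where H="\<lambda>u. \<mu>^2 / 2 * u" and h="\<lambda>_. \<mu>^2 / 2"])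
    fix u w1 w2 :: real assume u: "\<bar>u\<bar> \<le> \<mu>"
    have u2: "u^2 \<le> \<mu>^2" using u by (metis abs_ge_zero power2_abs power_mono)
    have uu: "\<bar>u^2 - \<mu>^2 / 2\<bar> \<le> \<mu>^2 / 2" using u2 zero_le_power2[of u] by (intro abs_leI) linarith+
    have "(s * u^2 + - s * \<mu>^2 / 2) * w1 = s * ((u^2 - \<mu>^2 / 2) * w1)" by (simp add: algebra_simps)
    also have "\<dots> \<le> \<bar>s * ((u^2 - \<mu>^2 / 2) * w1)\<bar>" by (rule abs_ge_self)
    also have "\<dots> = \<bar>u^2 - \<mu>^2 / 2\<bar> * \<bar>w1\<bar>" unfolding abs_mult s by (rule mult_1)
    also have "\<dots> \<le> \<mu>^2 / 2 * \<bar>w1\<bar>" by (rule mult_right_mono[OF uu abs_ge_zero])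
    finally show "(s * u^2 + - s * \<mu>^2 / 2) * w1 + \<mu>^2 / 2 * \<bar>w2\<bar> \<le> \<mu>^2 / 2 * norm_one_coeff w1 w2"
      by (simp add: norm_one_coeff_def distrib_left)
  qed (auto intro!: lipschitz_on_balls_intros derivative_eq_intros)
  then have "s * \<gamma> T $ 3 \<le> \<mu>^2 * ((L + s * x + y) / 2 - \<mu>)"
    by (simp add: power2_eq_square field_simps)
  also have "\<dots> \<le> martinet_bound_1 L (s * x) y"
    unfolding martinet_bound_1_def Let_def
  proof (rule clamp_maximizes_cubic[OF \<mu>])
    have "\<bar>x\<bar> = \<bar>s * x\<bar>" using s by (simp add: abs_mult)
    then show "\<mu> \<le> (L + s * x + y) / 2 - max (s * x) 0" using b1 by (auto simp: max_def field_simps)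
  qed simp
  finally show "s * \<gamma> T $ 3 \<le> martinet_bound_1 L (s * \<gamma> T $ 1) \<bar>\<gamma> T $ 2\<bar>" unfolding x_def y_def .
qed

text \<open>Reflections turn the given paths into paths to \<open>(q$1, q$2)\<close> with the
  extreme heights \<open>f (q$1)\<close> and \<open>- f (- q$1)\<close>. Heights in between come
  from interpolation with the straight segment, whose own height is
  \<open>q$1 * (q$2)^2 / 3\<close>.\<close>

lemma steers_martinet_symmetric:
  assumes N: "N = norm_inf_coeff \<or> N = norm_one_coeff" and p: "N (q$1) (q$2) \<le> L"
    and z: "- f (- q$1) \<le> q$3" "q$3 \<le> f (q$1)"
    and path: "\<And>x. N x (q$2) \<le> L \<Longrightarrow> \<exists>l. (\<Sum>(a,b)\<leftarrow>l. a) = x \<and> (\<Sum>(a,b)\<leftarrow>l. b) = \<bar>q$2\<bar> \<and> (\<Sum>(a,b)\<leftarrow>l. N a b) \<le> L \<and> martinet_height 0 l = f x"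
  shows "steers N martinet_X1 martinet_X2 L 0 q"
proof -
  define \<eta> :: real where "\<eta> = (if q$2 \<ge> 0 then 1 else -1)"
  have \<eta>: "\<bar>\<eta>\<bar> = 1" "\<eta> * \<eta> = 1" "\<eta> * \<bar>q$2\<bar> = q$2" by (auto simp: \<eta>_def)
  have Nabs: "N (\<sigma> * a) (\<eta> * b) = N a b" if "\<bar>\<sigma>\<bar> = 1" for \<sigma> a b
    using N \<eta>(1) that by (auto simp: norm_inf_coeff_def norm_one_coeff_def abs_mult)
  have key: "\<exists>l. (\<Sum>(a,b)\<leftarrow>l. a) = q$1 \<and> (\<Sum>(a,b)\<leftarrow>l. b) = q$2 \<and> (\<Sum>(a,b)\<leftarrow>l. N a b) \<le> L \<and> martinet_height 0 l = \<sigma> * f (\<sigma> * q$1)"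
    if \<sigma>: "\<sigma> = 1 \<or> \<sigma> = -1" for \<sigma>
  proof -
    have "N (\<sigma> * q$1) (q$2) \<le> L" using p N \<sigma> by (auto simp: norm_inf_coeff_def norm_one_coeff_def)
    then obtain l where l: "(\<Sum>(a,b)\<leftarrow>l. a) = \<sigma> * q$1" "(\<Sum>(a,b)\<leftarrow>l. b) = \<bar>q$2\<bar>" "(\<Sum>(a,b)\<leftarrow>l. N a b) \<le> L" "martinet_height 0 l = f (\<sigma> * q$1)"
      using path by blast
    define m where "m = map (\<lambda>(a,b). (\<sigma> * a, b)) (map (\<lambda>(a,b). (a, \<eta> * b)) l)"
    have "martinet_height 0 m = \<sigma> * f (\<sigma> * q$1)"
      unfolding m_def martinet_height_reflect(1) using martinet_height_reflect(2)[OF \<eta>(2), of 0 l] l(4) by simp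
    moreover have "(\<Sum>(a,b)\<leftarrow>m. a) = \<sigma> * (\<Sum>(a,b)\<leftarrow>l. a)" "(\<Sum>(a,b)\<leftarrow>m. b) = \<eta> * (\<Sum>(a,b)\<leftarrow>l. b)" "(\<Sum>(a,b)\<leftarrow>m. N a b) = (\<Sum>(a,b)\<leftarrow>l. N a b)"
      unfolding m_def using \<sigma> Nabs[of 1] Nabs[of "-1"] by (induction l) (auto simp: distrib_left)
    ultimately show ?thesis using l \<eta>(3) \<sigma> by (intro exI[of _ m]) auto
  qed
  have q: "q = vector [q$1, q$2, q$3]" by (simp add: vec_eq_iff forall_3 vector_3)
  show ?thesis
  proof (cases "q$1 * (q$2)^2 / 3 \<le> q$3")
    case True
    obtain l where "(\<Sum>(a,b)\<leftarrow>l. a) = q$1" "(\<Sum>(a,b)\<leftarrow>l. b) = q$2" "(\<Sum>(a,b)\<leftarrow>l. N a b) \<le> L" "martinet_height 0 l = 1 * f (1 * q$1)"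
      using key[of 1] by blast
    then show ?thesis using steers_martinet_interpolate[OF N p, of l "q$3"] z True q by simp
  next
    case False
    obtain l where "(\<Sum>(a,b)\<leftarrow>l. a) = q$1" "(\<Sum>(a,b)\<leftarrow>l. b) = q$2" "(\<Sum>(a,b)\<leftarrow>l. N a b) \<le> L" "martinet_height 0 l = -1 * f (-1 * q$1)"
      using key[of "-1"] by blast
    then show ?thesis using steers_martinet_interpolate[OF N p, of l "q$3"] z False q by simp
  qed
qed

lemma steers_martinet_reach_one:
  assumes p: "norm_one_coeff (q$1) (q$2) \<le> L"
    and z: "- martinet_bound_1 L (- q$1) \<bar>q$2\<bar> \<le> q$3" "q$3 \<le> martinet_bound_1 L (q$1) \<bar>q$2\<bar>"
  shows "steers norm_one_coeff martinet_X1 martinet_X2 L 0 q"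
proof (rule steers_martinet_symmetric[of norm_one_coeff q L "\<lambda>x. martinet_bound_1 L x \<bar>q$2\<bar>"])
  fix x assume "norm_one_coeff x (q$2) \<le> L"
  then have x: "\<bar>x\<bar> + \<bar>q$2\<bar> \<le> L" by (simp add: norm_one_coeff_def)
  define y where "y = \<bar>q$2\<bar>"
  define K where "K = (L + x + y) / 2"
  define m where "m = max y (min (2 * K / 3) (K - max x 0))"
  have K: "2 * K = L + x + y" unfolding K_def by (simp add: field_simps)
  have "y \<le> K - max x 0" using x K unfolding y_def[symmetric] by (auto simp: max_def)
  then have m: "0 \<le> y" "y \<le> m" "m \<le> K - max x 0" unfolding m_def y_def by auto
  have P: "0 \<le> K - m" "x \<le> K - m" using m(3) by auto
  let ?l = "[(- (K - m - x), 0), (0, m), (K - m, 0), (0, y - m)]"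
  have "(\<Sum>(a,b)\<leftarrow>?l. norm_one_coeff a b) = L"
    using m P K by (simp add: norm_one_coeff_def)
  moreover have "martinet_height 0 ?l = martinet_bound_1 L x y"
    unfolding martinet_bound_1_def Let_def K_def[symmetric] m_def[symmetric] by simp
  ultimately show "\<exists>l. (\<Sum>(a,b)\<leftarrow>l. a) = x \<and> (\<Sum>(a,b)\<leftarrow>l. b) = \<bar>q$2\<bar> \<and> (\<Sum>(a,b)\<leftarrow>l. norm_one_coeff a b) \<le> L
      \<and> martinet_height 0 l = martinet_bound_1 L x \<bar>q$2\<bar>"
    unfolding y_def[symmetric] by (intro exI[of _ ?l]) simp
qed (rule disjI2, rule refl, rule p, rule z, rule z)

section \<open>Martinet distribution with the sup norm\<close>

lemma cubic_mono_below_peak: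
  fixes a b \<mu> \<nu> :: real
  assumes "0 \<le> \<mu>" "\<mu> \<le> \<nu>" "0 \<le> b" "b * \<nu> \<le> a"
  shows "a * \<mu>^2 - 2 / 3 * b * \<mu>^3 \<le> a * \<nu>^2 - 2 / 3 * b * \<nu>^3"
proof -
  \<comment> \<open>The cubic has derivative \<open>2 * \<mu> * (a - b * \<mu>)\<close>; the
    identity expresses its increase without division by \<open>b\<close>.\<close>
  have "0 \<le> (\<nu> - \<mu>) * ((a - b * \<nu>) * (\<mu> + \<nu>)) + b / 3 * ((\<nu> - \<mu>)^2 * (\<nu> + 2 * \<mu>))"
    using assms by (intro add_nonneg_nonneg mult_nonneg_nonneg) auto
  also have "\<dots> = (a * \<nu>^2 - 2 / 3 * b * \<nu>^3) - (a * \<mu>^2 - 2 / 3 * b * \<mu>^3)"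
    by (simp add: power2_eq_square power3_eq_cube field_simps)
  finally show ?thesis by simp
qed

lemma cubic_antimono_above_peak:
  fixes a b \<mu> \<nu> :: real
  assumes "0 \<le> \<mu>" "\<mu> \<le> \<nu>" "0 \<le> b" "a \<le> b * \<mu>"
  shows "a * \<nu>^2 - 2 / 3 * b * \<nu>^3 \<le> a * \<mu>^2 - 2 / 3 * b * \<mu>^3"
proof -
  have "0 \<le> (\<nu> - \<mu>) * ((b * \<mu> - a) * (\<mu> + \<nu>)) + b / 3 * ((\<nu> - \<mu>)^2 * (2 * \<nu> + \<mu>))"
    using assms by (intro add_nonneg_nonneg mult_nonneg_nonneg) auto
  also have "\<dots> = (a * \<mu>^2 - 2 / 3 * b * \<mu>^3) - (a * \<nu>^2 - 2 / 3 * b * \<nu>^3)"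
    by (simp add: power2_eq_square power3_eq_cube field_simps)
  finally show ?thesis by simp
qed

text \<open>The optimal path waits at height \<open>y = 0\<close> moving in the direction \<open>- X1\<close>, rises to the turning height where \<open>X1\<close>
  changes sign, continues to the peak, and descends to \<open>y\<close>, changing sign again at the turning height if that is
  above \<open>y\<close>. The two candidates for the peak correspond to these two alternatives.\<close>

definition martinet_peak_inf :: "real \<Rightarrow> real \<Rightarrow> real \<Rightarrow> real" where
  "martinet_peak_inf L x y = max y (min (max (((L + x) / 2 + y) / (2 - sqrt 2 / 2)) ((L + x) / 2 / (2 - 2 * (sqrt 2 / 2)))) ((L + y) / 2))"

text \<open>Given the peak \<open>m\<close>, the displacement in \<open>x\<close> forces
  \<open>c + max c y = 2 * m - (L + x) / 2\<close> for the turning height \<open>c\<close>. The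
  arguments of \<open>min\<close> solve this for \<open>c \<le> y\<close> and for
  \<open>c \<ge> y\<close>.\<close>

definition martinet_turn_inf :: "real \<Rightarrow> real \<Rightarrow> real \<Rightarrow> real" where
  "martinet_turn_inf L x y = min (2 * martinet_peak_inf L x y - y - (L + x) / 2) (martinet_peak_inf L x y - (L + x) / 2 / 2)"

text \<open>With both controls at full strength, a leg gains a difference of cubes over 3, with a
  minus sign while \<open>X1\<close> is reversed; the leg on \<open>y = 0\<close> gains
  nothing.\<close>

definition martinet_bound_2 :: "real \<Rightarrow> real \<Rightarrow> real \<Rightarrow> real" where
  "martinet_bound_2 L x y = (2 * martinet_peak_inf L x y ^ 3 - 2 * martinet_turn_inf L x y ^ 3
     - 2 * max (martinet_turn_inf L x y) y ^ 3 + y ^ 3) / 3"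

text \<open>For nonnegative \<open>y\<close> and \<open>k\<close>, the integral of
  \<open>\<bar>u^2 - k^2\<bar>\<close> from 0 to \<open>y\<close>.\<close>

definition martinet_J :: "real \<Rightarrow> real \<Rightarrow> real" where
  "martinet_J y k = (if y \<le> k then k^2 * y - y^3 / 3 else y^3 / 3 - k^2 * y + 4 * k^3 / 3)"

text \<open>The bound obtained from \<open>martinet_calibration\<close> with
  \<open>p = - s * k^2\<close>, \<open>C = E\<close> and
  \<open>h u = E - \<bar>u^2 - k^2\<bar>\<close>. As a Lagrange multiplier for \<open>x\<close>,
  \<open>k^2\<close> marks the height \<open>k\<close> at which \<open>X1\<close> should change
  sign; \<open>E\<close> is the multiplier of the length.\<close>

definition martinet_F :: "real \<Rightarrow> real \<Rightarrow> real \<Rightarrow> real \<Rightarrow> real \<Rightarrow> real \<Rightarrow> real" where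
  "martinet_F L x y k E \<mu> = k^2 * x + E * (L - 2 * \<mu> + y) + 2 * (\<mu>^3 / 3 - k^2 * \<mu> + 4 * k^3 / 3) - martinet_J y k"

text \<open>\<open>\<kappa>\<close> solves \<open>k^2 = \<mu>^2 - k^2\<close> as
  \<open>k = \<kappa> * \<mu>\<close>: then both lower limits for \<open>E\<close> in
  \<open>le_martinet_bound_2\<close> are \<open>\<mu>^2 / 2\<close>. \<open>P\<close> is the time
  that the optimal path moves in the direction \<open>+ X1\<close>. \<open>m1\<close> and
  \<open>m2\<close> are the peaks of the two cubics in \<open>martinet_W\<close>.\<close>

context
  fixes L x y \<kappa> P m c d m1 m2 :: real
  assumes xy: "\<bar>x\<bar> \<le> L" "0 \<le> y" "y \<le> L"
  defines "\<kappa> \<equiv> sqrt 2 / 2" and "P \<equiv> (L + x) / 2"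
    and "m \<equiv> martinet_peak_inf L x y" and "c \<equiv> martinet_turn_inf L x y"
    and "d \<equiv> max (martinet_turn_inf L x y) y"
    and "m1 \<equiv> ((L + x) / 2 + y) / (2 - sqrt 2 / 2)" and "m2 \<equiv> (L + x) / 2 / (2 - 2 * (sqrt 2 / 2))"
begin

lemma martinet_kappa: "0 < \<kappa>" "\<kappa> < 1" "\<kappa>^2 = 1 / 2" "\<kappa> * \<kappa> = 1 / 2" "\<kappa>^3 = \<kappa> / 2"
proof -
  show k2: "\<kappa>^2 = 1 / 2" unfolding \<kappa>_def by (simp add: power_divide)
  show "0 < \<kappa>" unfolding \<kappa>_def by simp
  have "sqrt 2 < (2::real)" by (rule real_less_lsqrt) auto
  then show "\<kappa> < 1" unfolding \<kappa>_def by simp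
  show "\<kappa> * \<kappa> = 1 / 2" using k2 by (simp add: power2_eq_square)
  show "\<kappa>^3 = \<kappa> / 2" using k2 by (simp add: power3_eq_cube power2_eq_square)
qed

lemma martinet_P: "0 \<le> P" "L + x = 2 * P" using xy unfolding P_def by auto

lemma martinet_peak_iff: "m1 \<le> t \<longleftrightarrow> P + y \<le> (2 - \<kappa>) * t" "t \<le> m1 \<longleftrightarrow> (2 - \<kappa>) * t \<le> P + y"
  "m2 \<le> t \<longleftrightarrow> P \<le> (2 - 2 * \<kappa>) * t" "t \<le> m2 \<longleftrightarrow> (2 - 2 * \<kappa>) * t \<le> P"
  using martinet_kappa(1,2) unfolding m1_def m2_def P_def[symmetric] \<kappa>_def[symmetric]
  by (simp_all add: pos_divide_le_eq pos_le_divide_eq mult.commute)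

lemma martinet_peak_cases: "m = y \<and> max m1 m2 \<le> y \<or> m = max m1 m2 \<and> y \<le> m \<and> 2 * m \<le> L + y \<or> 2 * m = L + y \<and> m \<le> max m1 m2 \<and> y \<le> m"
  unfolding m_def martinet_peak_inf_def m1_def[symmetric] m2_def[symmetric] using xy by (auto simp: max_def min_def)

lemma martinet_peak_bounds: "y \<le> m" "2 * m \<le> L + y" using martinet_peak_cases xy by auto

lemma martinet_turn: "c = min (2 * m - y - P) (m - P / 2)" unfolding c_def martinet_turn_inf_def m_def P_def ..

lemma martinet_turn_add: "c + d = 2 * m - P" "d = max c y"
  using martinet_turn unfolding d_def c_def[symmetric] by (auto simp: min_def max_def)

text \<open>Together with \<open>martinet_turn_le\<close> this gives \<open>c = \<kappa> * m\<close>
  at the free peak \<open>m = max m1 m2\<close>; only a clamped peak can separate the two.\<close>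

lemma martinet_turn_ge: "max m1 m2 \<le> m \<Longrightarrow> \<kappa> * m \<le> c"
  using martinet_peak_iff(1,3)[of m] unfolding martinet_turn by (auto simp: algebra_simps)

lemma martinet_turn_le: "m \<le> max m1 m2 \<Longrightarrow> c \<le> \<kappa> * m"
  using martinet_peak_iff(2,4)[of m] unfolding martinet_turn by (auto simp: algebra_simps le_max_iff_disj min_le_iff_disj)

lemma martinet_turn_bounds: "0 \<le> c" "c \<le> m" "d \<le> m"
proof -
  have km: "0 \<le> \<kappa> * m" using martinet_kappa(1) xy(2) martinet_peak_bounds(1) by (intro mult_nonneg_nonneg) auto
  show "0 \<le> c" using martinet_peak_cases
  proof (elim disjE)
    assume "m = y \<and> max m1 m2 \<le> y"
    then have "\<kappa> * m \<le> c" by (intro martinet_turn_ge) simp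
    with km show ?thesis by (rule order_trans)
  next
    assume "m = max m1 m2 \<and> y \<le> m \<and> 2 * m \<le> L + y"
    then have "\<kappa> * m \<le> c" by (intro martinet_turn_ge) simp
    with km show ?thesis by (rule order_trans)
  next
    assume *: "2 * m = L + y \<and> m \<le> max m1 m2 \<and> y \<le> m"
    have "P \<le> L" using xy unfolding P_def by auto
    then show ?thesis using * xy unfolding martinet_turn by auto
  qed
  show "c \<le> m" using martinet_P unfolding martinet_turn by auto
  then show "d \<le> m" using martinet_peak_bounds unfolding martinet_turn_add(2) by simp
qed

text \<open>The bound for the balanced multipliers \<open>k = \<kappa> * \<mu>\<close>,
  \<open>E = \<mu>^2 / 2\<close> as a function of the peak: two cubics that meet at
  \<open>\<mu> = 2 * \<kappa> * y\<close>.\<close>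

definition martinet_W where "martinet_W \<mu> = (if y \<le> \<kappa> * \<mu> then P * \<mu>^2 - 2 / 3 * (2 - 2 * \<kappa>) * \<mu>^3 + y^3 / 3
    else (P + y) * \<mu>^2 - 2 / 3 * (2 - \<kappa>) * \<mu>^3 - y^3 / 3)"

lemma martinet_F_eq_W: "martinet_F L x y (\<kappa> * \<mu>) (\<mu>^2 / 2) \<mu> = martinet_W \<mu>"
proof -
  have k: "(\<kappa> * \<mu>)^2 = \<mu>^2 / 2" "(\<kappa> * \<mu>)^3 = \<kappa> / 2 * \<mu>^3" using martinet_kappa by (simp_all add: power_mult_distrib)
  have x: "x = 2 * P - L" using martinet_P by simp
  show ?thesis unfolding martinet_F_def martinet_W_def martinet_J_def k unfolding x
    by (auto simp: power2_eq_square power3_eq_cube field_simps)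
qed

lemma martinet_W_alt: assumes "\<kappa> * \<mu> \<le> y" shows "martinet_W \<mu> = (P + y) * \<mu>^2 - 2 / 3 * (2 - \<kappa>) * \<mu>^3 - y^3 / 3"
proof (cases "\<kappa> * \<mu> = y")
  case True
  have y3: "y^3 = \<kappa> / 2 * \<mu>^3" unfolding True[symmetric] using martinet_kappa by (simp add: power_mult_distrib)
  have y1: "y * \<mu>^2 = \<kappa> * \<mu>^3" unfolding True[symmetric] by (simp add: power2_eq_square power3_eq_cube)
  show ?thesis unfolding martinet_W_def y3 distrib_right[of P y] y1 using True by (simp add: field_simps)
qed (use assms in \<open>auto simp: martinet_W_def\<close>)

lemma martinet_W_junction: "\<kappa> * (2 * \<kappa> * y) = y" "y \<le> 2 * \<kappa> * y"
proof -
  have "\<kappa> * (2 * \<kappa> * y) = 2 * (\<kappa> * \<kappa>) * y" by (simp add: algebra_simps)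
  then show "\<kappa> * (2 * \<kappa> * y) = y" unfolding martinet_kappa(4) by simp
  have "1 / 2 < \<kappa>"
  proof (rule ccontr)
    assume "\<not> 1 / 2 < \<kappa>"
    then have "\<kappa> * \<kappa> \<le> 1 / 2 * (1 / 2)" using martinet_kappa(1) by (intro mult_mono) auto
    then show False using martinet_kappa(4) by simp
  qed
  then show "y \<le> 2 * \<kappa> * y" using mult_right_mono[of 1 "2 * \<kappa>" y] xy by simp
qed

text \<open>The peaks of the two cubics lie on the same side of their junction. This makes
  \<open>martinet_W\<close> unimodal, with its maximum at \<open>max m1 m2\<close>.\<close>

lemma martinet_peak_dichotomy: "max m1 m2 \<le> 2 * \<kappa> * y \<or> 2 * \<kappa> * y \<le> m1 \<and> max m1 m2 = m2"
proof -
  have e: "(2 - \<kappa>) * (2 * \<kappa> * y) = 4 * \<kappa> * y - y" "(2 - 2 * \<kappa>) * (2 * \<kappa> * y) = 4 * \<kappa> * y - 2 * y"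
    using martinet_W_junction(1) by (simp_all add: algebra_simps)
  show ?thesis
  proof (cases "P \<le> 4 * \<kappa> * y - 2 * y")
    case True
    then show ?thesis using martinet_peak_iff(1,3)[of "2 * \<kappa> * y"] unfolding e by auto
  next
    case False
    then have "2 * \<kappa> * y \<le> m1" using martinet_peak_iff(2)[of "2 * \<kappa> * y"] unfolding e by auto
    moreover have "m1 \<le> m2"
    proof -
      have "P + y = (2 - \<kappa>) * m1" using martinet_peak_iff(1,2)[of m1] by auto
      then have Pm: "P = (2 - \<kappa>) * m1 - y" by simp
      have "\<kappa> * (2 * \<kappa> * y) \<le> \<kappa> * m1" using calculation martinet_kappa(1) by (intro mult_left_mono) auto
      then have "y \<le> \<kappa> * m1" unfolding martinet_W_junction .
      then have "(2 - 2 * \<kappa>) * m1 \<le> P" unfolding Pm by (simp add: algebra_simps)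
      then show ?thesis using martinet_peak_iff(4) by blast
    qed
    ultimately show ?thesis by auto
  qed
qed

lemma martinet_kappa_le_iff: "\<kappa> * \<mu> \<le> y \<longleftrightarrow> \<mu> \<le> 2 * \<kappa> * y" "y \<le> \<kappa> * \<mu> \<longleftrightarrow> 2 * \<kappa> * y \<le> \<mu>"
  by (rule mult_le_cancel_left_pos[OF martinet_kappa(1), of \<mu> "2 * \<kappa> * y", unfolded martinet_W_junction(1)],
      rule mult_le_cancel_left_pos[OF martinet_kappa(1), of "2 * \<kappa> * y" \<mu>, unfolded martinet_W_junction(1)])

lemma martinet_W_mono: 
  assumes "y \<le> \<mu>" "\<mu> \<le> \<nu>" "\<nu> \<le> max m1 m2" shows "martinet_W \<mu> \<le> martinet_W \<nu>"
proof -
  have low: "martinet_W s \<le> martinet_W t" if "0 \<le> s" "s \<le> t" "t \<le> 2 * \<kappa> * y" "t \<le> m1" for s t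
    using cubic_mono_below_peak[of s t "2 - \<kappa>" "P + y"] that martinet_kappa martinet_peak_iff(2)[of t] martinet_W_alt[of s] martinet_W_alt[of t] martinet_kappa_le_iff by auto
  have high: "martinet_W s \<le> martinet_W t" if "0 \<le> s" "s \<le> t" "2 * \<kappa> * y \<le> s" "t \<le> m2" for s t
    using cubic_mono_below_peak[of s t "2 - 2 * \<kappa>" P] that martinet_kappa martinet_peak_iff(4)[of t] martinet_kappa_le_iff[of s] martinet_kappa_le_iff[of t] unfolding martinet_W_def by auto
  have mu0: "0 \<le> \<mu>" using assms xy by simp
  show ?thesis using martinet_peak_dichotomy
  proof
    assume 1: "max m1 m2 \<le> 2 * \<kappa> * y"
    show ?thesis
    proof (cases "\<nu> \<le> m1")
      case True
      then show ?thesis using low[of \<mu> \<nu>] mu0 assms 1 by auto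
    next
      case False
      \<comment> \<open>Below the junction the cubic in force peaks at \<open>m1\<close>; a larger
        \<open>m2\<close> would put \<open>m1\<close> beyond the junction.\<close>
      have "m2 \<le> m1"
      proof (rule ccontr)
        assume n: "\<not> m2 \<le> m1"
        have "P + y = (2 - \<kappa>) * m1" using martinet_peak_iff(1,2)[of m1] by auto
        then have Pm: "P = (2 - \<kappa>) * m1 - y" by simp
        have "(2 - 2 * \<kappa>) * m1 < P" using n martinet_peak_iff(3)[of m1] by auto
        then have "y < \<kappa> * m1" unfolding Pm by (simp add: algebra_simps)
        then show False using 1 martinet_kappa_le_iff(1)[of m1] by auto
      qed
      then show ?thesis using False assms by auto
    qed
  next
    assume 2: "2 * \<kappa> * y \<le> m1 \<and> max m1 m2 = m2"
    consider "\<nu> \<le> 2 * \<kappa> * y" | "2 * \<kappa> * y \<le> \<mu>" | "\<mu> \<le> 2 * \<kappa> * y" "2 * \<kappa> * y \<le> \<nu>" by linarith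
    then show ?thesis
    proof cases
      case 3
      have "martinet_W \<mu> \<le> martinet_W (2 * \<kappa> * y)" using 2 3 mu0 by (intro low) auto
      also have "\<dots> \<le> martinet_W \<nu>" using 2 3 mu0 assms by (intro high) auto
      finally show ?thesis .
    qed (use low[of \<mu> \<nu>] high[of \<mu> \<nu>] mu0 assms 2 in auto)
  qed
qed

lemma martinet_W_antimono: 
  assumes "y \<le> \<mu>" "\<mu> \<le> \<nu>" "max m1 m2 \<le> \<mu>" shows "martinet_W \<nu> \<le> martinet_W \<mu>"
proof -
  have low: "martinet_W t \<le> martinet_W s" if "0 \<le> s" "s \<le> t" "t \<le> 2 * \<kappa> * y" "m1 \<le> s" for s t
    using cubic_antimono_above_peak[of s t "2 - \<kappa>" "P + y"] that martinet_kappa martinet_peak_iff(1)[of s] martinet_W_alt[of s] martinet_W_alt[of t] martinet_kappa_le_iff by auto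
  have high: "martinet_W t \<le> martinet_W s" if "0 \<le> s" "s \<le> t" "2 * \<kappa> * y \<le> s" "m2 \<le> s" for s t
    using cubic_antimono_above_peak[of s t "2 - 2 * \<kappa>" P] that martinet_kappa martinet_peak_iff(3)[of s] martinet_kappa_le_iff[of s] martinet_kappa_le_iff[of t] unfolding martinet_W_def by auto
  have mu0: "0 \<le> \<mu>" using assms xy by simp
  consider "\<nu> \<le> 2 * \<kappa> * y" | "2 * \<kappa> * y \<le> \<mu>" | "\<mu> \<le> 2 * \<kappa> * y" "2 * \<kappa> * y \<le> \<nu>" by linarith
  then show ?thesis
  proof cases
    case 3
    have "martinet_W \<nu> \<le> martinet_W (2 * \<kappa> * y)" using 3 mu0 assms by (intro high) auto
    also have "\<dots> \<le> martinet_W \<mu>" using 3 mu0 assms by (intro low) auto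
    finally show ?thesis .
  qed (use low[of \<mu> \<nu>] high[of \<mu> \<nu>] mu0 assms in auto)
qed

lemma martinet_J_alt: "k \<le> y \<Longrightarrow> martinet_J y k = y^3 / 3 - k^2 * y + 4 * k^3 / 3"
  unfolding martinet_J_def by (cases "k = y") (auto simp: power2_eq_square power3_eq_cube)

text \<open>With the peak clamped at \<open>y\<close>, the multipliers \<open>k = c\<close>,
  \<open>E = c^2\<close> make the calibration exact on the leg along \<open>y = 0\<close>. They are
  admissible as long as \<open>\<nu>^2 \<le> 2 * c^2\<close>, which also makes the factored gap
  nonnegative.\<close>

lemma martinet_F_low:
  assumes m: "m = y" and \<nu>: "y \<le> \<nu>" "\<nu> \<le> 2 * \<kappa> * c" shows "martinet_F L x y c (c^2) \<nu> \<le> (2 * m^3 - 2 * c^3 - 2 * d^3 + y^3) / 3"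
proof -
  have d: "d = y" and c: "c \<le> y" and Pc: "P = y - c" using martinet_turn_add martinet_turn_bounds m by auto
  have x: "x = 2 * (y - c) - L" using martinet_P Pc by simp
  have "\<nu> * \<nu> \<le> (2 * \<kappa> * c) * (2 * \<kappa> * c)" using \<nu> xy by (intro mult_mono) auto
  also have "\<dots> = 4 * (\<kappa> * \<kappa>) * c^2" by (simp add: power2_eq_square)
  finally have n2: "\<nu> * \<nu> \<le> 2 * c^2" unfolding martinet_kappa(4) by simp
  moreover have "\<nu> * y \<le> \<nu> * \<nu>" "y * y \<le> \<nu> * \<nu>" using \<nu> xy by (auto intro: mult_mono)
  ultimately have "0 \<le> (\<nu> - y) * (4 * c^2 - 2 / 3 * (\<nu> * \<nu> + \<nu> * y + y * y))"
    using \<nu> by (intro mult_nonneg_nonneg) auto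
  moreover have "(2 * m^3 - 2 * c^3 - 2 * d^3 + y^3) / 3 - martinet_F L x y c (c^2) \<nu> = (\<nu> - y) * (4 * c^2 - 2 / 3 * (\<nu> * \<nu> + \<nu> * y + y * y))"
    unfolding martinet_F_def martinet_J_alt[OF c] d m unfolding x by (simp add: power2_eq_square power3_eq_cube field_simps)
  ultimately show ?thesis by linarith
qed

text \<open>At the free peak the balanced multipliers are exact, and no gap between the bound and
  the path remains.\<close>

lemma martinet_W_peak:
  assumes "c = \<kappa> * m" shows "martinet_W m = (2 * m^3 - 2 * c^3 - 2 * d^3 + y^3) / 3"
proof -
  have c3: "c^3 = \<kappa> / 2 * m^3" unfolding assms using martinet_kappa by (simp add: power_mult_distrib)
  show ?thesis
  proof (cases "y \<le> \<kappa> * m")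
    case True
    then have d: "d = c" using martinet_turn_add(2) assms by simp
    then have Pm: "P = 2 * m - 2 * \<kappa> * m" using martinet_turn_add(1) assms by simp
    show ?thesis unfolding d c3 martinet_W_def Pm using True
      by (simp add: power2_eq_square power3_eq_cube field_simps)
  next
    case False
    then have d: "d = y" using martinet_turn_add(2) assms by simp
    then have Pm: "P = 2 * m - \<kappa> * m - y" using martinet_turn_add(1) assms by simp
    show ?thesis unfolding d c3 martinet_W_def Pm using False
      by (simp add: power2_eq_square power3_eq_cube field_simps)
  qed
qed

text \<open>At the highest peak the length permits, no time is left on \<open>y = 0\<close>. Now
  \<open>E = \<nu>^2 - c^2\<close> makes \<open>h\<close> vanish at the peak height, and the gap is
  a multiple of \<open>(m - \<nu>)^2\<close>.\<close>

lemma martinet_F_high: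
  assumes m: "2 * m = L + y" and \<nu>: "0 \<le> \<nu>" "\<nu> \<le> m" shows "martinet_F L x y c (\<nu>^2 - c^2) \<nu> \<le> (2 * m^3 - 2 * c^3 - 2 * d^3 + y^3) / 3"
proof -
  have L: "L = 2 * m - y" using m by simp
  have x: "x = 2 * m - 2 * c - 2 * d + y" using martinet_P martinet_turn_add L by simp
  have top: "c^2 * x + 2 * (m^3 / 3 - c^2 * m + 4 * c^3 / 3) - martinet_J y c = (2 * m^3 - 2 * c^3 - 2 * d^3 + y^3) / 3"
  proof (cases "y \<le> c")
    case True
    then have "d = c" using martinet_turn_add by simp
    then show ?thesis using True unfolding martinet_J_def x by (simp add: power2_eq_square power3_eq_cube field_simps)
  next
    case False
    then have "d = y" using martinet_turn_add by simp
    then show ?thesis using False unfolding martinet_J_def x by (simp add: power2_eq_square power3_eq_cube field_simps)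
  qed
  have "0 \<le> 2 / 3 * ((m - \<nu>)^2 * (m + 2 * \<nu>))" using \<nu> by simp
  moreover have "(2 * m^3 - 2 * c^3 - 2 * d^3 + y^3) / 3 - martinet_F L x y c (\<nu>^2 - c^2) \<nu> = 2 / 3 * ((m - \<nu>)^2 * (m + 2 * \<nu>))"
    unfolding top[symmetric] martinet_F_def unfolding L by (simp add: power2_eq_square power3_eq_cube field_simps)
  ultimately show ?thesis by linarith
qed

text \<open>\<open>\<mu>\<close> is the peak of an arbitrary competitor, and the multipliers may
  depend on it. At a clamped peak those fixed by \<open>c\<close> are used where admissible;
  otherwise \<open>martinet_W\<close> is followed monotonically to \<open>2 * \<kappa> * c\<close>,
  where both choices coincide, or to the free peak.\<close>

lemma le_martinet_bound_2:
  assumes \<mu>: "y \<le> \<mu>" "2 * \<mu> \<le> L + y"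
    and bnd: "\<And>k E. 0 \<le> k \<Longrightarrow> k \<le> \<mu> \<Longrightarrow> k^2 \<le> E \<Longrightarrow> \<mu>^2 - k^2 \<le> E \<Longrightarrow> \<zeta> \<le> martinet_F L x y k E \<mu>"
  shows "\<zeta> \<le> martinet_bound_2 L x y"
proof -
  have mu0: "0 \<le> \<mu>" using \<mu> xy by simp
  have "\<kappa> * \<mu> \<le> \<mu>" using martinet_kappa mu0 by (simp add: mult_left_le_one_le)
  then have martinet_W: "\<zeta> \<le> martinet_W \<mu>"
  proof -
    have "(\<kappa> * \<mu>)^2 = \<mu>^2 / 2" unfolding power_mult_distrib martinet_kappa(3) by simp
    moreover have "0 \<le> \<kappa> * \<mu>" using martinet_kappa(1) mu0 by simp
    ultimately show ?thesis unfolding martinet_F_eq_W[symmetric] using \<open>\<kappa> * \<mu> \<le> \<mu>\<close> by (intro bnd) auto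
  qed
  \<comment> \<open>\<open>2 * \<kappa> * c\<close> equals \<open>c / \<kappa>\<close>, the peak
    whose balanced \<open>k\<close> is \<open>c\<close>.\<close>
  have "\<kappa> * (2 * \<kappa> * c) = 2 * (\<kappa> * \<kappa>) * c" by (simp add: algebra_simps)
  then have kc: "\<kappa> * (2 * \<kappa> * c) = c" unfolding martinet_kappa(4) by simp
  have kc2: "(2 * \<kappa> * c)^2 = 2 * c^2" using martinet_kappa by (simp add: power_mult_distrib)
  have cmu: "c \<le> \<kappa> * t \<longleftrightarrow> 2 * \<kappa> * c \<le> t" "\<kappa> * t \<le> c \<longleftrightarrow> t \<le> 2 * \<kappa> * c" for t
    by (rule mult_le_cancel_left_pos[OF martinet_kappa(1), of "2 * \<kappa> * c" t, unfolded kc],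
        rule mult_le_cancel_left_pos[OF martinet_kappa(1), of t "2 * \<kappa> * c", unfolded kc])
  have Wc: "martinet_W (2 * \<kappa> * c) = martinet_F L x y c (c^2) (2 * \<kappa> * c)" using martinet_F_eq_W[of "2 * \<kappa> * c"] unfolding kc kc2 by simp
  have c0: "0 \<le> 2 * \<kappa> * c" using martinet_turn_bounds(1) martinet_kappa by simp
  have "\<zeta> \<le> (2 * m^3 - 2 * c^3 - 2 * d^3 + y^3) / 3" using martinet_peak_cases
  proof (elim disjE)
    assume 1: "m = y \<and> max m1 m2 \<le> y"
    then have yc: "y \<le> 2 * \<kappa> * c" using martinet_turn_ge cmu(2)[of m] by auto
    show ?thesis
    proof (cases "\<mu> \<le> 2 * \<kappa> * c")
      case True
      have "\<mu>^2 \<le> 2 * c^2" using power_mono[OF True mu0, of 2] unfolding kc2 .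
      moreover have "c \<le> \<mu>" using martinet_turn_bounds(2) 1 \<mu> by auto
      ultimately have "\<zeta> \<le> martinet_F L x y c (c^2) \<mu>" using martinet_turn_bounds by (intro bnd) auto
      also have "\<dots> \<le> (2 * m^3 - 2 * c^3 - 2 * d^3 + y^3) / 3" using martinet_F_low 1 \<mu> True by blast
      finally show ?thesis .
    next
      case False
      have "\<zeta> \<le> martinet_W \<mu>" by (rule martinet_W)
      also have "\<dots> \<le> martinet_W (2 * \<kappa> * c)" using martinet_W_antimono[of "2 * \<kappa> * c" \<mu>] False yc 1 by auto
      also have "\<dots> \<le> (2 * m^3 - 2 * c^3 - 2 * d^3 + y^3) / 3" unfolding Wc using martinet_F_low[of "2 * \<kappa> * c"] 1 yc by auto
      finally show ?thesis .
    qed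
  next
    assume 2: "m = max m1 m2 \<and> y \<le> m \<and> 2 * m \<le> L + y"
    have "c = \<kappa> * m" using martinet_turn_ge martinet_turn_le 2 by auto
    moreover have "martinet_W \<mu> \<le> martinet_W m"
    proof (cases "\<mu> \<le> m")
      case True
      show ?thesis by (rule martinet_W_mono[OF \<mu>(1) True]) (use 2 in simp)
    next
      case False
      then have "m \<le> \<mu>" by simp
      then show ?thesis by (rule martinet_W_antimono[rotated]) (use 2 in simp_all)
    qed
    ultimately show ?thesis using martinet_W martinet_W_peak by auto
  next
    assume 3: "2 * m = L + y \<and> m \<le> max m1 m2 \<and> y \<le> m"
    have cm: "2 * \<kappa> * c \<le> m" using martinet_turn_le 3 cmu(1)[of m] by auto
    show ?thesis
    proof (cases "2 * \<kappa> * c \<le> \<mu>")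
      case True
      have "2 * c^2 \<le> \<mu>^2" using power_mono[OF True c0, of 2] unfolding kc2 .
      moreover have "c \<le> \<mu>" using cmu(1)[of \<mu>] True \<open>\<kappa> * \<mu> \<le> \<mu>\<close> by auto
      ultimately have "\<zeta> \<le> martinet_F L x y c (\<mu>^2 - c^2) \<mu>" using martinet_turn_bounds by (intro bnd) auto
      also have "\<dots> \<le> (2 * m^3 - 2 * c^3 - 2 * d^3 + y^3) / 3" using martinet_F_high[of \<mu>] 3 \<mu> mu0 by auto
      finally show ?thesis .
    next
      case False
      have "\<zeta> \<le> martinet_W \<mu>" by (rule martinet_W)
      also have "\<dots> \<le> martinet_W (2 * \<kappa> * c)" using martinet_W_mono[of \<mu> "2 * \<kappa> * c"] False cm 3 \<mu> by auto
      also have "\<dots> = martinet_F L x y c ((2 * \<kappa> * c)^2 - c^2) (2 * \<kappa> * c)" unfolding Wc kc2 by simp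
      also have "\<dots> \<le> (2 * m^3 - 2 * c^3 - 2 * d^3 + y^3) / 3" using martinet_F_high[OF _ c0 cm] 3 by auto
      finally show ?thesis .
    qed
  qed
  then show ?thesis unfolding martinet_bound_2_def m_def c_def d_def .
qed

lemma martinet_inf_optimal_path:
  "\<exists>l. (\<Sum>(a,b)\<leftarrow>l. a) = x \<and> (\<Sum>(a,b)\<leftarrow>l. b) = y \<and> (\<Sum>(a,b)\<leftarrow>l. norm_inf_coeff a b) \<le> L
      \<and> martinet_height 0 l = martinet_bound_2 L x y"
proof -
  \<comment> \<open>Rising to \<open>m\<close> and descending to \<open>y\<close> at full vertical
    speed takes time \<open>2 * m - y\<close>; \<open>e\<close> is what is left for the leg along
    \<open>y = 0\<close>.\<close>
  define e where "e = L - 2 * m + y"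
  have e: "0 \<le> e" using martinet_peak_bounds unfolding e_def by simp
  have dy: "y \<le> d" using martinet_turn_add by simp
  let ?l = "[(- e, 0), (- c, c), (m - c, m - c), (m - d, d - m), (y - d, y - d)]"
  have "(\<Sum>(a,b)\<leftarrow>?l. norm_inf_coeff a b) = e + c + (m - c) + (m - d) + (d - y)"
    using e martinet_turn_bounds dy by (simp add: norm_inf_coeff_def)
  also have "\<dots> = L" unfolding e_def by simp
  finally have "(\<Sum>(a,b)\<leftarrow>?l. norm_inf_coeff a b) \<le> L" by simp
  moreover have "(\<Sum>(a,b)\<leftarrow>?l. a) = x" using martinet_turn_add martinet_P unfolding e_def by simp
  moreover have "(\<Sum>(a,b)\<leftarrow>?l. b) = y" by simp
  moreover have "martinet_height 0 ?l = (2 * m^3 - 2 * c^3 - 2 * d^3 + y^3) / 3" by (simp add: power2_eq_square power3_eq_cube field_simps)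
  moreover have "martinet_bound_2 L x y = (2 * m^3 - 2 * c^3 - 2 * d^3 + y^3) / 3"
    unfolding martinet_bound_2_def m_def c_def d_def ..
  ultimately show ?thesis by metis
qed

end

text \<open>For \<open>k \<ge> 0\<close>, the odd antiderivative of
  \<open>\<bar>u^2 - k^2\<bar>\<close>. Written with \<open>v * \<bar>v\<bar>\<close> for
  \<open>v = u - k\<close> and \<open>v = u + k\<close>, it is differentiable everywhere by
  \<open>DERIV_times_abs\<close> and Lipschitz on balls by its form.\<close>

definition abs_diff_squares_integral :: "real \<Rightarrow> real \<Rightarrow> real" where
  "abs_diff_squares_integral k u = (u + - k) * ((u + - k) * \<bar>u + - k\<bar>) / 3 + k * ((u + - k) * \<bar>u + - k\<bar>)
     - (u + k) * ((u + k) * \<bar>u + k\<bar>) / 3 + k * ((u + k) * \<bar>u + k\<bar>) + u^3 / 3 - k^2 * u"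

lemma DERIV_abs_diff_squares_integral:
  assumes "0 \<le> k"
  shows "(abs_diff_squares_integral k has_real_derivative \<bar>u^2 - k^2\<bar>) (at u)"
proof -
  have T: "((\<lambda>u. (u + a) * \<bar>u + a\<bar>) has_real_derivative 2 * \<bar>u + a\<bar>) (at u)" for a
    using DERIV_chain2[OF DERIV_times_abs[of "u + a"] DERIV_add[OF DERIV_ident DERIV_const]] by simp
  have lin: "((\<lambda>u. u + a) has_real_derivative 1) (at u)" for a :: real
    by (auto intro!: derivative_eq_intros)
  have T3: "((\<lambda>u. (u + a) * ((u + a) * \<bar>u + a\<bar>)) has_real_derivative 3 * ((u + a) * \<bar>u + a\<bar>)) (at u)" for a
    using DERIV_mult[OF lin T[of a], of a] by (simp add: algebra_simps)
  have poly: "((\<lambda>u. u^3 / 3) has_real_derivative u^2) (at u)" by (auto intro!: derivative_eq_intros)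
  have "(abs_diff_squares_integral k has_real_derivative
      3 * ((u + - k) * \<bar>u + - k\<bar>) / 3 + k * (2 * \<bar>u + - k\<bar>) - 3 * ((u + k) * \<bar>u + k\<bar>) / 3 + k * (2 * \<bar>u + k\<bar>) + u^2 - k^2) (at u)"
    using DERIV_diff[OF DERIV_add[OF DERIV_add[OF DERIV_diff[OF DERIV_add[OF DERIV_cdivide[OF T3[of "- k"], of 3] DERIV_cmult[OF T[of "- k"], of k]]
       DERIV_cdivide[OF T3[of k], of 3]] DERIV_cmult[OF T[of k], of k]] poly] DERIV_cmult[OF DERIV_ident, of "k^2"]]
    unfolding abs_diff_squares_integral_def by simp
  moreover have "3 * ((u + - k) * \<bar>u + - k\<bar>) / 3 + k * (2 * \<bar>u + - k\<bar>) - 3 * ((u + k) * \<bar>u + k\<bar>) / 3 + k * (2 * \<bar>u + k\<bar>) + u^2 - k^2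
      = \<bar>u^2 - k^2\<bar>"
  proof -
    have abs: "\<bar>u^2 - k^2\<bar> = \<bar>u + - k\<bar> * \<bar>u + k\<bar>"
      unfolding abs_mult[symmetric] by (simp add: power2_eq_square algebra_simps)
    show ?thesis unfolding abs using assms by (auto simp: abs_if power2_eq_square field_simps)
  qed
  ultimately show ?thesis by simp
qed

lemma abs_diff_squares_integral_minus: "abs_diff_squares_integral k (- u) = - abs_diff_squares_integral k u"
proof -
  have "\<bar>- u + - k\<bar> = \<bar>u + k\<bar>" "\<bar>- u + k\<bar> = \<bar>u + - k\<bar>" by linarith+
  then show ?thesis unfolding abs_diff_squares_integral_def
    by (simp only:) (simp add: power2_eq_square power3_eq_cube field_simps)
qed

lemma abs_diff_squares_integral_eq:
  assumes "0 \<le> k" "0 \<le> u"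
  shows "abs_diff_squares_integral k u = (if u \<le> k then k^2 * u - u^3 / 3 else u^3 / 3 - k^2 * u + 4 * k^3 / 3)"
proof -
  have "\<bar>u + k\<bar> = u + k" using assms by simp
  moreover have "\<bar>u + - k\<bar> = (if u \<le> k then k - u else u - k)" by auto
  ultimately show ?thesis unfolding abs_diff_squares_integral_def
    by (auto simp: power2_eq_square power3_eq_cube field_simps)
qed

lemma martinet_barrier_inf:
  assumes hor: "horizontal martinet_X1 martinet_X2 T \<gamma>" and T: "0 \<le> T" and g0: "\<gamma> 0 = 0"
    and len: "sf_length norm_inf_coeff martinet_X1 martinet_X2 T \<gamma> \<le> ennreal L" and L: "0 \<le> L" and s: "\<bar>s\<bar> = 1"
  shows "\<bar>\<gamma> T $ 1\<bar> \<le> L" "\<bar>\<gamma> T $ 2\<bar> \<le> L" "s * \<gamma> T $ 3 \<le> martinet_bound_2 L (s * \<gamma> T $ 1) \<bar>\<gamma> T $ 2\<bar>"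
proof -
  have cf: "continuous_on UNIV (\<lambda>q :: real^3. \<bar>q $ 2\<bar>)" by (intro continuous_intros)
  obtain t where t: "0 \<le> t" "t \<le> T" "\<And>\<tau>. 0 \<le> \<tau> \<Longrightarrow> \<tau> \<le> T \<Longrightarrow> \<bar>\<gamma> \<tau> $ 2\<bar> \<le> \<bar>\<gamma> t $ 2\<bar>"
    using horizontal_coord_attains_max[OF hor T cf] by blast
  define \<mu> x y where "\<mu> = \<bar>\<gamma> t $ 2\<bar>" and "x = \<gamma> T $ 1" and "y = \<bar>\<gamma> T $ 2\<bar>"
  have \<mu>: "0 \<le> y" "y \<le> \<mu>" using t(3)[of T] T unfolding \<mu>_def y_def by auto
  note cal = martinet_calibration[OF hor g0 len L t, folded \<mu>_def x_def y_def]
  define \<rho> :: real where "\<rho> = (if x \<ge> 0 then 1 else -1)"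
  have \<rho>: "\<rho> * x = \<bar>x\<bar>" by (auto simp: \<rho>_def)
  have "0 * \<gamma> T $ 3 + \<rho> * x + 2 * 0 - 0 \<le> 1 * L"
  proof (rule cal[where H="\<lambda>u. 0" and h="\<lambda>_. 0"])
    show "(0 * y\<^sup>2 + \<rho>) * w1 + 0 * \<bar>w2\<bar> \<le> 1 * norm_inf_coeff w1 w2" for y w1 w2
      by (auto simp: norm_inf_coeff_def \<rho>_def)
  qed (auto intro!: lipschitz_on_balls_intros derivative_eq_intros)
  then have x: "\<bar>x\<bar> \<le> L" using \<rho> by simp
  have "0 * \<gamma> T $ 3 + 0 * x + 2 * \<mu> - y \<le> 1 * L"
  proof (rule cal[where H="\<lambda>u. u" and h="\<lambda>_. 1"])
    show "(0 * y\<^sup>2 + 0) * w1 + 1 * \<bar>w2\<bar> \<le> 1 * norm_inf_coeff w1 w2" for y w1 w2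
      by (auto simp: norm_inf_coeff_def)
  qed (auto intro!: lipschitz_on_balls_intros derivative_eq_intros)
  then have b1: "2 * \<mu> \<le> L + y" by simp
  \<comment> \<open>The weights \<open>\<bar>u^2 - k^2\<bar>\<close> of \<open>w1\<close> and
    \<open>E - \<bar>u^2 - k^2\<bar>\<close> of \<open>w2\<close> add up to \<open>E\<close>, as the
    sup norm demands. The two conditions on \<open>E\<close> keep the second weight nonnegative for
    \<open>\<bar>u\<bar> \<le> \<mu>\<close>.\<close>
  have main: "s * \<gamma> T $ 3 \<le> martinet_F L (s * x) y k E \<mu>"
    if k: "0 \<le> k" "k \<le> \<mu>" and E: "k^2 \<le> E" "\<mu>^2 - k^2 \<le> E" for k E
  proof -
    let ?A = "abs_diff_squares_integral k"
    have small: "\<bar>u^2 - k^2\<bar> \<le> E" if u: "\<bar>u\<bar> \<le> \<mu>" for u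
    proof -
      have "u^2 \<le> \<mu>^2" using u by (metis abs_ge_zero power2_abs power_mono)
      then show ?thesis using E zero_le_power2[of u] by (intro abs_leI) linarith+
    qed
    have "s * \<gamma> T $ 3 + (- s * k^2) * x + 2 * (E * \<mu> - ?A \<mu>) - (E * y - ?A y) \<le> E * L"
    proof (rule cal[where H="\<lambda>u. E * u - ?A u" and h="\<lambda>u. E - \<bar>u^2 - k^2\<bar>"])
      show "((\<lambda>u. E * u - ?A u) has_real_derivative (E - \<bar>u^2 - k^2\<bar>)) (at u)" for u
        using DERIV_diff[OF DERIV_cmult[OF DERIV_ident] DERIV_abs_diff_squares_integral[OF k(1)], of E u] by simp
      show "E * (- u) - ?A (- u) = - (E * u - ?A u)" for u unfolding abs_diff_squares_integral_minus by simp
      show "lipschitz_on_balls (\<lambda>q :: real^3. E * q$2 - ?A (q$2))"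
        unfolding abs_diff_squares_integral_def by (intro lipschitz_on_balls_intros)
      show "0 \<le> E" using E(1) zero_le_power2[of k] by linarith
      fix u assume u: "\<bar>u\<bar> \<le> \<mu>"
      show "0 \<le> E - \<bar>u^2 - k^2\<bar>" using small[OF u] by simp
      fix w1 w2 :: real
      define M where "M = max \<bar>w1\<bar> \<bar>w2\<bar>"
      have "(s * u^2 + - s * k^2) * w1 = s * ((u^2 - k^2) * w1)" by (simp add: algebra_simps)
      also have "\<dots> \<le> \<bar>s * ((u^2 - k^2) * w1)\<bar>" by (rule abs_ge_self)
      also have "\<dots> = \<bar>u^2 - k^2\<bar> * \<bar>w1\<bar>" unfolding abs_mult s by (rule mult_1)
      also have "\<dots> \<le> \<bar>u^2 - k^2\<bar> * M" unfolding M_def by (intro mult_left_mono) auto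
      finally have "(s * u^2 + - s * k^2) * w1 \<le> \<bar>u^2 - k^2\<bar> * M" .
      moreover have "(E - \<bar>u^2 - k^2\<bar>) * \<bar>w2\<bar> \<le> (E - \<bar>u^2 - k^2\<bar>) * M"
        using small[OF u] unfolding M_def by (intro mult_left_mono) auto
      moreover have "\<bar>u^2 - k^2\<bar> * M + (E - \<bar>u^2 - k^2\<bar>) * M = E * M" by (simp add: left_diff_distrib)
      ultimately show "(s * u^2 + - s * k^2) * w1 + (E - \<bar>u^2 - k^2\<bar>) * \<bar>w2\<bar> \<le> E * norm_inf_coeff w1 w2"
        unfolding norm_inf_coeff_def M_def[symmetric] by linarith
    qed
    moreover have "?A \<mu> = \<mu>^3 / 3 - k^2 * \<mu> + 4 * k^3 / 3"
      using abs_diff_squares_integral_eq[OF k(1), of \<mu>] k \<mu> by (cases "\<mu> = k") (auto simp: power2_eq_square power3_eq_cube)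
    moreover have "?A y = martinet_J y k"
      using abs_diff_squares_integral_eq[OF k(1) \<mu>(1)] unfolding martinet_J_def by simp
    ultimately show ?thesis unfolding martinet_F_def by (simp add: algebra_simps)
  qed
  show "\<bar>\<gamma> T $ 1\<bar> \<le> L" "\<bar>\<gamma> T $ 2\<bar> \<le> L" using x b1 \<mu> unfolding x_def y_def by auto
  have "\<bar>s * x\<bar> \<le> L" using x s by (simp add: abs_mult)
  from le_martinet_bound_2[OF this \<mu>(1) _ \<mu>(2) b1 main] b1 \<mu>
  show "s * \<gamma> T $ 3 \<le> martinet_bound_2 L (s * \<gamma> T $ 1) \<bar>\<gamma> T $ 2\<bar>" unfolding x_def y_def by auto
qed

lemma steers_martinet_reach_inf:
  assumes p: "norm_inf_coeff (q$1) (q$2) \<le> L"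
    and z: "- martinet_bound_2 L (- q$1) \<bar>q$2\<bar> \<le> q$3" "q$3 \<le> martinet_bound_2 L (q$1) \<bar>q$2\<bar>"
  shows "steers norm_inf_coeff martinet_X1 martinet_X2 L 0 q"
proof (rule steers_martinet_symmetric[of norm_inf_coeff q L "\<lambda>x. martinet_bound_2 L x \<bar>q$2\<bar>"])
  fix x assume "norm_inf_coeff x (q$2) \<le> L"
  then have "\<bar>x\<bar> \<le> L" "0 \<le> \<bar>q$2\<bar>" "\<bar>q$2\<bar> \<le> L" by (auto simp: norm_inf_coeff_def)
  then show "\<exists>l. (\<Sum>(a,b)\<leftarrow>l. a) = x \<and> (\<Sum>(a,b)\<leftarrow>l. b) = \<bar>q$2\<bar> \<and> (\<Sum>(a,b)\<leftarrow>l. norm_inf_coeff a b) \<le> L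
      \<and> martinet_height 0 l = martinet_bound_2 L x \<bar>q$2\<bar>"
    by (rule martinet_inf_optimal_path)
qed (rule disjI1, rule refl, rule p, rule z, rule z)

text \<open>Reversing \<open>x\<close> reverses \<open>z\<close>, so the lower bound is the upper
  one at \<open>- q$1\<close>, and the two differ in general.\<close>

lemma martinet_barriers:
  assumes NB: "N = norm_one_coeff \<and> B = martinet_bound_1 \<or> N = norm_inf_coeff \<and> B = martinet_bound_2"
  shows "sublevel_barriers N martinet_X1 martinet_X2 3 (weights_3 3) (plane_norm N)
     (\<lambda>L q. B L (q$1) \<bar>q$2\<bar>) (\<lambda>L q. B L (- q$1) \<bar>q$2\<bar>)"
proof
  have N: "N = norm_inf_coeff \<or> N = norm_one_coeff" using NB by blast
  show "0 \<le> N w1 w2" for w1 w2 using N coeff_norm_simps by blast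
  show "N 0 0 = 0" using N coeff_norm_simps by blast
  show "1 \<le> weights_3 3 j" for j by (simp add: weights_3_def)
  show "steers N martinet_X1 martinet_X2 (k * L) (dilation (weights_3 3) k p) (dilation (weights_3 3) k q)"
    if "0 < k" "steers N martinet_X1 martinet_X2 L p q" for k L p q
    using that by (rule steers_martinet_dilation)
  show "plane_norm N (\<gamma> T) \<le> L \<and> - B L (- \<gamma> T $ 1) \<bar>\<gamma> T $ 2\<bar> \<le> \<gamma> T $ 3 \<and> \<gamma> T $ 3 \<le> B L (\<gamma> T $ 1) \<bar>\<gamma> T $ 2\<bar>"
    if *: "0 < L" "0 \<le> T" "horizontal martinet_X1 martinet_X2 T \<gamma>" "\<gamma> 0 = 0" "sf_length N martinet_X1 martinet_X2 T \<gamma> \<le> ennreal L"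
    for L T \<gamma>
    using NB
  proof
    assume NB: "N = norm_one_coeff \<and> B = martinet_bound_1"
    then have len: "sf_length norm_one_coeff martinet_X1 martinet_X2 T \<gamma> \<le> ennreal L" using *(5) by simp
    note b = martinet_barrier_one[OF *(3,2,4) len]
    show ?thesis using b[of 1] b[of "-1"] *(1) NB by (simp add: plane_norm_def norm_one_coeff_def)
  next
    assume NB: "N = norm_inf_coeff \<and> B = martinet_bound_2"
    then have len: "sf_length norm_inf_coeff martinet_X1 martinet_X2 T \<gamma> \<le> ennreal L" using *(5) by simp
    note b = martinet_barrier_inf[OF *(3,2,4) len]
    show ?thesis using b[of 1] b[of "-1"] *(1) NB by (simp add: plane_norm_def norm_inf_coeff_def)
  qed
  show "steers N martinet_X1 martinet_X2 L 0 q"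
    if "0 < L" "plane_norm N q \<le> L" "- B L (- q$1) \<bar>q$2\<bar> \<le> q $ 3" "q $ 3 \<le> B L (q$1) \<bar>q$2\<bar>" for L q
    using NB steers_martinet_reach_one[of q L] steers_martinet_reach_inf[of q L] that unfolding plane_norm_def by auto
  show "\<exists>h>0. \<exists>h'>0. steers N martinet_X1 martinet_X2 L q (q + axis 3 h) \<and> steers N martinet_X1 martinet_X2 L q (q - axis 3 h')"
    if "0 < L" for L q using N that by (rule steers_martinet_loop)
  show "B L ((q + axis 3 h)$1) \<bar>(q + axis 3 h)$2\<bar> = B L (q$1) \<bar>q$2\<bar>" for L h and q :: "real^3" by (simp add: axis_def)
  show "B L (- (q + axis 3 h)$1) \<bar>(q + axis 3 h)$2\<bar> = B L (- q$1) \<bar>q$2\<bar>" for L h and q :: "real^3" by (simp add: axis_def)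
  have sq: "2 - sqrt 2 / 2 \<noteq> 0" "2 - 2 * (sqrt 2 / 2) \<noteq> 0"
    using real_less_lsqrt[of 2 2] by auto
  have c: "continuous_on UNIV (\<lambda>z :: real \<times> (real^3). martinet_bound_1 (fst z) (\<sigma> * snd z $ 1) \<bar>snd z $ 2\<bar>)"
    "continuous_on UNIV (\<lambda>z :: real \<times> (real^3). martinet_bound_2 (fst z) (\<sigma> * snd z $ 1) \<bar>snd z $ 2\<bar>)" for \<sigma>
    unfolding martinet_bound_1_def martinet_bound_2_def martinet_turn_inf_def martinet_peak_inf_def Let_def
    using sq by (intro continuous_intros; simp)+
  show "continuous_on UNIV (\<lambda>z :: real \<times> (real^3). B (fst z) (snd z $ 1) \<bar>snd z $ 2\<bar>)" using NB c[of 1] by auto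
  show "continuous_on UNIV (\<lambda>z :: real \<times> (real^3). B (fst z) (- snd z $ 1) \<bar>snd z $ 2\<bar>)" using NB c[of "-1"] by auto
  have p: "piecewise_poly (\<lambda>q :: real^3. martinet_bound_1 L (\<sigma> * q $ 1) \<bar>q $ 2\<bar>)"
    "piecewise_poly (\<lambda>q :: real^3. martinet_bound_2 L (\<sigma> * q $ 1) \<bar>q $ 2\<bar>)" for \<sigma> L
    unfolding martinet_bound_1_def martinet_bound_2_def martinet_turn_inf_def martinet_peak_inf_def Let_def
    by (intro piecewise_poly_intros)+
  show "piecewise_poly (\<lambda>q :: real^3. B L (q $ 1) \<bar>q $ 2\<bar>)" for L using NB p[of L 1] by auto
  show "piecewise_poly (\<lambda>q :: real^3. B L (- q $ 1) \<bar>q $ 2\<bar>)" for L using NB p[of L "-1"] by auto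
qed (use NB plane_norm_regular in auto)

theorem mainTheorem1:
  fixes r :: real
  assumes "r > 0"
  shows
   "(\<forall>N\<in>{norm_inf_coeff, norm_one_coeff}.
       (let S = sf_sphere N heis_X1 heis_X2 r in
          S homeomorphic sphere (0::real^3) 1 \<and> rectifiable_set TYPE(real^2) S \<and> semianalytic S) \<and>
       (let S = sf_sphere N grushin_X1 grushin_X2 r in
          S homeomorphic sphere (0::real^2) 1 \<and> rectifiable_set TYPE(real^1) S \<and> semianalytic S) \<and>
       (let S = sf_sphere N martinet_X1 martinet_X2 r in
          S homeomorphic sphere (0::real^3) 1 \<and> rectifiable_set TYPE(real^2) S \<and> semianalytic S))"
proof
  fix N assume "N \<in> {norm_inf_coeff, norm_one_coeff}"
  then have N: "N = norm_inf_coeff \<or> N = norm_one_coeff" by simp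
  define UH where "UH = (if N = norm_one_coeff then heis_bound_one else heis_bound_inf)"
  define UG where "UG = (if N = norm_one_coeff then grushin_bound_one else grushin_bound_inf)"
  define B where "B = (if N = norm_one_coeff then martinet_bound_1 else martinet_bound_2)"
  interpret heis: sublevel_barriers N heis_X1 heis_X2 3 "weights_3 2" "plane_norm N" UH UH
    by (rule heis_barriers) (use N in \<open>auto simp: UH_def\<close>)
  interpret grushin: sublevel_barriers N grushin_X1 grushin_X2 2 grushin_e "\<lambda>q. \<bar>q$1\<bar>" UG UG
    by (rule grushin_barriers) (use N in \<open>auto simp: UG_def\<close>)
  interpret martinet: sublevel_barriers N martinet_X1 martinet_X2 3 "weights_3 3" "plane_norm N"
      "\<lambda>L q. B L (q$1) \<bar>q$2\<bar>" "\<lambda>L q. B L (- q$1) \<bar>q$2\<bar>"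
    by (rule martinet_barriers) (use N in \<open>auto simp: B_def\<close>)
  \<comment> \<open>One list serves both three-dimensional cases, whose \<open>ell\<close> is
    \<open>plane_norm N\<close>.\<close>
  obtain l3 :: "(3 \<times> (real^3 \<Rightarrow> real)) list" where l3:
    "\<forall>j f. (j,f)\<in>set l3 \<longrightarrow> piecewise_poly f \<and> (\<forall>q t. f (\<chi> k. if k = j then t else q$k) = f q)"
    "\<forall>q. plane_norm N q = r \<longrightarrow> (\<exists>(j,f)\<in>set l3. q$j = f q)"
    using plane_norm_level_graph[OF N, of r] by (elim exE conjE) (rule that)
  obtain l2 :: "(2 \<times> (real^2 \<Rightarrow> real)) list" where l2:
    "\<forall>j f. (j,f)\<in>set l2 \<longrightarrow> piecewise_poly f \<and> (\<forall>q t. f (\<chi> k. if k = j then t else q$k) = f q)"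
    "\<forall>q :: real^2. \<bar>q$1\<bar> = r \<longrightarrow> (\<exists>(j,f)\<in>set l2. q$j = f q)"
    using grushin_ell_graph[of r] by (elim exE conjE) (rule that)
  have "rectifiable_set TYPE(real^2) (sf_sphere N heis_X1 heis_X2 r)"
    by (rule heis.rectifiable_sphere[OF assms _ l3(1)[rule_format] l3(2)[rule_format]]) simp_all
  moreover have "rectifiable_set TYPE(real^1) (sf_sphere N grushin_X1 grushin_X2 r)"
    by (rule grushin.rectifiable_sphere[OF assms _ l2(1)[rule_format] l2(2)[rule_format]]) simp_all
  moreover have "rectifiable_set TYPE(real^2) (sf_sphere N martinet_X1 martinet_X2 r)"
    by (rule martinet.rectifiable_sphere[OF assms _ l3(1)[rule_format] l3(2)[rule_format]]) simp_all
  ultimately show "(let S = sf_sphere N heis_X1 heis_X2 r in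
          S homeomorphic sphere (0::real^3) 1 \<and> rectifiable_set TYPE(real^2) S \<and> semianalytic S) \<and>
       (let S = sf_sphere N grushin_X1 grushin_X2 r in
          S homeomorphic sphere (0::real^2) 1 \<and> rectifiable_set TYPE(real^1) S \<and> semianalytic S) \<and>
       (let S = sf_sphere N martinet_X1 martinet_X2 r in
          S homeomorphic sphere (0::real^3) 1 \<and> rectifiable_set TYPE(real^2) S \<and> semianalytic S)"
    unfolding Let_def
    using heis.homeomorphic_sphere[OF assms] heis.semianalytic_sphere[OF assms]
      grushin.homeomorphic_sphere[OF assms] grushin.semianalytic_sphere[OF assms]
      martinet.homeomorphic_sphere[OF assms] martinet.semianalytic_sphere[OF assms] by blast
qed

end
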